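(* Let $\mathbf p=(p_k)_{k\ge0}$ be a probability mass function on $\{0,1,2,\dots\}$, let $Z\sim\mathbf p$ and assume $\mathbb E[Z]<\infty$. Let $c\in(0,1)$. Then the random variable $\mathcal R_{\emptyset,c}(\infty)$ defined in the context is finite almost surely, and for every continuity point $r$ of the distribution of $\mathcal R_{\emptyset,c}(\infty)$, $$\frac1n\sum_{v\in\mathcal T_n(\mathbf p)}\mathbf 1\{R_{v,c}(n)>r\}\ \xrightarrow{P}\ \mathbb P(\mathcal R_{\emptyset,c}(\infty)>r)\qquad(n\to\infty).$$
   Context: Discrete model. Let $Z_1,Z_2,\dots$ be i.i.d. with law $\mathbf p$. The random trees $\mathcal T_n=\mathcal T_n(\mathbf p)$, $n\ge1$, are rooted at $v_0$, with edges directed from children to parents. $\mathcal T_1$ has vertices $v_0,v_1$ and a directed edge from $v_1$ to $v_0$. Given $\mathcal T_n$ with vertex set $\{v_0,\dots,v_n\}$, a new vertex $v_{n+1}$ selects a vertex $V_n$ uniformly at random from $\{v_0,\dots,v_n\}$ and attaches (by a directed edge from $v_{n+1}$) to the vertex at distance $\min(Z_{n+1},\mathrm{dist}(v_0,V_n))$ from $V_n$ on the path from $V_n$ to $v_0$. Here $V_n$ and $Z_{n+1}$ are independent of each other and $Z_{n+1}$ is independent of the past. PageRank. For $v\in\mathcal T_n$ let $P_l(v,n)$ be the number of directed paths of length $l$ in $\mathcal T_n$ that end at $v$. The graph normalized PageRank score with damping factor $c$ is $R_{v,c}(n)=(1-c)\big(1+\sum_{l\ge1}c^lP_l(v,n)\big)$.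 Limit variable. $\mathcal T^*(t)$, $t\ge0$, is the continuous time tree process starting at time $0$ from a single root vertex $\emptyset$, in which every existing vertex $v$ reproduces independently at rate one; when $v$ reproduces, an independent $Z\sim\mathbf p$ is sampled; if $Z\le\mathrm{dist}(\emptyset,v)$ then a new vertex is attached as a child to the vertex $u$ on the path from $v$ to the root with $\mathrm{dist}(v,u)=Z$; if $Z>\mathrm{dist}(\emptyset,v)$ nothing happens. Let $\tau\sim\mathrm{Exp}(1)$ be independent of $\mathcal T^*$, and let $P_l(\emptyset)$ be the number of directed paths of length $l$ ending at the root in $\mathcal T^*(\tau)$ (edges directed from child to parent), i.e. the number of vertices at distance $l$ from the root. Then $\mathcal R_{\emptyset,c}(\infty)=(1-c)\big(1+\sum_{l=1}^\infty c^lP_l(\emptyset)\big)$. *)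

theory Defs
  imports "HOL-Probability.Probability"
begin

section \<open>PageRank on directed graphs\<close>

text \<open>A directed graph is given by its set of arcs; a pair \<open>(u, w)\<close> is an arc from \<open>u\<close> to \<open>w\<close>.
  In the trees below the arcs run from children to parents.\<close>

definition dpaths :: "('v \<times> 'v) set \<Rightarrow> nat \<Rightarrow> 'v \<Rightarrow> 'v list set" where
  "dpaths A l v =
     {xs. length xs = Suc l \<and> distinct xs \<and> last xs = v \<and> successively (\<lambda>x y. (x, y) \<in> A) xs}"

text \<open>The number of paths is an extended number, so the score is \<open>\<infinity>\<close> when the series diverges
  or when infinitely many paths of some length end at \<open>v\<close>.
  On a finite graph it is always finite when \<open>0 < c < 1\<close>.\<close>

definition pagerank :: "real \<Rightarrow> ('v \<times> 'v) set \<Rightarrow> 'v \<Rightarrow> ennreal" where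
  "pagerank c A v =
     ennreal (1 - c) * (1 + (\<Sum>l. ennreal (c ^ Suc l) * emeasure (count_space UNIV) (dpaths A (Suc l) v)))"

section \<open>The discrete trees\<close>

text \<open>The vertex \<open>v\<^sub>i\<close> is the number \<open>i\<close>. A tree is encoded by a parent map \<open>par\<close>, where the root \<open>0\<close>
  (and every number that is not a vertex yet) is sent to \<open>0\<close>.\<close>

definition root_dist :: "(nat \<Rightarrow> nat) \<Rightarrow> nat \<Rightarrow> nat" where
  "root_dist par v = (LEAST k. (par ^^ k) v = 0)"

text \<open>\<open>tree_parent V Z n\<close> is the parent map of the tree on \<open>{0..n}\<close>, for realised selections
  \<open>V 1, V 2, \<dots>\<close> and steps \<open>Z 1, Z 2, \<dots>\<close>. In the tree for \<open>n = 1\<close> the vertex \<open>1\<close> is attached to the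
  root \<open>0\<close>, so its parent map is constantly \<open>0\<close>.\<close>

fun tree_parent :: "(nat \<Rightarrow> nat) \<Rightarrow> (nat \<Rightarrow> nat) \<Rightarrow> nat \<Rightarrow> nat \<Rightarrow> nat" where
  "tree_parent V Z 0 = (\<lambda>_. 0)"
| "tree_parent V Z (Suc 0) = (\<lambda>_. 0)"
| "tree_parent V Z (Suc (Suc n)) =
     (let par = tree_parent V Z (Suc n); v = V (Suc n)
      in par(Suc (Suc n) := (par ^^ min (Z (Suc (Suc n))) (root_dist par v)) v))"

definition tree_arcs :: "(nat \<Rightarrow> nat) \<Rightarrow> (nat \<Rightarrow> nat) \<Rightarrow> nat \<Rightarrow> (nat \<times> nat) set" where
  "tree_arcs V Z n = {(i, tree_parent V Z n i) | i. i \<in> {1..n}}"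

section \<open>The continuous time tree\<close>

text \<open>Graphical construction. Potential vertices are lists: the root is \<open>[]\<close>, and \<open>k # v\<close> is the
  vertex that the \<open>k\<close>-th reproduction event of \<open>v\<close> (counted from \<open>0\<close>) may create. The
  time between the \<open>(k-1)\<close>-th and the \<open>k\<close>-th event of \<open>v\<close> (from the birth of \<open>v\<close> if \<open>k = 0\<close>) is
  \<open>E (v, k)\<close>, and the step sampled at the \<open>k\<close>-th event is \<open>Z (v, k)\<close>.

  \<open>root_path Z v\<close> is the path from \<open>v\<close> to the root in the tree, both ends included: \<open>k # v\<close> is
  attached to the vertex at distance \<open>Z (v, k)\<close> from \<open>v\<close> on the path from \<open>v\<close>.
  Note that \<open>v\<close> is the vertex whose clock rang and not in general the parent of \<open>k # v\<close>.\<close>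

primrec root_path :: "(nat list \<times> nat \<Rightarrow> nat) \<Rightarrow> nat list \<Rightarrow> nat list list" where
  "root_path Z [] = [[]]"
| "root_path Z (k # v) = (k # v) # drop (Z (v, k)) (root_path Z v)"

text \<open>The event leads to a new vertex iff the step is at most the distance
  \<open>length (root_path Z v) - 1\<close> of \<open>v\<close> from the root.\<close>

primrec is_created :: "(nat list \<times> nat \<Rightarrow> nat) \<Rightarrow> nat list \<Rightarrow> bool" where
  "is_created Z [] \<longleftrightarrow> True"
| "is_created Z (k # v) \<longleftrightarrow> is_created Z v \<and> Z (v, k) \<le> length (root_path Z v) - 1"

primrec birth_time :: "(nat list \<times> nat \<Rightarrow> real) \<Rightarrow> nat list \<Rightarrow> real" where
  "birth_time E [] = 0"
| "birth_time E (k # v) = birth_time E v + (\<Sum>j\<le>k. E (v, j))"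

definition ct_verts ::
  "(nat list \<times> nat \<Rightarrow> real) \<Rightarrow> (nat list \<times> nat \<Rightarrow> nat) \<Rightarrow> real \<Rightarrow> nat list set" where
  "ct_verts E Z t = {v. is_created Z v \<and> birth_time E v \<le> t}"

definition ct_arcs ::
  "(nat list \<times> nat \<Rightarrow> real) \<Rightarrow> (nat list \<times> nat \<Rightarrow> nat) \<Rightarrow> real \<Rightarrow> (nat list \<times> nat list) set" where
  "ct_arcs E Z t = {(v, root_path Z v ! 1) | v. v \<in> ct_verts E Z t \<and> v \<noteq> []}"

definition exp1 :: "real measure" where
  "exp1 = density lborel (\<lambda>x. ennreal (exponential_density 1 x))"

text \<open>The law of \<open>(E, Z, \<tau>)\<close>: all coordinates are independent, the waiting times and \<open>\<tau>\<close> are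
  exponential with rate one, and the steps have law \<open>p\<close>.\<close>

definition ct_space ::
  "nat pmf \<Rightarrow> ((nat list \<times> nat \<Rightarrow> real) \<times> (nat list \<times> nat \<Rightarrow> nat) \<times> real) measure" where
  "ct_space p = (\<Pi>\<^sub>M _\<in>UNIV. exp1) \<Otimes>\<^sub>M (\<Pi>\<^sub>M _\<in>UNIV. measure_pmf p) \<Otimes>\<^sub>M exp1"

definition pagerank_limit ::
  "real \<Rightarrow> (nat list \<times> nat \<Rightarrow> real) \<times> (nat list \<times> nat \<Rightarrow> nat) \<times> real \<Rightarrow> ennreal" where
  "pagerank_limit c = (\<lambda>(E, Z, \<tau>). pagerank c (ct_arcs E Z \<tau>) [])"

lemma prob_space_exp1: "prob_space exp1"
  unfolding exp1_def by (rule prob_space_exponential_density) simp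

lemma prob_space_ct_space: "prob_space (ct_space p)"
proof -
  have 1: "prob_space (\<Pi>\<^sub>M _\<in>(UNIV :: (nat list \<times> nat) set). exp1)"
    by (intro prob_space_PiM prob_space_exp1)
  have 2: "prob_space (\<Pi>\<^sub>M _\<in>(UNIV :: (nat list \<times> nat) set). measure_pmf p)"
    by (intro prob_space_PiM prob_space_measure_pmf)
  show ?thesis
    unfolding ct_space_def by (intro prob_space_pair 1 2 prob_space_exp1)
qed

lemma measurable_ct_coords:
  "(\<lambda>\<omega>. fst \<omega> i) \<in> borel_measurable (ct_space p)"
  "(\<lambda>\<omega>. fst (snd \<omega>) i) \<in> ct_space p \<rightarrow>\<^sub>M count_space UNIV"
  "(\<lambda>\<omega>. snd (snd \<omega>)) \<in> borel_measurable (ct_space p)"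
proof -
  have e: "(\<lambda>x. x) \<in> exp1 \<rightarrow>\<^sub>M borel" by (simp add: exp1_def)
  have "(\<lambda>\<omega>. fst \<omega> i) \<in> ct_space p \<rightarrow>\<^sub>M exp1"
    unfolding ct_space_def by measurable
  from measurable_compose[OF this e] show "(\<lambda>\<omega>. fst \<omega> i) \<in> borel_measurable (ct_space p)" .
  have "(\<lambda>\<omega>. fst (snd \<omega>) i) \<in> ct_space p \<rightarrow>\<^sub>M measure_pmf p"
    unfolding ct_space_def by measurable
  then show "(\<lambda>\<omega>. fst (snd \<omega>) i) \<in> ct_space p \<rightarrow>\<^sub>M count_space UNIV" by simp
  have "(\<lambda>\<omega>. snd (snd \<omega>)) \<in> ct_space p \<rightarrow>\<^sub>M exp1"
    unfolding ct_space_def by measurable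
  from measurable_compose[OF this e] show "(\<lambda>\<omega>. snd (snd \<omega>)) \<in> borel_measurable (ct_space p)" .
qed

lemma measurable_root_path:
  "(\<lambda>\<omega>. root_path (fst (snd \<omega>)) v) \<in> ct_space p \<rightarrow>\<^sub>M count_space UNIV"
proof (induction v)
  case (Cons k v)
  note [measurable] = Cons measurable_ct_coords
  show ?case by simp
qed simp

lemma measurable_ct_arcs:
  "Measurable.pred (ct_space p) (\<lambda>\<omega>. (u, w) \<in> ct_arcs (fst \<omega>) (fst (snd \<omega>)) (snd (snd \<omega>)))"
proof -
  note [measurable] = measurable_root_path measurable_ct_coords
  have [measurable]: "Measurable.pred (ct_space p) (\<lambda>\<omega>. is_created (fst (snd \<omega>)) v)" for v
  proof (induction v)
    case (Cons k v)
    have len: "(\<lambda>\<omega>. length (root_path (fst (snd \<omega>)) v) - 1) \<in> ct_space p \<rightarrow>\<^sub>M count_space UNIV"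
      by (rule measurable_compose[OF measurable_root_path, where g = "\<lambda>xs. length xs - 1"]) simp
    have "Measurable.pred (ct_space p)
        (\<lambda>\<omega>. fst (snd \<omega>) (v, k) \<le> length (root_path (fst (snd \<omega>)) v) - 1)"
      by (rule measurable_compose_countable[OF _ measurable_ct_coords(2),
            where f = "\<lambda>i \<omega>. i \<le> length (root_path (fst (snd \<omega>)) v) - 1"])
        (rule measurable_compose[OF len], simp)
    with Cons show ?case
      unfolding is_created.simps by (intro pred_intros_logic)
  qed simp
  have [measurable]: "(\<lambda>\<omega>. birth_time (fst \<omega>) v) \<in> borel_measurable (ct_space p)" for v
    by (induction v) simp_all
  show ?thesis
    unfolding ct_arcs_def ct_verts_def by simp
qed

lemma measurable_pagerank_limit: "pagerank_limit c \<in> borel_measurable (ct_space p)"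
proof -
  let ?A = "\<lambda>\<omega>. ct_arcs (fst \<omega>) (fst (snd \<omega>)) (snd (snd \<omega>))"
  note [measurable] = measurable_ct_arcs
  have succ [measurable]:
    "Measurable.pred (ct_space p) (\<lambda>\<omega>. successively (\<lambda>x y. (x, y) \<in> ?A \<omega>) xs)" for xs
    by (induction xs rule: induct_list012) simp_all
  have [measurable]: "Measurable.pred (ct_space p) (\<lambda>\<omega>. xs \<in> dpaths (?A \<omega>) l [])" for xs l
    unfolding dpaths_def by simp
  interpret C: sigma_finite_measure "count_space (UNIV :: nat list list set)"
    by (rule sigma_finite_measure_count_space)
  have "(\<lambda>\<omega>. emeasure (count_space UNIV) (dpaths (?A \<omega>) l [])) =
      (\<lambda>\<omega>. \<integral>\<^sup>+xs. indicator (dpaths (?A \<omega>) l []) xs \<partial>count_space UNIV)" for l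
    by simp
  moreover have "(\<lambda>\<omega>. \<integral>\<^sup>+xs. indicator (dpaths (?A \<omega>) l []) xs \<partial>count_space UNIV)
      \<in> borel_measurable (ct_space p)" for l
  proof (rule C.borel_measurable_nn_integral)
    have "(\<lambda>x. indicator (dpaths (?A (fst x)) l []) (snd x) :: ennreal)
        \<in> borel_measurable (ct_space p \<Otimes>\<^sub>M count_space UNIV)"
      by (rule measurable_compose_countable[where f = "\<lambda>xs x. indicator (dpaths (?A (fst x)) l []) xs" and g = snd])
        (auto simp: indicator_def)
    then show "(\<lambda>(\<omega>, xs). indicator (dpaths (?A \<omega>) l []) xs :: ennreal)
        \<in> borel_measurable (ct_space p \<Otimes>\<^sub>M count_space UNIV)"
      by (simp add: case_prod_beta)
  qed
  ultimately have [measurable]: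
    "(\<lambda>\<omega>. emeasure (count_space UNIV) (dpaths (?A \<omega>) l [])) \<in> borel_measurable (ct_space p)" for l
    by simp
  show ?thesis
    unfolding pagerank_limit_def pagerank_def case_prod_beta by measurable
qed

end

theory Submission
  imports Defs
begin

text \<open>
  The score of a vertex \<open>v\<close> depends only on the numbers of vertices at the various distances below
  it. For \<open>v\<close> other than the root, this profile is completed to the \<^emph>\<open>type\<close> of \<open>v\<close>. Call descendants of \<open>v\<close> the vertex \<open>v\<close> itself
  and all vertices that arrived when a descendant of \<open>v\<close> was selected. Every vertex below \<open>v\<close> in the
  tree is a descendant of \<open>v\<close>; it gets the label \<open>Some d\<close>, where \<open>d\<close> is its distance to \<open>v\<close>, and the
  other descendants get the label \<open>None\<close>. The type is the multiset of these labels.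
  It evolves autonomously: each member is selected at the same rate and then adds one
  member, whose label is a function of the label of the selected member and the step. So a type is
  an urn, with the same dynamics in the discrete and in the continuous model.

  \<^emph>\<open>Discrete time.\<close> Let \<open>N\<^sub>M\<close> be the number of vertices of type \<open>M\<close> among \<open>m\<close> vertices. In one step
  it grows in the mean by \<open>1\<close> if \<open>M\<close> is the type of a new vertex, plus \<open>1 / m\<close> times the rate at which
  smaller types turn into \<open>M\<close>, minus \<open>size M / m\<close> times \<open>N\<^sub>M\<close>. If the weights \<open>\<pi>\<^sub>M\<close> solve the
  corresponding stationary equation (\<open>urn_limit_forward\<close>), then \<open>N\<^sub>M - m \<pi>\<^sub>M\<close> has a homogeneous
  recursion, and by induction on the size of \<open>M\<close> its second moment is \<open>O(m)\<close>
  (\<open>discrepancy_second_moment\<close>). The increments are bounded, because the ancestors of a selected vertex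
  have sets of descendants of different sizes. Hence \<open>N\<^sub>M / m\<close> converges to \<open>\<pi>\<^sub>M\<close> in probability. As
  \<open>\<pi>\<close> is a probability distribution on a countable set, the fraction of vertices whose type belongs to
  a set \<open>S\<close> converges to \<open>\<pi>(S)\<close> for all sets \<open>S\<close> (\<open>type_fraction_converges\<close>), in particular for the
  types with score above \<open>r\<close>.

  \<^emph>\<open>Continuous time.\<close> At the first event of the root the process splits into two independent copies.
  From the resulting renewal equation, the population at time \<open>t\<close> equals \<open>M\<close> with probability
  \<open>exp (- t) * (1 - exp (- t)) ^ (size M - 1) * a M\<close>, where \<open>a M\<close> is the probability that the urn passes
  through \<open>M\<close> (\<open>pop_prob_eq\<close>). The induction step is the decomposition of the urn at its first step
  (\<open>urn_prob_backward\<close>), while \<open>a\<close> is defined by forward steps; the two agree because births act on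
  unions of independent populations by the Leibniz rule. Integration over the exponential time \<open>\<tau>\<close>
  gives the weights \<open>a M / (size M * (size M + 1))\<close>. They add up to one, so the tree is almost surely
  finite, and they satisfy the stationary equation, so they are the \<open>\<pi>\<^sub>M\<close> from above.
\<close>

section \<open>Urns with offspring\<close>

text \<open>A configuration is a multiset of individuals; each of them gives birth at rate one to an
  individual drawn from \<open>K\<close>, and nobody dies. This is the rate of births of an individual \<open>y\<close>.\<close>

definition birth_rate :: "('a \<Rightarrow> 'a pmf) \<Rightarrow> 'a multiset \<Rightarrow> 'a \<Rightarrow> real" where
  "birth_rate K M y = (\<Sum>x\<in>#M. pmf (K x) y)"

lemma birth_rate_union: "birth_rate K (M + N) y = birth_rate K M y + birth_rate K N y"
  by (simp add: birth_rate_def)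

lemma sum_mset_eq_sum_count:
  fixes f :: "'a \<Rightarrow> real"
  shows "(\<Sum>x\<in>#M. f x) = (\<Sum>x\<in>set_mset M. count M x * f x)"
proof (induction M)
  case (add x M)
  have "(\<Sum>y\<in>set_mset (add_mset x M). count (add_mset x M) y * f y) =
      (\<Sum>y\<in>insert x (set_mset M). count M y * f y + (if y = x then f x else 0))"
    by (intro sum.cong) (auto simp: algebra_simps)
  also have "\<dots> = (\<Sum>y\<in>insert x (set_mset M). count M y * f y) + f x"
    by (simp add: sum.distrib)
  also have "(\<Sum>y\<in>insert x (set_mset M). count M y * f y) = (\<Sum>y\<in>set_mset M. count M y * f y)"
    by (intro sum.mono_neutral_right) (auto simp: not_in_iff)
  finally show ?case using add by simp
qed simp

definition spawn :: "('a \<Rightarrow> 'a pmf) \<Rightarrow> 'a multiset \<Rightarrow> 'a multiset pmf" where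
  "spawn K M = pmf_of_multiset M \<bind> (\<lambda>x. map_pmf (\<lambda>y. add_mset y M) (K x))"

primrec urn :: "('a \<Rightarrow> 'a pmf) \<Rightarrow> 'a \<Rightarrow> nat \<Rightarrow> 'a multiset pmf" where
  "urn K x 0 = return_pmf {#x#}"
| "urn K x (Suc n) = urn K x n \<bind> spawn K"

lemma size_urn: "M \<in> set_pmf (urn K x n) \<Longrightarrow> size M = Suc n"
proof (induction n arbitrary: M)
  case (Suc n)
  then show ?case by (auto simp: spawn_def)
qed simp

lemma pmf_spawn:
  assumes "M \<noteq> {#}"
  shows "pmf (spawn K M) (add_mset y M) = birth_rate K M y / size M"
proof -
  have inj: "inj (\<lambda>y. add_mset y M)" by (auto intro: injI)
  have "pmf (spawn K M) (add_mset y M) =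
      measure_pmf.expectation (pmf_of_multiset M) (\<lambda>x. pmf (K x) y)"
    unfolding spawn_def pmf_bind using pmf_map_inj'[OF inj] by simp
  also have "\<dots> = (\<Sum>x\<in>set_mset M. pmf (K x) y * (count M x / size M))"
    by (subst integral_measure_pmf_real[where A="set_mset M"]) (use assms in auto)
  also have "\<dots> = (\<Sum>x\<in>set_mset M. count M x * pmf (K x) y) / size M"
    by (simp add: sum_divide_distrib mult.commute)
  also have "(\<Sum>x\<in>set_mset M. count M x * pmf (K x) y) = birth_rate K M y"
    by (simp add: birth_rate_def sum_mset_eq_sum_count)
  finally show ?thesis .
qed

lemma pmf_spawn_eq_0: "(\<And>y. N \<noteq> add_mset y M) \<Longrightarrow> M \<noteq> {#} \<Longrightarrow> pmf (spawn K M) N = 0"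
  by (auto simp: spawn_def pmf_eq_0_set_pmf)

definition parents_sum :: "('a \<Rightarrow> 'a pmf) \<Rightarrow> ('a multiset \<Rightarrow> real) \<Rightarrow> 'a multiset \<Rightarrow> real" where
  "parents_sum K F M = (\<Sum>y\<in>set_mset M. birth_rate K (M - {#y#}) y * F (M - {#y#}))"

text \<open>As the size of the urn grows by one in each step, a configuration can be reached at one time only.\<close>

definition urn_prob :: "('a \<Rightarrow> 'a pmf) \<Rightarrow> 'a \<Rightarrow> 'a multiset \<Rightarrow> real" where
  "urn_prob K x M = pmf (urn K x (size M - 1)) M"

lemma urn_prob_empty [simp]: "urn_prob K x {#} = 0"
  by (simp add: urn_prob_def)

lemma urn_prob_single: "urn_prob K x {#y#} = of_bool (x = y)"
  by (auto simp: urn_prob_def)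

text \<open>Conditioning on the last step. The factor \<open>size M - 1\<close> is the number of individuals before that
  step; for sizes 0 and 1 both sides vanish, so the identity can be used without side conditions.\<close>

lemma urn_prob_forward: "(real (size M) - 1) * urn_prob K x M = parents_sum K (urn_prob K x) M"
proof -
  consider "M = {#}" | y where "M = {#y#}" | n where "size M = Suc (Suc n)"
    by (metis One_nat_def nat.exhaust_sel size_eq_0_iff_empty size_1_singleton_mset)
  then show ?thesis
  proof cases
    case (3 n)
    let ?P = "(\<lambda>y. M - {#y#}) ` set_mset M"
    have inj: "inj_on (\<lambda>y. M - {#y#}) (set_mset M)"
    proof (rule inj_onI)
      fix y z assume "y \<in># M" "z \<in># M" "M - {#y#} = M - {#z#}"
      then have "add_mset y (M - {#z#}) = add_mset z (M - {#z#})" by (metis insert_DiffM)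
      then show "y = z" by simp
    qed
    have nz: "N \<noteq> {#}" if "N \<in> set_pmf (urn K x n)" for N
      using size_urn[OF that] by auto
    have "urn_prob K x M = measure_pmf.expectation (urn K x n) (\<lambda>N. pmf (spawn K N) M)"
      using 3 by (simp add: urn_prob_def pmf_bind)
    also have "\<dots> = (\<Sum>N\<in>?P. pmf (spawn K N) M * pmf (urn K x n) N)"
    proof (rule integral_measure_pmf_real)
      fix N assume N: "N \<in> set_pmf (urn K x n)" "pmf (spawn K N) M \<noteq> 0"
      then obtain y where "M = add_mset y N" using pmf_spawn_eq_0 nz by metis
      then show "N \<in> ?P" by (auto intro!: image_eqI[of _ _ y])
    qed simp
    also have "\<dots> = (\<Sum>y\<in>set_mset M. pmf (spawn K (M - {#y#})) M * pmf (urn K x n) (M - {#y#}))"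
      using inj by (simp add: sum.reindex)
    also have "\<dots> = (\<Sum>y\<in>set_mset M. birth_rate K (M - {#y#}) y * urn_prob K x (M - {#y#}) / Suc n)"
    proof (rule sum.cong)
      fix y assume y: "y \<in># M"
      then have s: "size (M - {#y#}) = Suc n" using 3 by (simp add: size_Diff_singleton)
      have "pmf (spawn K (M - {#y#})) (add_mset y (M - {#y#})) = birth_rate K (M - {#y#}) y / size (M - {#y#})"
        by (rule pmf_spawn) (use s in auto)
      then show "pmf (spawn K (M - {#y#})) M * pmf (urn K x n) (M - {#y#}) =
        birth_rate K (M - {#y#}) y * urn_prob K x (M - {#y#}) / Suc n"
        using y s by (simp add: urn_prob_def)
    qed simp
    finally show ?thesis
      using 3 by (simp add: parents_sum_def sum_divide_distrib[symmetric])
  qed (simp_all add: parents_sum_def birth_rate_def)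
qed

lemma finite_submultisets: "finite {N. N \<subseteq># M}"
proof (induction M)
  case (add x M)
  have "{N. N \<subseteq># add_mset x M} \<subseteq> {N. N \<subseteq># M} \<union> add_mset x ` {N. N \<subseteq># M}"
  proof
    fix N assume N: "N \<in> {N. N \<subseteq># add_mset x M}"
    show "N \<in> {N. N \<subseteq># M} \<union> add_mset x ` {N. N \<subseteq># M}"
    proof (cases "x \<in># N")
      case True
      then obtain N' where "N = add_mset x N'" by (metis insert_DiffM)
      then show ?thesis using N by auto
    next
      case False
      then show ?thesis using N by (auto simp: subseteq_mset_def not_in_iff split: if_splits) (metis le0)
    qed
  qed
  then show ?case using add finite_subset by blast
qed simp

text \<open>The convolution on the monoid of multisets: if \<open>F\<close> and \<open>G\<close> are laws, this is the law of the union
  of two independent populations.\<close>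

definition splitting_sum :: "('a multiset \<Rightarrow> real) \<Rightarrow> ('a multiset \<Rightarrow> real) \<Rightarrow> 'a multiset \<Rightarrow> real" where
  "splitting_sum F G M = (\<Sum>N\<in>{N. N \<subseteq># M}. F N * G (M - N))"

lemma splitting_sum_commute: "splitting_sum F G M = splitting_sum G F M"
  unfolding splitting_sum_def
  by (rule sum.reindex_bij_witness[of _ "\<lambda>N. M - N" "\<lambda>N. M - N"])
    (auto simp: multiset_eq_iff subseteq_mset_def mult.commute intro!: arg_cong2[where f="(*)"] arg_cong[where f=F] arg_cong[where f=G])

text \<open>If the last newborn \<open>y\<close> belongs to the first part of \<open>M\<close>, then removing \<open>y\<close> and splitting the
  rest is the same as splitting \<open>M\<close> and removing \<open>y\<close> from the first part.\<close>

lemma parents_sum_splitting_sum_aux: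
  "(\<Sum>y\<in>set_mset M. \<Sum>N\<in>{N. N \<subseteq># M - {#y#}}. birth_rate K N y * F N * G (M - {#y#} - N)) =
   splitting_sum (parents_sum K F) G M"
proof -
  have "(\<Sum>y\<in>set_mset M. \<Sum>N\<in>{N. N \<subseteq># M - {#y#}}. birth_rate K N y * F N * G (M - {#y#} - N)) =
      (\<Sum>(y, N)\<in>(SIGMA y:set_mset M. {N. N \<subseteq># M - {#y#}}). birth_rate K N y * F N * G (M - {#y#} - N))"
    by (intro sum.Sigma) (auto simp: finite_submultisets)
  also have "\<dots> = (\<Sum>(N, y)\<in>(SIGMA N:{N. N \<subseteq># M}. set_mset N).
      birth_rate K (N - {#y#}) y * F (N - {#y#}) * G (M - N))"
    by (rule sum.reindex_bij_witness[of _ "\<lambda>(N, y). (y, N - {#y#})" "\<lambda>(y, N). (add_mset y N, y)"])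
       (auto simp: insert_subset_eq_iff subset_eq_diff_conv mset_subset_eqD)
  also have "\<dots> = (\<Sum>N\<in>{N. N \<subseteq># M}. \<Sum>y\<in>set_mset N.
      birth_rate K (N - {#y#}) y * F (N - {#y#}) * G (M - N))"
    by (intro sum.Sigma[symmetric]) (auto simp: finite_submultisets)
  also have "\<dots> = splitting_sum (parents_sum K F) G M"
    by (simp add: splitting_sum_def parents_sum_def sum_distrib_right)
  finally show ?thesis .
qed

text \<open>The Leibniz rule: birth rates are additive, so the next birth happens in exactly one of the two
  parts of a split population.\<close>

lemma parents_sum_splitting_sum:
  "parents_sum K (splitting_sum F G) M = splitting_sum (parents_sum K F) G M + splitting_sum F (parents_sum K G) M"
proof -
  have "parents_sum K (splitting_sum F G) M = (\<Sum>y\<in>set_mset M. \<Sum>N\<in>{N. N \<subseteq># M - {#y#}}.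
      birth_rate K (M - {#y#}) y * (F N * G (M - {#y#} - N)))"
    by (simp add: parents_sum_def splitting_sum_def sum_distrib_left)
  also have "\<dots> = (\<Sum>y\<in>set_mset M. \<Sum>N\<in>{N. N \<subseteq># M - {#y#}}.
      birth_rate K N y * F N * G (M - {#y#} - N)) +
    (\<Sum>y\<in>set_mset M. \<Sum>N\<in>{N. N \<subseteq># M - {#y#}}.
      birth_rate K (M - {#y#} - N) y * G (M - {#y#} - N) * F N)"
    unfolding sum.distrib[symmetric]
  proof (intro sum.cong refl)
    fix y N assume "N \<in> {N. N \<subseteq># M - {#y#}}"
    then have "M - {#y#} = N + (M - {#y#} - N)"
      by (metis mem_Collect_eq subset_mset.add_diff_inverse)
    then have "birth_rate K (M - {#y#}) y = birth_rate K N y + birth_rate K (M - {#y#} - N) y"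
      by (metis birth_rate_union)
    then show "birth_rate K (M - {#y#}) y * (F N * G (M - {#y#} - N)) =
      birth_rate K N y * F N * G (M - {#y#} - N) + birth_rate K (M - {#y#} - N) y * G (M - {#y#} - N) * F N"
      by (simp only:) (simp add: algebra_simps)
  qed
  also have "(\<Sum>y\<in>set_mset M. \<Sum>N\<in>{N. N \<subseteq># M - {#y#}}.
      birth_rate K (M - {#y#} - N) y * G (M - {#y#} - N) * F N) =
      (\<Sum>y\<in>set_mset M. \<Sum>N\<in>{N. N \<subseteq># M - {#y#}}.
      birth_rate K N y * G N * F (M - {#y#} - N))"
  proof (rule sum.cong[OF refl])
    fix y
    show "(\<Sum>N\<in>{N. N \<subseteq># M - {#y#}}. birth_rate K (M - {#y#} - N) y * G (M - {#y#} - N) * F N) =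
      (\<Sum>N\<in>{N. N \<subseteq># M - {#y#}}. birth_rate K N y * G N * F (M - {#y#} - N))"
      using splitting_sum_commute[of F "\<lambda>N. birth_rate K N y * G N" "M - {#y#}"]
      by (simp add: splitting_sum_def mult_ac)
  qed
  also have "\<dots> = splitting_sum (parents_sum K G) F M" by (rule parents_sum_splitting_sum_aux)
  also have "\<dots> = splitting_sum F (parents_sum K G) M" by (rule splitting_sum_commute)
  also note parents_sum_splitting_sum_aux
  finally show ?thesis .
qed


text \<open>A union of two independent urns, each weighted by its own urn law, is an eigenvector of the birth
  operator: by the Leibniz rule the factors \<open>size N - 1\<close> of the two parts add up to \<open>size M - 2\<close>.\<close>

lemma splitting_sum_urn_prob_derivation:
  "parents_sum K (splitting_sum (urn_prob K x) (urn_prob K y)) M =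
   (real (size M) - 2) * splitting_sum (urn_prob K x) (urn_prob K y) M"
proof -
  have *: "parents_sum K (urn_prob K z) = (\<lambda>M. (real (size M) - 1) * urn_prob K z M)" for z
    by (rule ext) (rule urn_prob_forward[symmetric])
  show ?thesis
    unfolding parents_sum_splitting_sum * unfolding splitting_sum_def sum.distrib[symmetric] sum_distrib_left
  proof (intro sum.cong refl)
    fix N assume "N \<in> {N. N \<subseteq># M}"
    then have "real (size (M - N)) = real (size M) - real (size N)"
      by (simp add: size_Diff_submset size_mset_mono of_nat_diff)
    then show "(real (size N) - 1) * urn_prob K x N * urn_prob K y (M - N) +
        urn_prob K x N * ((real (size (M - N)) - 1) * urn_prob K y (M - N)) =
        (real (size M) - 2) * (urn_prob K x N * urn_prob K y (M - N))"
      by (simp only:) (simp add: algebra_simps)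
  qed
qed

text \<open>Conditioning on the first birth. After it the urn consists of two individuals \<open>x\<close> and \<open>y\<close>, whose
  families evolve as independent urns, and by Polya's urn the size of the first family is uniform
  on \<open>{1..size M - 1}\<close>; this explains the factor on the left. In the proof both sides are seen to
  satisfy the same forward recursion in the size of \<open>M\<close>.\<close>

lemma urn_prob_backward:
  assumes "finite Y" "set_pmf (K x) \<subseteq> Y" "size M \<ge> 2"
  shows "(real (size M) - 1) * urn_prob K x M =
    (\<Sum>y\<in>Y. pmf (K x) y * splitting_sum (urn_prob K x) (urn_prob K y) M)"
  using assms(3)
proof (induction "size M" arbitrary: M rule: less_induct)
  case less
  show ?case
  proof (cases "size M = 2")
    case True
    then obtain a b where M: "M = {#a, b#}"
      by (metis (no_types, opaque_lifting) Suc_1 One_nat_def size_eq_Suc_imp_eq_union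
          size_1_singleton_mset union_mset_add_mset_left add_mset_add_single diff_Suc_1 size_mset_SucE)
    have *: "splitting_sum (urn_prob K x) (urn_prob K y) M =
      (if a = b then of_bool (x = a \<and> y = b) else of_bool (x = a \<and> y = b) + of_bool (x = b \<and> y = a))" for y
    proof -
      have S: "{N. N \<subseteq># M} = {{#}, {#a#}, {#b#}, {#a, b#}}"
      proof (intro equalityI subsetI)
        fix N assume "N \<in> {N. N \<subseteq># M}"
        then have "N \<subseteq># M" by simp
        then obtain C where C: "M = N + C" by (auto simp: subset_mset.le_iff_add)
        then have "size N + size C = 2" using True by simp
        then consider "size N = 0" | "size N = 1" | "size N = 2" "size C = 0" by linarith
        then show "N \<in> {{#}, {#a#}, {#b#}, {#a, b#}}"
        proof cases
          case 2
          then obtain u where u: "N = {#u#}" by (metis size_1_singleton_mset)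
          then have "u \<in># M" using C by simp
          then show ?thesis using u M by auto
        qed (use M C in auto)
      qed (auto simp: M)
      show ?thesis
      proof (cases "a = b")
        case True
        have "splitting_sum (urn_prob K x) (urn_prob K y) M = (\<Sum>N\<in>{{#}, {#a#}, {#a, a#}}. urn_prob K x N * urn_prob K y (M - N))"
          unfolding splitting_sum_def S using True by simp
        also have "\<dots> = of_bool (x = a \<and> y = a)"
          using True by (simp add: M urn_prob_single)
        finally show ?thesis using True by simp
      next
        case False
        then show ?thesis unfolding splitting_sum_def S by (simp add: M urn_prob_single add_mset_commute)
      qed
    qed
    have "(real (size M) - 1) * urn_prob K x M = parents_sum K (urn_prob K x) M" by (rule urn_prob_forward)
    also have "\<dots> = (if a = b then of_bool (x = a) * pmf (K x) b
        else of_bool (x = a) * pmf (K x) b + of_bool (x = b) * pmf (K x) a)"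
      by (auto simp: parents_sum_def M urn_prob_single birth_rate_def add_mset_commute)
    also have "\<dots> = (\<Sum>y\<in>Y. pmf (K x) y * splitting_sum (urn_prob K x) (urn_prob K y) M)"
    proof -
      have e: "(\<Sum>y\<in>Y. pmf (K x) y * of_bool (P \<and> y = c)) = of_bool P * pmf (K x) c" for P c
      proof -
        have "(\<Sum>y\<in>Y. pmf (K x) y * of_bool (P \<and> y = c)) = (\<Sum>y\<in>Y. if y = c then of_bool P * pmf (K x) c else 0)"
          by (intro sum.cong) auto
        also have "\<dots> = of_bool P * pmf (K x) c"
          using assms by (auto simp: set_pmf_iff)
        finally show ?thesis .
      qed
      show ?thesis unfolding * by (simp add: distrib_left sum.distrib e)
    qed
    finally show ?thesis .
  next
    case False
    then have n: "size M \<ge> 3" using less by simp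
    have "(real (size M) - 2) * ((real (size M) - 1) * urn_prob K x M) =
        (\<Sum>u\<in>set_mset M. birth_rate K (M - {#u#}) u * ((real (size M) - 2) * urn_prob K x (M - {#u#})))"
      unfolding urn_prob_forward parents_sum_def by (simp add: sum_distrib_left mult_ac)
    also have "\<dots> = (\<Sum>u\<in>set_mset M. birth_rate K (M - {#u#}) u *
        (\<Sum>y\<in>Y. pmf (K x) y * splitting_sum (urn_prob K x) (urn_prob K y) (M - {#u#})))"
    proof (intro sum.cong refl arg_cong2[where f="(*)"])
      fix u assume "u \<in># M"
      then have s: "size M = Suc (size (M - {#u#}))" by (metis insert_DiffM size_add_mset)
      then have "(real (size (M - {#u#})) - 1) * urn_prob K x (M - {#u#}) =
         (\<Sum>y\<in>Y. pmf (K x) y * splitting_sum (urn_prob K x) (urn_prob K y) (M - {#u#}))"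
        using n by (intro less.hyps) auto
      then show "(real (size M) - 2) * urn_prob K x (M - {#u#}) =
         (\<Sum>y\<in>Y. pmf (K x) y * splitting_sum (urn_prob K x) (urn_prob K y) (M - {#u#}))"
        using s by simp
    qed
    also have "\<dots> = (\<Sum>y\<in>Y. pmf (K x) y * parents_sum K (splitting_sum (urn_prob K x) (urn_prob K y)) M)"
      unfolding parents_sum_def sum_distrib_left by (subst sum.swap) (simp add: mult_ac)
    also have "\<dots> = (real (size M) - 2) * (\<Sum>y\<in>Y. pmf (K x) y * splitting_sum (urn_prob K x) (urn_prob K y) M)"
      unfolding splitting_sum_urn_prob_derivation by (simp add: sum_distrib_left mult_ac)
    finally show ?thesis using n by simp
  qed
qed

section \<open>Splitting a Yule tree at the first event\<close>

text \<open>An i.i.d. family indexed by \<open>'i\<close> can be assembled from one further variable and two i.i.d. families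
  when \<open>dec\<close> assigns to different indices different sources.\<close>

lemma distr_PiM_glue:
  fixes dec :: "'i \<Rightarrow> ('i + 'i) option" and N :: "'b measure"
  assumes "prob_space N" and dec: "inj dec"
  defines "glue \<equiv> (\<lambda>(s, a, b) i. case dec i of None \<Rightarrow> s | Some (Inl j) \<Rightarrow> a j | Some (Inr j) \<Rightarrow> b j)"
  defines "P \<equiv> (\<Pi>\<^sub>M _\<in>(UNIV :: 'i set). N)"
  shows "glue \<in> N \<Otimes>\<^sub>M P \<Otimes>\<^sub>M P \<rightarrow>\<^sub>M P"
    and "distr (N \<Otimes>\<^sub>M P \<Otimes>\<^sub>M P) P glue = P"
proof -
  interpret N: prob_space N by fact
  interpret P: prob_space P unfolding P_def by (intro prob_space_PiM assms(1))
  interpret PP: pair_prob_space P P ..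
  show meas: "glue \<in> N \<Otimes>\<^sub>M P \<Otimes>\<^sub>M P \<rightarrow>\<^sub>M P"
    unfolding P_def
  proof (rule measurable_PiM_single')
    fix i
    show "(\<lambda>\<omega>. glue \<omega> i) \<in> N \<Otimes>\<^sub>M (\<Pi>\<^sub>M _\<in>UNIV. N) \<Otimes>\<^sub>M (\<Pi>\<^sub>M _\<in>UNIV. N) \<rightarrow>\<^sub>M N"
    proof (cases "dec i")
      case (Some d)
      then show ?thesis by (cases d) (auto simp: glue_def case_prod_beta)
    qed (auto simp: glue_def case_prod_beta)
  qed (auto simp: PiE_def extensional_def glue_def space_pair_measure space_PiM Pi_iff split: option.split sum.split)
  show "distr (N \<Otimes>\<^sub>M P \<Otimes>\<^sub>M P) P glue = P"
    unfolding P_def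
  proof (rule measure_eqI_PiM_infinite[symmetric, OF refl], fold P_def)
    show "finite_measure P" by unfold_locales
    fix A J assume J: "finite J" "J \<subseteq> (UNIV :: 'i set)" and A: "\<And>i. i \<in> J \<Longrightarrow> A i \<in> sets N"
    define A' where "A' d = A (inv dec d)" for d
    define Jn where "Jn = dec ` J \<inter> {None}"
    define Ja where "Ja = {j. Some (Inl j) \<in> dec ` J}"
    define Jb where "Jb = {j. Some (Inr j) \<in> dec ` J}"
    define S where "S = (if None \<in> dec ` J then A' None else space N)"
    have A': "A' d \<in> sets N" if "d \<in> dec ` J" for d
      using that A dec by (auto simp: A'_def)
    have fin: "finite Ja" "finite Jb"
      using finite_vimageI[of "dec ` J" "Some \<circ> Inl"] finite_vimageI[of "dec ` J" "Some \<circ> Inr"] J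
      by (auto simp: Ja_def Jb_def vimage_def inj_def)
    have split: "dec ` J = Jn \<union> ((Some \<circ> Inl) ` Ja \<union> (Some \<circ> Inr) ` Jb)"
    proof (intro equalityI subsetI)
      fix d assume "d \<in> dec ` J"
      then show "d \<in> Jn \<union> ((Some \<circ> Inl) ` Ja \<union> (Some \<circ> Inr) ` Jb)"
        by (cases d rule: option.exhaust; cases "the d") (auto simp: Jn_def Ja_def Jb_def)
    qed (auto simp: Jn_def Ja_def Jb_def)
    have "emeasure P (prod_emb UNIV (\<lambda>_. N) J (Pi\<^sub>E J A)) = (\<Prod>i\<in>J. emeasure N (A i))"
      unfolding P_def using J A assms(1) by (intro emeasure_PiM_emb) auto
    also have "\<dots> = (\<Prod>d\<in>dec ` J. emeasure N (A' d))"
      using dec by (subst prod.reindex) (auto simp: A'_def intro: inj_on_subset)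
    also have "\<dots> = (\<Prod>d\<in>Jn. emeasure N (A' d)) *
        ((\<Prod>d\<in>(Some \<circ> Inl) ` Ja. emeasure N (A' d)) * (\<Prod>d\<in>(Some \<circ> Inr) ` Jb. emeasure N (A' d)))"
      unfolding split using fin by (subst prod.union_disjoint; (subst prod.union_disjoint)?) (auto simp: Jn_def)
    also have "(\<Prod>d\<in>Jn. emeasure N (A' d)) = emeasure N S"
      by (cases "None \<in> dec ` J") (auto simp: Jn_def S_def N.emeasure_space_1)
    also have "(\<Prod>d\<in>(Some \<circ> Inl) ` Ja. emeasure N (A' d)) =
        emeasure P (prod_emb UNIV (\<lambda>_. N) Ja (\<Pi>\<^sub>E j\<in>Ja. A' (Some (Inl j))))"
      unfolding P_def using A' fin assms(1)
      by (subst emeasure_PiM_emb) (auto simp: prod.reindex inj_on_def Ja_def)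
    also have "(\<Prod>d\<in>(Some \<circ> Inr) ` Jb. emeasure N (A' d)) =
        emeasure P (prod_emb UNIV (\<lambda>_. N) Jb (\<Pi>\<^sub>E j\<in>Jb. A' (Some (Inr j))))"
      unfolding P_def using A' fin assms(1)
      by (subst emeasure_PiM_emb) (auto simp: prod.reindex inj_on_def Jb_def)
    also have "emeasure N S * (emeasure P (prod_emb UNIV (\<lambda>_. N) Ja (\<Pi>\<^sub>E j\<in>Ja. A' (Some (Inl j)))) *
        emeasure P (prod_emb UNIV (\<lambda>_. N) Jb (\<Pi>\<^sub>E j\<in>Jb. A' (Some (Inr j))))) =
        emeasure (N \<Otimes>\<^sub>M P \<Otimes>\<^sub>M P) (S \<times> prod_emb UNIV (\<lambda>_. N) Ja (\<Pi>\<^sub>E j\<in>Ja. A' (Some (Inl j))) \<times>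
          prod_emb UNIV (\<lambda>_. N) Jb (\<Pi>\<^sub>E j\<in>Jb. A' (Some (Inr j))))"
    proof -
      have "S \<in> sets N" using A' by (auto simp: S_def)
      moreover have "prod_emb UNIV (\<lambda>_. N) Ja (\<Pi>\<^sub>E j\<in>Ja. A' (Some (Inl j))) \<in> sets P"
        unfolding P_def using A' fin by (intro sets_PiM_I) (auto simp: Ja_def)
      moreover have "prod_emb UNIV (\<lambda>_. N) Jb (\<Pi>\<^sub>E j\<in>Jb. A' (Some (Inr j))) \<in> sets P"
        unfolding P_def using A' fin by (intro sets_PiM_I) (auto simp: Jb_def)
      ultimately show ?thesis
        by (simp add: PP.emeasure_pair_measure_Times P.emeasure_pair_measure_Times)
    qed
    also have "S \<times> prod_emb UNIV (\<lambda>_. N) Ja (\<Pi>\<^sub>E j\<in>Ja. A' (Some (Inl j))) \<times>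
          prod_emb UNIV (\<lambda>_. N) Jb (\<Pi>\<^sub>E j\<in>Jb. A' (Some (Inr j))) =
        glue -` prod_emb UNIV (\<lambda>_. N) J (Pi\<^sub>E J A) \<inter> space (N \<Otimes>\<^sub>M P \<Otimes>\<^sub>M P)"
    proof -
      have AA: "A i = A' (dec i)" for i using dec by (simp add: A'_def)
      have 1: "(\<forall>i\<in>J. glue (s, a, b) i \<in> A i) \<longleftrightarrow>
        (None \<in> dec ` J \<longrightarrow> s \<in> A' None) \<and> (\<forall>j\<in>Ja. a j \<in> A' (Some (Inl j))) \<and>
        (\<forall>j\<in>Jb. b j \<in> A' (Some (Inr j)))" (is "?L \<longleftrightarrow> ?R") for s a b
      proof
        assume L: ?L
        show ?R
          using L by (fastforce simp: glue_def AA Ja_def Jb_def image_iff dest: sym split: option.splits sum.splits)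
      next
        assume R: ?R
        show ?L
        proof
          fix i assume i: "i \<in> J"
          then have "dec i \<in> dec ` J" by simp
          have "None = dec i \<Longrightarrow> s \<in> A' None" using R \<open>dec i \<in> dec ` J\<close> by metis
          show "glue (s, a, b) i \<in> A i"
          proof (cases "dec i")
            case (Some d)
            with \<open>dec i \<in> dec ` J\<close> show ?thesis
              using R by (cases d) (simp_all add: glue_def AA Ja_def Jb_def)
          qed (use \<open>None = dec i \<Longrightarrow> s \<in> A' None\<close> in \<open>simp add: glue_def AA\<close>)
        qed
      qed
      have S: "s \<in> S \<longleftrightarrow> s \<in> space N \<and> (None \<in> dec ` J \<longrightarrow> s \<in> A' None)" for s
        using A'[THEN sets.sets_into_space] by (auto simp: S_def)
      have sp: "x \<in> space N" if "j \<in> Ja" "x \<in> A' (Some (Inl j))" for j x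
        using that A'[THEN sets.sets_into_space] by (auto simp: Ja_def)
      have sp': "x \<in> space N" if "j \<in> Jb" "x \<in> A' (Some (Inr j))" for j x
        using that A'[THEN sets.sets_into_space] by (auto simp: Jb_def)
      have g: "glue (s, a, b) i \<in> space N" if "s \<in> space N" "\<And>i. a i \<in> space N" "\<And>i. b i \<in> space N" for s a b i
        using that by (auto simp: glue_def split: option.splits sum.splits)
      have pe: "x \<in> prod_emb UNIV (\<lambda>_. N) L (Pi\<^sub>E L B) \<longleftrightarrow> (\<forall>i. x i \<in> space N) \<and> (\<forall>i\<in>L. x i \<in> B i)" for x L B
        by (auto simp: prod_emb_def PiE_iff)
      show ?thesis
        unfolding set_eq_iff
        by (auto simp: pe S 1[simplified] space_pair_measure P_def space_PiM g PiE_iff)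
    qed
    also have "emeasure (N \<Otimes>\<^sub>M P \<Otimes>\<^sub>M P) \<dots> =
        emeasure (distr (N \<Otimes>\<^sub>M P \<Otimes>\<^sub>M P) P glue) (prod_emb UNIV (\<lambda>_. N) J (Pi\<^sub>E J A))"
      using J A by (intro emeasure_distr[symmetric] meas) (auto simp: P_def intro!: sets_PiM_I)
    finally show "emeasure P (prod_emb UNIV (\<lambda>_. N) J (Pi\<^sub>E J A)) =
        emeasure (distr (N \<Otimes>\<^sub>M P \<Otimes>\<^sub>M P) P glue) (prod_emb UNIV (\<lambda>_. N) J (Pi\<^sub>E J A))" .
  qed (simp add: P_def)
qed


text \<open>Cuts the tree of potential vertices at the first event of the root. The event itself has index
  \<open>([], 0)\<close> and is sent to \<open>None\<close>. The vertex \<open>[0]\<close> created by it and everything below it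
  (the lists that end with \<open>0\<close>) form the right copy. The root restarted after this event, whose
  \<open>k\<close>-th event is the former event \<open>k + 1\<close>, forms the left copy.\<close>

definition split_index :: "nat list \<times> nat \<Rightarrow> ((nat list \<times> nat) + (nat list \<times> nat)) option" where
  "split_index = (\<lambda>(v, k).
     if v = [] then (if k = 0 then None else Some (Inl ([], k - 1)))
     else if last v = 0 then Some (Inr (butlast v, k))
     else Some (Inl (butlast v @ [last v - 1], k)))"

definition glue :: "'b \<times> (nat list \<times> nat \<Rightarrow> 'b) \<times> (nat list \<times> nat \<Rightarrow> 'b) \<Rightarrow> nat list \<times> nat \<Rightarrow> 'b" where
  "glue = (\<lambda>(s, a, b) i. case split_index i of None \<Rightarrow> s | Some (Inl j) \<Rightarrow> a j | Some (Inr j) \<Rightarrow> b j)"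

lemma inj_split_index: "inj split_index"
proof (rule injI)
  fix p q :: "nat list \<times> nat"
  assume eq: "split_index p = split_index q"
  obtain v k w l where pq: "p = (v, k)" "q = (w, l)" by (cases p, cases q)
  show "p = q"
    using eq unfolding pq split_index_def
    by (cases v rule: rev_cases; cases w rule: rev_cases) (auto split: if_splits)
qed

lemma glue_simps [simp]:
  "glue (s, a, b) ([], 0) = s"
  "glue (s, a, b) ([], Suc k) = a ([], k)"
  "glue (s, a, b) (w @ [0], k) = b (w, k)"
  "glue (s, a, b) (w @ [Suc j], k) = a (w @ [j], k)"
  by (simp_all add: glue_def split_index_def)

lemma
  assumes "prob_space N"
  shows measurable_glue: "glue \<in> N \<Otimes>\<^sub>M (\<Pi>\<^sub>M _\<in>UNIV. N) \<Otimes>\<^sub>M (\<Pi>\<^sub>M _\<in>UNIV. N) \<rightarrow>\<^sub>M (\<Pi>\<^sub>M _\<in>UNIV. N)"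
    and distr_glue: "distr (N \<Otimes>\<^sub>M (\<Pi>\<^sub>M _\<in>UNIV. N) \<Otimes>\<^sub>M (\<Pi>\<^sub>M _\<in>UNIV. N)) (\<Pi>\<^sub>M _\<in>UNIV. N) glue = (\<Pi>\<^sub>M _\<in>UNIV. N)"
  using distr_PiM_glue[OF assms inj_split_index] unfolding glue_def by auto

lemma nn_integral_glue:
  assumes N: "prob_space N" and f: "f \<in> borel_measurable (\<Pi>\<^sub>M _\<in>UNIV. N)"
  shows "(\<integral>\<^sup>+x. f x \<partial>(\<Pi>\<^sub>M _\<in>UNIV. N)) =
    (\<integral>\<^sup>+s. \<integral>\<^sup>+a. \<integral>\<^sup>+b. f (glue (s, a, b)) \<partial>(\<Pi>\<^sub>M _\<in>UNIV. N) \<partial>(\<Pi>\<^sub>M _\<in>UNIV. N) \<partial>N)"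
proof -
  let ?P = "\<Pi>\<^sub>M _\<in>(UNIV :: (nat list \<times> nat) set). N"
  interpret N: prob_space N by fact
  interpret P: prob_space ?P by (intro prob_space_PiM N)
  interpret PP: pair_prob_space ?P ?P ..
  note [measurable] = measurable_glue[OF N] f
  have "(\<integral>\<^sup>+x. f x \<partial>?P) = (\<integral>\<^sup>+x. f x \<partial>distr (N \<Otimes>\<^sub>M ?P \<Otimes>\<^sub>M ?P) ?P glue)"
    by (simp only: distr_glue[OF N])
  also have "\<dots> = (\<integral>\<^sup>+x. f (glue x) \<partial>(N \<Otimes>\<^sub>M ?P \<Otimes>\<^sub>M ?P))"
    by (intro nn_integral_distr) measurable
  also have "\<dots> = (\<integral>\<^sup>+s. \<integral>\<^sup>+x. f (glue (s, x)) \<partial>(?P \<Otimes>\<^sub>M ?P) \<partial>N)"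
    by (subst PP.nn_integral_fst[symmetric]) measurable
  also have "\<dots> = (\<integral>\<^sup>+s. \<integral>\<^sup>+a. \<integral>\<^sup>+b. f (glue (s, a, b)) \<partial>?P \<partial>?P \<partial>N)"
    by (intro nn_integral_cong, subst P.nn_integral_fst[symmetric]) measurable
  finally show ?thesis .
qed

text \<open>Labels are inherited along the genealogy of the clocks, in which the parent of \<open>k # v\<close> is \<open>v\<close>.
  The distance to the root, with an extra value for vertices that are not created, is of this form.
  This is what makes the labelled Yule tree a branching process.\<close>

primrec label :: "('a \<Rightarrow> nat \<Rightarrow> 'a) \<Rightarrow> 'a \<Rightarrow> (nat list \<times> nat \<Rightarrow> nat) \<Rightarrow> nat list \<Rightarrow> 'a" where
  "label off x Z [] = x"
| "label off x Z (k # v) = off (label off x Z v) (Z (v, k))"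

text \<open>All reproduction events are kept here, whether or not they lead to a vertex of the tree. So this
  set depends on the clocks only and is a Yule tree with rate one, independent of the steps.\<close>

definition yule :: "(nat list \<times> nat \<Rightarrow> real) \<Rightarrow> real \<Rightarrow> nat list set" where
  "yule E t = {v. birth_time E v \<le> t}"

text \<open>If infinitely many events happen before \<open>t\<close>, the value is \<open>{#}\<close>; for a finite Yule tree and \<open>0 \<le> t\<close> it is
  never \<open>{#}\<close>, because the root is present. So \<open>{#}\<close> encodes explosion.\<close>

definition population ::
  "('a \<Rightarrow> nat \<Rightarrow> 'a) \<Rightarrow> 'a \<Rightarrow> (nat list \<times> nat \<Rightarrow> real) \<Rightarrow> (nat list \<times> nat \<Rightarrow> nat) \<Rightarrow> real \<Rightarrow> 'a multiset" where
  "population off x E Z t = image_mset (label off x Z) (mset_set (yule E t))"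

text \<open>The position in the whole tree of a vertex of the left copy in \<open>split_index\<close>.\<close>

definition shift :: "nat list \<Rightarrow> nat list" where
  "shift v = (if v = [] then [] else butlast v @ [Suc (last v)])"

lemma shift_simps [simp]: "shift [] = []" "shift (w @ [j]) = w @ [Suc j]"
  by (simp_all add: shift_def)

lemma inj_shift: "inj shift"
proof (rule injI)
  fix v w assume "shift v = shift w"
  then show "v = w" by (cases v rule: rev_cases; cases w rule: rev_cases) auto
qed

lemma shift_Cons: "v \<noteq> [] \<Longrightarrow> shift (k # v) = k # shift v"
  by (simp add: shift_def)

lemma label_glue:
  "label off x (glue (z, Za, Zb)) (shift v) = label off x Za v"
  "label off x (glue (z, Za, Zb)) (w @ [0]) = label off (off x z) Zb w"
proof -
  show "label off x (glue (z, Za, Zb)) (shift v) = label off x Za v"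
  proof (induction v)
    case (Cons k v)
    show ?case
    proof (cases v rule: rev_cases)
      case Nil
      then show ?thesis using shift_simps(2)[of "[]"] by simp
    next
      case (snoc w j)
      then show ?thesis using Cons by (simp add: shift_Cons)
    qed
  qed simp
  show "label off x (glue (z, Za, Zb)) (w @ [0]) = label off (off x z) Zb w"
    by (induction w) simp_all
qed

lemma birth_time_glue:
  "v \<noteq> [] \<Longrightarrow> birth_time (glue (s, a, b)) (shift v) = s + birth_time a v"
  "birth_time (glue (s, a, b)) (w @ [0]) = s + birth_time b w"
proof -
  show "birth_time (glue (s, a, b)) (shift v) = s + birth_time a v" if "v \<noteq> []"
    using that
  proof (induction v)
    case (Cons k v)
    show ?case
    proof (cases v rule: rev_cases)
      case Nil
      then show ?thesis using shift_simps(2)[of "[]"] by (simp add: sum.atMost_Suc_shift del: sum.atMost_Suc)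
    next
      case (snoc w j)
      then show ?thesis using Cons by (simp add: shift_Cons)
    qed
  qed simp
  show "birth_time (glue (s, a, b)) (w @ [0]) = s + birth_time b w"
    by (induction w) simp_all
qed

lemma birth_time_nonneg: "(\<And>i. 0 \<le> E i) \<Longrightarrow> 0 \<le> birth_time E v"
  by (induction v) (auto intro!: add_nonneg_nonneg sum_nonneg)

lemma shift_cases: obtains v where "u = shift v" | w where "u = w @ [0]"
  by (metis not0_implies_Suc rev_exhaust shift_simps)

lemma shift_neq [simp]: "shift v \<noteq> w @ [0]" "w @ [0] \<noteq> shift v"
  by (auto simp: shift_def)

lemma yule_glue:
  assumes "0 \<le> s" "s \<le> t"
  shows "yule (glue (s, a, b)) t = shift ` yule a (t - s) \<union> (\<lambda>w. w @ [0]) ` yule b (t - s)"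
proof (intro set_eqI)
  fix u
  show "u \<in> yule (glue (s, a, b)) t \<longleftrightarrow> u \<in> shift ` yule a (t - s) \<union> (\<lambda>w. w @ [0]) ` yule b (t - s)"
  proof (cases u rule: shift_cases)
    case (1 v)
    have "birth_time (glue (s, a, b)) (shift v) \<le> t \<longleftrightarrow> birth_time a v \<le> t - s"
      using assms birth_time_glue(1)[of v s a b] by (cases "v = []") auto
    then show ?thesis unfolding 1 using inj_shift by (auto simp: yule_def inj_def)
  next
    case (2 w)
    then show ?thesis by (auto simp: yule_def birth_time_glue)
  qed
qed

lemma yule_glue_less:
  assumes "0 \<le> t" "t < s" "\<And>i. 0 \<le> a i" "\<And>i. 0 \<le> b i"
  shows "yule (glue (s, a, b)) t = {[]}"
proof (intro set_eqI)
  fix u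
  show "u \<in> yule (glue (s, a, b)) t \<longleftrightarrow> u \<in> {[]}"
  proof (cases u rule: shift_cases)
    case (1 v)
    then show ?thesis
      using assms birth_time_glue(1)[of v s a b] birth_time_nonneg[of a v] by (cases "v = []") (auto simp: yule_def)
  next
    case (2 w)
    then show ?thesis using assms birth_time_nonneg[of b w] by (auto simp: yule_def birth_time_glue)
  qed
qed

lemma Nil_in_yule: "0 \<le> t \<Longrightarrow> [] \<in> yule E t"
  by (simp add: yule_def)

lemma population_eq_empty_iff: "0 \<le> t \<Longrightarrow> population off x E Z t = {#} \<longleftrightarrow> infinite (yule E t)"
  using Nil_in_yule[of t E] by (auto simp: population_def mset_set_empty_iff)

text \<open>The branching property: after the first event of the root at time \<open>s\<close>, the population at time \<open>t\<close>
  is the union of the populations of the restarted root and of its first child at time \<open>t - s\<close>.\<close>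

lemma population_glue:
  assumes "0 \<le> s" "s \<le> t" "M \<noteq> {#}"
  shows "population off x (glue (s, a, b)) (glue (z, Za, Zb)) t = M \<longleftrightarrow>
    population off x a Za (t - s) \<noteq> {#} \<and> population off (off x z) b Zb (t - s) \<noteq> {#} \<and>
    population off x a Za (t - s) + population off (off x z) b Zb (t - s) = M"
proof -
  have inj: "inj_on shift A" "inj_on (\<lambda>w. w @ [0::nat]) B" for A B
    using inj_shift by (auto intro: inj_on_subset injI)
  have fin: "finite (yule (glue (s, a, b)) t) \<longleftrightarrow> finite (yule a (t - s)) \<and> finite (yule b (t - s))"
    using assms inj by (simp add: yule_glue finite_image_iff)
  show ?thesis
  proof (cases "finite (yule (glue (s, a, b)) t)")
    case True
    then have fin': "finite (yule a (t - s))" "finite (yule b (t - s))" using fin by auto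
    have "mset_set (yule (glue (s, a, b)) t) =
        image_mset shift (mset_set (yule a (t - s))) + image_mset (\<lambda>w. w @ [0]) (mset_set (yule b (t - s)))"
      unfolding yule_glue[OF assms(1,2)] using fin' inj
      by (subst mset_set_Union) (auto simp: image_mset_mset_set)
    then have "population off x (glue (s, a, b)) (glue (z, Za, Zb)) t =
        population off x a Za (t - s) + population off (off x z) b Zb (t - s)"
      by (simp add: population_def multiset.map_comp o_def label_glue)
    then show ?thesis using fin' assms by (simp add: population_eq_empty_iff)
  next
    case False
    then show ?thesis using fin assms
      by (auto simp: population_eq_empty_iff)
  qed
qed

lemma population_glue_less:
  assumes "0 \<le> t" "t < s" "\<And>i. 0 \<le> a i" "\<And>i. 0 \<le> b i"
  shows "population off x (glue (s, a, b)) Z t = {#x#}"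
  using assms by (simp add: population_def yule_glue_less)

section \<open>The law of the population of a Yule tree\<close>

instance multiset :: (countable) countable
proof (rule countable_classI)
  fix M N :: "'a multiset"
  assume "to_nat (SOME xs. mset xs = M) = to_nat (SOME xs. mset xs = N)"
  then have "(SOME xs. mset xs = M) = (SOME xs. mset xs = N)" by simp
  then show "M = N" by (metis (mono_tags) ex_mset someI_ex)
qed

abbreviation clocks :: "(nat list \<times> nat \<Rightarrow> real) measure" where
  "clocks \<equiv> \<Pi>\<^sub>M _\<in>UNIV. exp1"

abbreviation steps :: "nat pmf \<Rightarrow> (nat list \<times> nat \<Rightarrow> nat) measure" where
  "steps p \<equiv> \<Pi>\<^sub>M _\<in>UNIV. measure_pmf p"

lemma prob_space_clocks: "prob_space clocks"
  by (intro prob_space_PiM prob_space_exp1)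

lemma prob_space_steps: "prob_space (steps p)"
  by (intro prob_space_PiM prob_space_measure_pmf)

lemma sets_exp1 [measurable_cong]: "sets exp1 = sets borel"
  by (simp add: exp1_def)

lemma space_exp1 [simp]: "space exp1 = UNIV"
  by (simp add: exp1_def)

lemma measurable_birth_time [measurable]: "(\<lambda>E. birth_time E v) \<in> borel_measurable clocks"
proof (induction v)
  case (Cons k v)
  note [measurable] = Cons
  show ?case by simp
qed simp

lemma measurable_mset_yule:
  "(\<lambda>(E, t). mset_set (yule E t)) \<in> clocks \<Otimes>\<^sub>M exp1 \<rightarrow>\<^sub>M count_space UNIV"
proof -
  let ?M = "clocks \<Otimes>\<^sub>M exp1" and ?f = "\<lambda>\<omega>. mset_set (yule (fst \<omega>) (snd \<omega>))"
  have eq: "Measurable.pred ?M (\<lambda>\<omega>. yule (fst \<omega>) (snd \<omega>) = S)" for S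
    unfolding yule_def set_eq_iff mem_Collect_eq by measurable
  have ne: "?f -` {A} \<inter> space ?M \<in> sets ?M" if "A \<noteq> {#}" for A
  proof -
    have "?f -` {A} \<inter> space ?M =
        {\<omega> \<in> space ?M. A = mset_set (set_mset A) \<and> yule (fst \<omega>) (snd \<omega>) = set_mset A}"
      using that by (auto; metis finite_set_mset_mset_set mset_set.infinite)
    also have "\<dots> \<in> sets ?M" using eq by measurable
    finally show ?thesis .
  qed
  have "?f -` {A} \<inter> space ?M \<in> sets ?M" for A
  proof (cases "A = {#}")
    case True
    have "?f -` {A} \<inter> space ?M = space ?M - (\<Union>B\<in>UNIV - {{#}}. ?f -` {B} \<inter> space ?M)"
      using True by auto
    also have "\<dots> \<in> sets ?M"
      using ne by (intro sets.Diff sets.countable_UN'') auto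
    finally show ?thesis .
  qed (rule ne)
  then have "?f \<in> ?M \<rightarrow>\<^sub>M count_space UNIV"
    by (simp add: measurable_count_space_eq2_countable)
  then show ?thesis by (simp add: case_prod_beta')
qed

lemma measurable_label [measurable]:
  fixes off :: "'a::countable \<Rightarrow> nat \<Rightarrow> 'a"
  shows "(\<lambda>Z. label off x Z v) \<in> steps p \<rightarrow>\<^sub>M count_space UNIV"
proof (induction v)
  case (Cons k v)
  have Zvk: "(\<lambda>Z. Z (v, k)) \<in> steps p \<rightarrow>\<^sub>M count_space UNIV"
    using measurable_component_singleton[of "(v, k)" UNIV "\<lambda>_. measure_pmf p"] by simp
  have "(\<lambda>Z. off y (Z (v, k))) \<in> steps p \<rightarrow>\<^sub>M count_space UNIV" for y
    by (rule measurable_compose[OF Zvk]) simp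
  then show ?case
    unfolding label.simps by (rule measurable_compose_countable[OF _ Cons])
qed simp

lemma measurable_population [measurable]:
  fixes off :: "'a::countable \<Rightarrow> nat \<Rightarrow> 'a"
  shows "(\<lambda>(E, Z, t). population off x E Z t) \<in> clocks \<Otimes>\<^sub>M steps p \<Otimes>\<^sub>M exp1 \<rightarrow>\<^sub>M count_space UNIV"
proof -
  let ?M = "clocks \<Otimes>\<^sub>M steps p \<Otimes>\<^sub>M exp1"
  have img: "(\<lambda>\<omega>. image_mset (label off x (fst (snd \<omega>))) A) \<in> ?M \<rightarrow>\<^sub>M count_space UNIV" for A
  proof (induction A)
    case (add v A)
    have lab: "(\<lambda>\<omega>. label off x (fst (snd \<omega>)) v) \<in> ?M \<rightarrow>\<^sub>M count_space UNIV"
      by (rule measurable_compose[OF _ measurable_label]) measurable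
    have "(\<lambda>\<omega>. add_mset y (image_mset (label off x (fst (snd \<omega>))) A)) \<in> ?M \<rightarrow>\<^sub>M count_space UNIV" for y
      by (rule measurable_compose[OF add]) simp
    then show ?case
      unfolding image_mset_add_mset by (rule measurable_compose_countable[OF _ lab])
  qed simp
  have "(\<lambda>\<omega>. mset_set (yule (fst \<omega>) (snd (snd \<omega>)))) \<in> ?M \<rightarrow>\<^sub>M count_space UNIV"
    using measurable_compose[OF _ measurable_mset_yule, of "\<lambda>\<omega>. (fst \<omega>, snd (snd \<omega>))" ?M]
    by (simp add: case_prod_beta)
  then show ?thesis
    unfolding population_def case_prod_beta' by (rule measurable_compose_countable[OF img])
qed

lemma measurable_population_at [measurable]:
  fixes off :: "'a::countable \<Rightarrow> nat \<Rightarrow> 'a"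
  shows "(\<lambda>(E, Z). population off x E Z t) \<in> clocks \<Otimes>\<^sub>M steps p \<rightarrow>\<^sub>M count_space UNIV"
  using measurable_compose[OF _ measurable_population, of "\<lambda>\<omega>. (fst \<omega>, snd \<omega>, t)" "clocks \<Otimes>\<^sub>M steps p"]
  by (simp add: case_prod_beta')

lemma AE_exp1_nonneg: "AE s in exp1. 0 \<le> s"
  unfolding exp1_def by (subst AE_density) (auto simp: exponential_density_def)

lemma AE_clocks_nonneg: "AE E in clocks. \<forall>i. 0 \<le> E i"
  unfolding AE_all_countable
proof
  fix i
  have "AE s in distr clocks exp1 (\<lambda>E. E i). 0 \<le> s"
    by (subst distr_PiM_component) (auto simp: prob_space_exp1 AE_exp1_nonneg)
  then show "AE E in clocks. 0 \<le> E i"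
    by (rule AE_distrD[rotated]) simp
qed

text \<open>A union of two nonempty parts determines its first part, so the indicator of the union being \<open>M\<close>
  is a finite sum of products; this is what makes the independence of the two families usable.\<close>

lemma sum_indicator_split:
  fixes P Q M :: "'a multiset"
  shows "(\<Sum>N\<in>{N. N \<subseteq># M} - {{#}, M}. indicator {N} P * indicator {M - N} Q :: ennreal) =
    of_bool (P \<noteq> {#} \<and> Q \<noteq> {#} \<and> P + Q = M)"
proof -
  let ?S = "{N. N \<subseteq># M} - {{#}, M}"
  have fin: "finite ?S" by (simp add: finite_submultisets)
  have "(\<Sum>N\<in>?S. indicator {N} P * indicator {M - N} Q :: ennreal) =
      (\<Sum>N\<in>?S. if N = P then indicator {M - P} Q else 0)"
    by (intro sum.cong) auto
  also have "\<dots> = (if P \<in> ?S then indicator {M - P} Q else 0)"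
    using fin by (rule sum.delta)
  also have "\<dots> = of_bool (P \<in> ?S \<and> Q = M - P)" by auto
  also have "P \<in> ?S \<and> Q = M - P \<longleftrightarrow> P \<noteq> {#} \<and> Q \<noteq> {#} \<and> P + Q = M"
    by (auto simp: subset_mset.add_diff_inverse) (metis add.right_neutral subset_mset.add_diff_inverse)
  finally show ?thesis .
qed

definition pop_prob :: "('a::countable \<Rightarrow> nat \<Rightarrow> 'a) \<Rightarrow> nat pmf \<Rightarrow> 'a \<Rightarrow> 'a multiset \<Rightarrow> real \<Rightarrow> ennreal" where
  "pop_prob off p x M t = (\<integral>\<^sup>+E. \<integral>\<^sup>+Z. indicator {M} (population off x E Z t) \<partial>steps p \<partial>clocks)"

lemma measurable_population_pair:
  fixes off :: "'a::countable \<Rightarrow> nat \<Rightarrow> 'a"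
  shows "(\<lambda>(E, Z). indicator {M} (population off x E Z t) :: ennreal) \<in> borel_measurable (clocks \<Otimes>\<^sub>M steps p)"
  using measurable_compose[OF measurable_population_at, of "indicator {M}" borel off x t p]
  by (simp add: case_prod_beta')

lemma measurable_population_clocks:
  fixes off :: "'a::countable \<Rightarrow> nat \<Rightarrow> 'a"
  shows "(\<lambda>E. \<integral>\<^sup>+Z. indicator {M} (population off x E Z t) \<partial>steps p) \<in> borel_measurable clocks"
proof -
  interpret prob_space "steps p" by (rule prob_space_steps)
  show ?thesis by (rule borel_measurable_nn_integral[OF measurable_population_pair])
qed

lemma measurable_population_steps:
  fixes off :: "'a::countable \<Rightarrow> nat \<Rightarrow> 'a"
  shows "(\<lambda>Z. indicator {M} (population off x E Z t) :: ennreal) \<in> borel_measurable (steps p)"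
proof -
  have "E \<in> space clocks" by (simp add: space_PiM)
  from measurable_compose_Pair1[OF this measurable_population_pair] show ?thesis by simp
qed

text \<open>The renewal equation at the first event of the root: no event until \<open>t\<close> leaves only the root, and
  an event at time \<open>s\<close> leaves two independent families that have the time \<open>t - s\<close> to produce
  \<open>N\<close> and \<open>M - N\<close>. Neither part can be empty, hence the restricted range of \<open>N\<close>.\<close>

lemma pop_prob_rec:
  fixes off :: "'a::countable \<Rightarrow> nat \<Rightarrow> 'a"
  assumes fin: "finite (range (off x))" and t: "0 \<le> t" and M: "M \<noteq> {#}"
  defines "S \<equiv> {N. N \<subseteq># M} - {{#}, M}"
  shows "pop_prob off p x M t = (\<integral>\<^sup>+s. (if t < s then indicator {M} {#x#} else
      (\<Sum>N\<in>S. \<Sum>y\<in>range (off x). pmf (map_pmf (off x) p) y * (pop_prob off p x N (t - s) * pop_prob off p y (M - N) (t - s)))) \<partial>exp1)"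
proof -
  interpret C: prob_space clocks by (rule prob_space_clocks)
  interpret T: prob_space "steps p" by (rule prob_space_steps)
  let ?I = "\<lambda>x E Z t M. indicator {M} (population off x E Z t) :: ennreal"
  define h where "h y N u a = (\<integral>\<^sup>+Z. ?I y a Z u N \<partial>steps p)" for y N u a
  define k where "k y = ennreal (pmf (map_pmf (off x) p) y)" for y
  have h_meas [measurable]: "h y N u \<in> borel_measurable clocks" for y N u
    unfolding h_def by (rule measurable_population_clocks)
  note [measurable] = measurable_population_steps
  have pop_prob_h: "pop_prob off p y N u = (\<integral>\<^sup>+a. h y N u a \<partial>clocks)" for y N u
    by (simp add: pop_prob_def h_def)
  have offspring_int: "(\<integral>\<^sup>+z. g (off x z) \<partial>measure_pmf p) = (\<Sum>y\<in>range (off x). k y * g y)" for g :: "'a \<Rightarrow> ennreal"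
  proof -
    have "(\<integral>\<^sup>+z. g (off x z) \<partial>measure_pmf p) = (\<integral>\<^sup>+y. g y \<partial>map_pmf (off x) p)" by simp
    also have "\<dots> = (\<Sum>y\<in>range (off x). g y * k y)"
      unfolding k_def by (rule nn_integral_measure_pmf_support) (use fin in auto)
    finally show ?thesis by (simp add: mult.commute)
  qed
  have steps_int: "(\<integral>\<^sup>+Z. ?I x (glue (s, a, b)) Z t M \<partial>steps p) =
      (\<Sum>N\<in>S. \<Sum>y\<in>range (off x). k y * (h x N (t - s) a * h y (M - N) (t - s) b))"
    if "0 \<le> s" "s \<le> t" for s a b
  proof -
    have "(\<integral>\<^sup>+Z. ?I x (glue (s, a, b)) Z t M \<partial>steps p) =
       (\<integral>\<^sup>+z. \<integral>\<^sup>+Za. \<integral>\<^sup>+Zb. ?I x (glue (s, a, b)) (glue (z, Za, Zb)) t M \<partial>steps p \<partial>steps p \<partial>measure_pmf p)"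
      by (intro nn_integral_glue prob_space_measure_pmf measurable_population_steps)
    also have "\<dots> = (\<integral>\<^sup>+z. \<integral>\<^sup>+Za. \<integral>\<^sup>+Zb.
       (\<Sum>N\<in>S. ?I x a Za (t - s) N * ?I (off x z) b Zb (t - s) (M - N)) \<partial>steps p \<partial>steps p \<partial>measure_pmf p)"
      unfolding S_def sum_indicator_split
      by (intro nn_integral_cong) (simp add: indicator_def population_glue[OF that M])
    also have "\<dots> = (\<integral>\<^sup>+z. (\<Sum>N\<in>S. h x N (t - s) a * h (off x z) (M - N) (t - s) b) \<partial>measure_pmf p)"
      by (simp add: nn_integral_sum nn_integral_cmult nn_integral_multc h_def)
    also have "\<dots> = (\<Sum>N\<in>S. h x N (t - s) a * (\<Sum>y\<in>range (off x). k y * h y (M - N) (t - s) b))"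
      by (simp add: nn_integral_sum nn_integral_cmult offspring_int[of "\<lambda>y. h y _ _ b"])
    finally show ?thesis by (simp add: sum_distrib_left mult_ac)
  qed
  have "pop_prob off p x M t =
      (\<integral>\<^sup>+s. \<integral>\<^sup>+a. \<integral>\<^sup>+b. (\<integral>\<^sup>+Z. ?I x (glue (s, a, b)) Z t M \<partial>steps p) \<partial>clocks \<partial>clocks \<partial>exp1)"
    unfolding pop_prob_def by (intro nn_integral_glue prob_space_exp1 measurable_population_clocks)
  also have "\<dots> = (\<integral>\<^sup>+s. (if t < s then indicator {M} {#x#} else
      (\<Sum>N\<in>S. \<Sum>y\<in>range (off x). k y * (pop_prob off p x N (t - s) * pop_prob off p y (M - N) (t - s)))) \<partial>exp1)"
  proof (intro nn_integral_cong_AE, use AE_exp1_nonneg in eventually_elim)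
    fix s :: real assume s: "0 \<le> s"
    show "(\<integral>\<^sup>+a. \<integral>\<^sup>+b. (\<integral>\<^sup>+Z. ?I x (glue (s, a, b)) Z t M \<partial>steps p) \<partial>clocks \<partial>clocks) =
      (if t < s then indicator {M} {#x#} else
      (\<Sum>N\<in>S. \<Sum>y\<in>range (off x). k y * (pop_prob off p x N (t - s) * pop_prob off p y (M - N) (t - s))))"
    proof (cases "t < s")
      case True
      have "(\<integral>\<^sup>+a. \<integral>\<^sup>+b. (\<integral>\<^sup>+Z. ?I x (glue (s, a, b)) Z t M \<partial>steps p) \<partial>clocks \<partial>clocks) =
         (\<integral>\<^sup>+a. \<integral>\<^sup>+b. indicator {M} {#x#} \<partial>clocks \<partial>clocks)"
      proof (intro nn_integral_cong_AE, use AE_clocks_nonneg in eventually_elim)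
        fix a :: "nat list \<times> nat \<Rightarrow> real" assume a: "\<forall>i. 0 \<le> a i"
        show "(\<integral>\<^sup>+b. (\<integral>\<^sup>+Z. ?I x (glue (s, a, b)) Z t M \<partial>steps p) \<partial>clocks) =
            (\<integral>\<^sup>+b. indicator {M} {#x#} \<partial>clocks)"
        proof (intro nn_integral_cong_AE, use AE_clocks_nonneg in eventually_elim)
          fix b :: "nat list \<times> nat \<Rightarrow> real" assume b: "\<forall>i. 0 \<le> b i"
          show "(\<integral>\<^sup>+Z. ?I x (glue (s, a, b)) Z t M \<partial>steps p) = indicator {M} {#x#}"
          proof -
            have "population off x (glue (s, a, b)) Z t = {#x#}" for Z
              using a b t True by (intro population_glue_less) auto
            then show ?thesis by (simp add: T.emeasure_space_1)
          qed
        qed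
      qed
      then show ?thesis using True by (simp add: C.emeasure_space_1)
    next
      case False
      then show ?thesis
        using s by (simp add: steps_int nn_integral_sum nn_integral_cmult nn_integral_multc pop_prob_h)
    qed
  qed
  finally show ?thesis unfolding k_def .
qed

lemma nn_integral_exp1:
  assumes [measurable]: "f \<in> borel_measurable borel"
  shows "(\<integral>\<^sup>+s. f s \<partial>exp1) = (\<integral>\<^sup>+s. ennreal (exp (- s)) * f s * indicator {0..} s \<partial>lborel)"
  unfolding exp1_def
  by (subst nn_integral_density) (auto intro!: nn_integral_cong simp: exponential_density_def indicator_def)

lemma exp1_tail:
  assumes "0 \<le> t"
  shows "(\<integral>\<^sup>+s. indicator {t<..} s \<partial>exp1) = ennreal (exp (- t))"
proof -
  interpret prob_space exp1 by (rule prob_space_exp1)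
  have "distributed exp1 lborel (\<lambda>x. x) (exponential_density 1)"
    by (simp add: distributed_def exp1_def distr_id2 cong: distr_cong)
  from exponential_distributedD_gt[OF this assms] have "measure exp1 {t<..} = exp (- t)"
    by (simp add: greaterThan_def)
  then show ?thesis by (simp add: emeasure_eq_measure sets_exp1)
qed

text \<open>The size of a Yule tree at time \<open>t\<close> is geometric with parameter \<open>exp (- t)\<close>, and given its size the
  population is that of the urn. The product form passes through the renewal equation because the
  exponents of \<open>1 - exp (- u)\<close> of the two families add up to \<open>size M - 2\<close>; the sum that remains is
  the backward equation of the urn.\<close>

theorem pop_prob_eq:
  fixes off :: "'a::countable \<Rightarrow> nat \<Rightarrow> 'a" and p :: "nat pmf"
  assumes fin: "\<And>x. finite (range (off x))" and t: "0 \<le> t" and M: "M \<noteq> {#}"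
  defines "K \<equiv> (\<lambda>x. map_pmf (off x) p)"
  shows "pop_prob off p x M t = ennreal (exp (- t) * (1 - exp (- t)) ^ (size M - 1) * urn_prob K x M)"
  using t M
proof (induction "size M" arbitrary: M x t rule: less_induct)
  case (less M x t)
  let ?n = "size M"
  define S where "S = {N. N \<subseteq># M} - {{#}, M}"
  define c where "c = (real ?n - 1) * urn_prob K x M"
  have n: "?n \<ge> 1" using less.prems by (simp add: Suc_le_eq nonempty_has_size)
  have urn_nonneg: "0 \<le> urn_prob K y N" for y N by (simp add: urn_prob_def)
  have c_nonneg: "0 \<le> c" using n urn_nonneg by (simp add: c_def)
  have finS: "finite S" by (simp add: S_def finite_submultisets)
  have c: "(\<Sum>N\<in>S. \<Sum>y\<in>range (off x). pmf (K x) y * (urn_prob K x N * urn_prob K y (M - N))) = c"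
  proof (cases "?n = 1")
    case True
    then obtain y where y: "M = {#y#}" by (metis size_1_singleton_mset)
    then have "S = {}" by (auto simp: S_def subset_mset.le_iff_add single_is_union)
    then show ?thesis using True by (simp add: c_def)
  next
    case False
    have "c = (\<Sum>y\<in>range (off x). pmf (K x) y * splitting_sum (urn_prob K x) (urn_prob K y) M)"
      unfolding c_def by (rule urn_prob_backward) (use n False fin in \<open>auto simp: K_def\<close>)
    also have "\<dots> = (\<Sum>N\<in>{N. N \<subseteq># M}. \<Sum>y\<in>range (off x). pmf (K x) y * (urn_prob K x N * urn_prob K y (M - N)))"
      unfolding splitting_sum_def sum_distrib_left by (rule sum.swap)
    also have "\<dots> = (\<Sum>N\<in>S. \<Sum>y\<in>range (off x). pmf (K x) y * (urn_prob K x N * urn_prob K y (M - N)))"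
      by (intro sum.mono_neutral_right) (auto simp: S_def finite_submultisets)
    finally show ?thesis by simp
  qed
  have inner: "(\<Sum>N\<in>S. \<Sum>y\<in>range (off x). pmf (K x) y * (pop_prob off p x N u * pop_prob off p y (M - N) u)) =
      ennreal (exp (- u) * exp (- u) * (1 - exp (- u)) ^ (?n - 2) * c)" if u: "0 \<le> u" for u
  proof -
    have "(\<Sum>N\<in>S. \<Sum>y\<in>range (off x). pmf (K x) y * (pop_prob off p x N u * pop_prob off p y (M - N) u)) =
      (\<Sum>N\<in>S. \<Sum>y\<in>range (off x). ennreal (exp (- u) * exp (- u) * (1 - exp (- u)) ^ (?n - 2) *
         (pmf (K x) y * (urn_prob K x N * urn_prob K y (M - N)))))"
    proof (intro sum.cong refl)
      fix N y assume N: "N \<in> S"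
      then obtain C where C: "M = N + C" "N \<noteq> {#}" "C \<noteq> {#}"
        by (auto simp: S_def subset_mset.le_iff_add)
      then have s: "size N < ?n" "size C < ?n" "size N \<ge> 1" "size C \<ge> 1" "?n = size N + size C"
        by (simp_all add: nonempty_has_size Suc_le_eq)
      have e: "?n - 2 = (size N - 1) + (size C - 1)" using s by simp
      have p: "0 \<le> 1 - exp (- u)" using u by simp
      have "pop_prob off p x N u = ennreal (exp (- u) * (1 - exp (- u)) ^ (size N - 1) * urn_prob K x N)"
        "pop_prob off p y C u = ennreal (exp (- u) * (1 - exp (- u)) ^ (size C - 1) * urn_prob K y C)"
        using less.hyps[of N u x] less.hyps[of C u y] s C u by auto
      moreover have "ennreal (pmf (K x) y) * (ennreal \<alpha> * ennreal \<beta>) = ennreal (pmf (K x) y * (\<alpha> * \<beta>))"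
        if "0 \<le> \<alpha>" "0 \<le> \<beta>" for \<alpha> \<beta>
        using that by (simp add: ennreal_mult)
      ultimately have "pmf (K x) y * (pop_prob off p x N u * pop_prob off p y (M - N) u) =
        ennreal (pmf (K x) y * ((exp (- u) * (1 - exp (- u)) ^ (size N - 1) * urn_prob K x N) *
          (exp (- u) * (1 - exp (- u)) ^ (size C - 1) * urn_prob K y C)))"
        using C(1) p urn_nonneg by simp
      also have "pmf (K x) y * ((exp (- u) * (1 - exp (- u)) ^ (size N - 1) * urn_prob K x N) *
          (exp (- u) * (1 - exp (- u)) ^ (size C - 1) * urn_prob K y C)) =
         exp (- u) * exp (- u) * (1 - exp (- u)) ^ (?n - 2) * (pmf (K x) y * (urn_prob K x N * urn_prob K y (M - N)))"
        unfolding e power_add using C(1) by (simp add: mult_ac)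
      finally show "pmf (K x) y * (pop_prob off p x N u * pop_prob off p y (M - N) u) =
        ennreal (exp (- u) * exp (- u) * (1 - exp (- u)) ^ (?n - 2) *
         (pmf (K x) y * (urn_prob K x N * urn_prob K y (M - N))))" .
    qed
    also have "\<dots> = ennreal (\<Sum>N\<in>S. \<Sum>y\<in>range (off x). exp (- u) * exp (- u) * (1 - exp (- u)) ^ (?n - 2) *
         (pmf (K x) y * (urn_prob K x N * urn_prob K y (M - N))))"
      using u urn_nonneg by (simp add: sum_nonneg)
    also have "(\<Sum>N\<in>S. \<Sum>y\<in>range (off x). exp (- u) * exp (- u) * (1 - exp (- u)) ^ (?n - 2) *
         (pmf (K x) y * (urn_prob K x N * urn_prob K y (M - N)))) = exp (- u) * exp (- u) * (1 - exp (- u)) ^ (?n - 2) * c"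
      unfolding c[symmetric] by (simp add: sum_distrib_left)
    finally show ?thesis .
  qed
  have "pop_prob off p x M t = (\<integral>\<^sup>+s. (if t < s then indicator {M} {#x#} else
      (\<Sum>N\<in>S. \<Sum>y\<in>range (off x). pmf (K x) y * (pop_prob off p x N (t - s) * pop_prob off p y (M - N) (t - s)))) \<partial>exp1)"
    unfolding S_def K_def by (intro pop_prob_rec fin less.prems)
  also have "\<dots> = (\<integral>\<^sup>+s. indicator {M} {#x#} * indicator {t<..} s +
      ennreal (exp (- (t - s)) * exp (- (t - s)) * (1 - exp (- (t - s))) ^ (?n - 2) * c) * indicator {..t} s \<partial>exp1)"
    by (intro nn_integral_cong) (auto simp: inner not_less simp del: minus_diff_eq)
  also have "\<dots> = indicator {M} {#x#} * ennreal (exp (- t)) +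
      (\<integral>\<^sup>+s. ennreal (exp (- (t - s)) * exp (- (t - s)) * (1 - exp (- (t - s))) ^ (?n - 2) * c) * indicator {..t} s \<partial>exp1)"
    by (subst nn_integral_add) (auto simp: nn_integral_cmult exp1_tail less.prems sets_exp1 simp del: nn_integral_indicator)
  also have "(\<integral>\<^sup>+s. ennreal (exp (- (t - s)) * exp (- (t - s)) * (1 - exp (- (t - s))) ^ (?n - 2) * c) * indicator {..t} s \<partial>exp1) =
     (\<integral>\<^sup>+s. ennreal (c * exp (- t) * exp (s - t) * (1 - exp (s - t)) ^ (?n - 2)) * indicator {0..t} s \<partial>lborel)"
  proof (subst nn_integral_exp1, measurable, rule nn_integral_cong)
    fix s :: real
    show "ennreal (exp (- s)) * (ennreal (exp (- (t - s)) * exp (- (t - s)) * (1 - exp (- (t - s))) ^ (?n - 2) * c) * indicator {..t} s) * indicator {0..} s =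
      ennreal (c * exp (- t) * exp (s - t) * (1 - exp (s - t)) ^ (?n - 2)) * indicator {0..t} s"
    proof (cases "0 \<le> s \<and> s \<le> t")
      case True
      have "exp (- s) * (exp (s - t) * exp (s - t) * (1 - exp (s - t)) ^ (?n - 2) * c) =
          (exp (- s) * exp (s - t)) * (c * exp (s - t) * (1 - exp (s - t)) ^ (?n - 2))"
        by (simp only: mult_ac)
      also have "exp (- s) * exp (s - t) = exp (- t)" by (simp add: exp_add[symmetric])
      also have "exp (- t) * (c * exp (s - t) * (1 - exp (s - t)) ^ (?n - 2)) =
          c * exp (- t) * exp (s - t) * (1 - exp (s - t)) ^ (?n - 2)"
        by (simp only: mult_ac)
      finally have eq: "exp (- s) * (exp (s - t) * exp (s - t) * (1 - exp (s - t)) ^ (?n - 2) * c) =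
          c * exp (- t) * exp (s - t) * (1 - exp (s - t)) ^ (?n - 2)" .
      then show ?thesis using True by (simp add: ennreal_mult'[symmetric]) (simp only: eq)
    qed (auto simp: indicator_def)
  qed
  also have "indicator {M} {#x#} * ennreal (exp (- t)) + \<dots> = ennreal (exp (- t) * (1 - exp (- t)) ^ (?n - 1) * urn_prob K x M)"
  proof (cases "?n = 1")
    case True
    then obtain y where y: "M = {#y#}" by (metis size_1_singleton_mset)
    then show ?thesis using True by (simp add: c_def urn_prob_single indicator_def)
  next
    case False
    then have n2: "?n \<ge> 2" using n by simp
    then have m: "?n - 1 = Suc (?n - 2)" by simp
    \<comment> \<open>an antiderivative of the integrand; it vanishes at \<open>s = t\<close>\<close>
    define F where "F s = - (urn_prob K x M * exp (- t) * (1 - exp (s - t)) ^ (?n - 1))" for s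
    have rn: "real ?n - 1 = real (?n - 1)" using n by simp
    have "(\<integral>\<^sup>+s. ennreal (c * exp (- t) * exp (s - t) * (1 - exp (s - t)) ^ (?n - 2)) * indicator {0..t} s \<partial>lborel) =
        ennreal (F t - F 0)"
    proof (rule nn_integral_FTC_Icc)
      fix s assume "s \<in> {0..t}"
      then show "0 \<le> c * exp (- t) * exp (s - t) * (1 - exp (s - t)) ^ (?n - 2)"
        using c_nonneg by simp
      have "((\<lambda>s. - (urn_prob K x M * exp (- t) * (1 - exp (s - t)) ^ Suc (?n - 2))) has_real_derivative
         - (urn_prob K x M * exp (- t) * (real (Suc (?n - 2)) * (- exp (s - t) * (1 - exp (s - t)) ^ (?n - 2))))) (at s)"
        by (rule derivative_eq_intros refl | simp)+
      also have "- (urn_prob K x M * exp (- t) * (real (Suc (?n - 2)) * (- exp (s - t) * (1 - exp (s - t)) ^ (?n - 2)))) =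
          c * exp (- t) * exp (s - t) * (1 - exp (s - t)) ^ (?n - 2)"
        unfolding c_def rn m by (simp add: mult_ac)
      finally show "(F has_real_derivative c * exp (- t) * exp (s - t) * (1 - exp (s - t)) ^ (?n - 2)) (at s)"
        unfolding F_def[abs_def] m .
    qed (use less.prems in auto)
    moreover have "M \<noteq> {#x#}" using n2 by auto
    ultimately show ?thesis using m by (simp add: F_def mult_ac)
  qed
  finally show ?case .
qed

lemma exp1_geometric: "(\<integral>\<^sup>+t. ennreal (exp (- t) * (1 - exp (- t)) ^ n) \<partial>exp1) = ennreal (1 / ((real n + 1) * (real n + 2)))"
proof -
  define F where "F t = (1 - exp (- t)) ^ (Suc n) / (real n + 1) - (1 - exp (- t)) ^ (Suc (Suc n)) / (real n + 2)" for t :: real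
  have "(\<integral>\<^sup>+t. ennreal (exp (- t) * (1 - exp (- t)) ^ n) \<partial>exp1) =
     (\<integral>\<^sup>+t. ennreal (exp (- t) * (exp (- t) * (1 - exp (- t)) ^ n)) * indicator {0..} t \<partial>lborel)"
    by (subst nn_integral_exp1) (auto intro!: nn_integral_cong simp: ennreal_mult' simp del: ennreal_mult'')
  also have "\<dots> = ennreal ((1 / (real n + 1) - 1 / (real n + 2)) - F 0)"
  proof (rule nn_integral_FTC_atLeast)
    fix t :: real assume "0 \<le> t"
    then show "0 \<le> exp (- t) * (exp (- t) * (1 - exp (- t)) ^ n)" by simp
    have d: "((\<lambda>t. (1 - exp (- t)) ^ Suc m / (real m + 1)) has_real_derivative (1 - exp (- t)) ^ m * exp (- t)) (at t)" for m
      by (rule derivative_eq_intros refl | simp add: add.commute)+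
    have "(F has_real_derivative (1 - exp (- t)) ^ n * exp (- t) - (1 - exp (- t)) ^ (Suc n) * exp (- t)) (at t)"
      using DERIV_diff[OF d[of n] d[of "Suc n"]] by (simp add: F_def[abs_def] add.commute)
    moreover have "(1 - exp (- t)) ^ n * exp (- t) - (1 - exp (- t)) ^ (Suc n) * exp (- t) = exp (- t) * (exp (- t) * (1 - exp (- t)) ^ n)"
      by (simp add: algebra_simps)
    ultimately show "(F has_real_derivative exp (- t) * (exp (- t) * (1 - exp (- t)) ^ n)) (at t)" by simp
  next
    have e: "((\<lambda>t::real. exp (- t)) \<longlongrightarrow> 0) at_top"
      using exp_at_bot filterlim_uminus_at_bot_at_top filterlim_compose by blast
    have "(F \<longlongrightarrow> (1 - 0) ^ Suc n / (real n + 1) - (1 - 0) ^ Suc (Suc n) / (real n + 2)) at_top"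
      unfolding F_def by (intro tendsto_intros e) auto
    then show "(F \<longlongrightarrow> 1 / (real n + 1) - 1 / (real n + 2)) at_top" by simp
  qed simp
  also have "(1 / (real n + 1) - 1 / (real n + 2)) - F 0 = 1 / ((real n + 1) * (real n + 2))"
    by (simp add: F_def field_simps)
  finally show ?thesis .
qed

lemma nn_integral_ct_space:
  assumes f: "(\<lambda>(E, Z, t). f E Z t) \<in> borel_measurable (clocks \<Otimes>\<^sub>M steps p \<Otimes>\<^sub>M exp1)"
  shows "(\<integral>\<^sup>+(E, Z, t). f E Z t \<partial>ct_space p) = (\<integral>\<^sup>+t. \<integral>\<^sup>+E. \<integral>\<^sup>+Z. f E Z t \<partial>steps p \<partial>clocks \<partial>exp1)"
proof -
  interpret C: prob_space clocks by (rule prob_space_clocks)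
  interpret T: prob_space "steps p" by (rule prob_space_steps)
  interpret X: prob_space exp1 by (rule prob_space_exp1)
  interpret TX: pair_prob_space "steps p" exp1 ..
  interpret CX: pair_prob_space clocks exp1 ..
  note [measurable] = f
  have fE: "(\<lambda>(Z, t). f E Z t) \<in> borel_measurable (steps p \<Otimes>\<^sub>M exp1)" for E
  proof -
    have "E \<in> space clocks" by (simp add: space_PiM)
    from measurable_compose_Pair1[OF this f] show ?thesis by simp
  qed
  have "(\<integral>\<^sup>+(E, Z, t). f E Z t \<partial>ct_space p) = (\<integral>\<^sup>+E. \<integral>\<^sup>+(Z, t). f E Z t \<partial>(steps p \<Otimes>\<^sub>M exp1) \<partial>clocks)"
    unfolding ct_space_def by (subst TX.nn_integral_fst[symmetric]) (use f in \<open>simp_all add: case_prod_beta'\<close>)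
  also have "\<dots> = (\<integral>\<^sup>+E. \<integral>\<^sup>+t. \<integral>\<^sup>+Z. f E Z t \<partial>steps p \<partial>exp1 \<partial>clocks)"
    using TX.nn_integral_snd[OF fE] by (simp add: case_prod_beta')
  also have "\<dots> = (\<integral>\<^sup>+t. \<integral>\<^sup>+E. \<integral>\<^sup>+Z. f E Z t \<partial>steps p \<partial>clocks \<partial>exp1)"
  proof -
    have "(\<lambda>((E, t), Z). f E Z t) \<in> borel_measurable ((clocks \<Otimes>\<^sub>M exp1) \<Otimes>\<^sub>M steps p)"
      using measurable_compose[OF _ f, of "\<lambda>\<omega>. (fst (fst \<omega>), snd \<omega>, snd (fst \<omega>))" "(clocks \<Otimes>\<^sub>M exp1) \<Otimes>\<^sub>M steps p"]
      by (simp add: case_prod_beta')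
    then have "(\<lambda>Et. \<integral>\<^sup>+Z. f (fst Et) Z (snd Et) \<partial>steps p) \<in> borel_measurable (clocks \<Otimes>\<^sub>M exp1)"
      using T.borel_measurable_nn_integral[of "\<lambda>Et Z. f (fst Et) Z (snd Et)" "clocks \<Otimes>\<^sub>M exp1"] by (simp add: case_prod_beta')
    then show ?thesis
      using CX.Fubini'[of "\<lambda>E t. \<integral>\<^sup>+Z. f E Z t \<partial>steps p"] by (simp add: case_prod_beta')
  qed
  finally show ?thesis .
qed

definition final_population ::
  "('a \<Rightarrow> nat \<Rightarrow> 'a) \<Rightarrow> 'a \<Rightarrow> (nat list \<times> nat \<Rightarrow> real) \<times> (nat list \<times> nat \<Rightarrow> nat) \<times> real \<Rightarrow> 'a multiset" where
  "final_population off x = (\<lambda>(E, Z, \<tau>). population off x E Z \<tau>)"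

lemma measurable_final_population [measurable]:
  fixes off :: "'a::countable \<Rightarrow> nat \<Rightarrow> 'a"
  shows "final_population off x \<in> ct_space p \<rightarrow>\<^sub>M count_space UNIV"
  unfolding final_population_def ct_space_def by (rule measurable_population)

lemma emeasure_final_population:
  fixes off :: "'a::countable \<Rightarrow> nat \<Rightarrow> 'a" and p :: "nat pmf"
  assumes fin: "\<And>x. finite (range (off x))" and M: "M \<noteq> {#}"
  defines "K \<equiv> (\<lambda>x. map_pmf (off x) p)"
  shows "emeasure (distr (ct_space p) (count_space UNIV) (final_population off x)) {M} =
    ennreal (urn_prob K x M / (real (size M) * (real (size M) + 1)))"
proof -
  let ?n = "size M - 1"
  have n: "real (size M) = real ?n + 1" using M by (simp add: of_nat_diff Suc_le_eq nonempty_has_size)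
  have a0: "0 \<le> urn_prob K x M" by (simp add: urn_prob_def)
  have "emeasure (distr (ct_space p) (count_space UNIV) (final_population off x)) {M} =
      (\<integral>\<^sup>+\<omega>. indicator {M} \<omega> \<partial>distr (ct_space p) (count_space UNIV) (final_population off x))"
    by simp
  also have "\<dots> = (\<integral>\<^sup>+\<omega>. indicator {M} (final_population off x \<omega>) \<partial>ct_space p)"
    by (rule nn_integral_distr) auto
  also have "\<dots> = (\<integral>\<^sup>+(E, Z, t). indicator {M} (population off x E Z t) \<partial>ct_space p)"
    by (simp add: final_population_def case_prod_beta')
  also have "\<dots> = (\<integral>\<^sup>+t. pop_prob off p x M t \<partial>exp1)"
    unfolding pop_prob_def
    by (rule nn_integral_ct_space)
      (use measurable_compose[OF measurable_population, of "indicator {M}" borel off x p] in \<open>simp add: case_prod_beta'\<close>)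
  also have "\<dots> = (\<integral>\<^sup>+t. ennreal (urn_prob K x M) * ennreal (exp (- t) * (1 - exp (- t)) ^ ?n) \<partial>exp1)"
  proof (intro nn_integral_cong_AE, use AE_exp1_nonneg in eventually_elim)
    fix t :: real assume t: "0 \<le> t"
    show "pop_prob off p x M t = ennreal (urn_prob K x M) * ennreal (exp (- t) * (1 - exp (- t)) ^ ?n)"
      unfolding pop_prob_eq[OF fin t M] K_def[symmetric] ennreal_mult'[OF a0, symmetric] by (simp add: mult_ac)
  qed
  also have "\<dots> = ennreal (urn_prob K x M) * ennreal (1 / ((real ?n + 1) * (real ?n + 2)))"
    by (simp add: nn_integral_cmult exp1_geometric sets_exp1)
  also have "\<dots> = ennreal (urn_prob K x M / (real (size M) * (real (size M) + 1)))"
    unfolding n ennreal_mult'[OF a0, symmetric] by (simp add: add.commute)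
  finally show ?thesis .
qed

lemma sums_inverse_consecutive: "(\<lambda>n. 1 / ((real n + 1) * (real n + 2))) sums 1"
proof -
  have "(\<lambda>n. 1 / real (Suc n)) \<longlonglongrightarrow> 0" by (rule LIMSEQ_Suc) (rule lim_1_over_n)
  from telescope_sums'[OF this] show ?thesis by (simp add: field_simps)
qed

text \<open>The law of the size of a Yule tree at an independent exponential time, minus one.\<close>

definition urn_time :: "nat pmf" where
  "urn_time = embed_pmf (\<lambda>n. 1 / ((real n + 1) * (real n + 2)))"

lemma pmf_urn_time: "pmf urn_time n = 1 / ((real n + 1) * (real n + 2))"
  unfolding urn_time_def
proof (rule pmf_embed_pmf)
  show "(\<integral>\<^sup>+n. ennreal (1 / ((real n + 1) * (real n + 2))) \<partial>count_space UNIV) = 1"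
    unfolding nn_integral_count_space_nat
    by (subst suminf_ennreal_eq[OF _ sums_inverse_consecutive]) auto
qed simp

definition urn_limit :: "('a \<Rightarrow> 'a pmf) \<Rightarrow> 'a \<Rightarrow> 'a multiset pmf" where
  "urn_limit K x = urn_time \<bind> urn K x"

lemma pmf_urn_limit:
  "pmf (urn_limit K x) M = urn_prob K x M / (real (size M) * (real (size M) + 1))"
proof (cases "M = {#}")
  case True
  have "pmf (urn K x n) {#} = 0" for n using size_urn[of "{#}" K x n] by (auto simp: pmf_eq_0_set_pmf)
  then show ?thesis using True by (simp add: urn_limit_def pmf_bind)
next
  case False
  have "pmf (urn_limit K x) M = measure_pmf.expectation urn_time (\<lambda>n. pmf (urn K x n) M)"
    by (simp add: urn_limit_def pmf_bind)
  also have "\<dots> = (\<Sum>n\<in>{size M - 1}. pmf (urn K x n) M * pmf urn_time n)"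
    by (rule integral_measure_pmf_real) (auto simp: pmf_eq_0_set_pmf dest: size_urn)
  also have "\<dots> = urn_prob K x M / (real (size M) * (real (size M) + 1))"
  proof -
    obtain k where "size M = Suc k" using False by (cases "size M") auto
    then show ?thesis by (simp add: urn_prob_def pmf_urn_time add.commute)
  qed
  finally show ?thesis .
qed

text \<open>The atoms away from \<open>{#}\<close> agree by the formula at a fixed time. Those on the right have total
  mass one, so no mass is left for \<open>{#}\<close>: the Yule tree is almost surely finite at time \<open>\<tau>\<close>.\<close>

theorem distr_final_population:
  fixes off :: "'a::countable \<Rightarrow> nat \<Rightarrow> 'a" and p :: "nat pmf"
  assumes fin: "\<And>x. finite (range (off x))"
  shows "distr (ct_space p) (count_space UNIV) (final_population off x) =
    measure_pmf (urn_limit (\<lambda>x. map_pmf (off x) p) x)" (is "?D = measure_pmf ?L")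
proof -
  interpret D: prob_space ?D
    by (intro prob_space.prob_space_distr prob_space_ct_space measurable_final_population)
  have 1: "emeasure ?D {M} = emeasure ?L {M}" if "M \<noteq> {#}" for M
    unfolding emeasure_final_population[OF fin that] emeasure_pmf_single pmf_urn_limit ..
  have 2: "emeasure ?D (- {{#}}) = emeasure ?L (- {{#}})"
    using 1 by (subst (1 2) emeasure_countable_singleton) (auto intro!: nn_integral_cong)
  have "D.prob {{#}} = 1 - D.prob (- {{#}})"
    using D.prob_compl[of "{{#}}"] by (simp add: Compl_eq_Diff_UNIV)
  also have "D.prob (- {{#}}) = measure_pmf.prob ?L (- {{#}})"
    using 2 by (simp add: measure_def)
  also have "1 - \<dots> = measure_pmf.prob ?L {{#}}"
    using measure_pmf.prob_compl[of "{{#}}" ?L] by (simp add: Compl_eq_Diff_UNIV)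
  finally have "emeasure ?D {{#}} = emeasure ?L {{#}}"
    by (simp add: D.emeasure_eq_measure measure_pmf.emeasure_eq_measure)
  with 1 have 3: "emeasure ?D {M} = emeasure ?L {M}" for M by (cases "M = {#}") auto
  show ?thesis by (rule measure_eqI_countable[of _ UNIV]) (auto simp: 3)
qed

text \<open>The stationarity equation of the empirical distribution of types in a uniformly growing forest:
  the newcomers of type \<open>{#x#}\<close> and the types that turn into \<open>M\<close> balance the growth of the forest
  and the vertices that leave \<open>M\<close>.\<close>

lemma urn_limit_forward:
  "pmf (urn_limit K x) M * (1 + real (size M)) =
   of_bool (M = {#x#}) + parents_sum K (pmf (urn_limit K x)) M"
proof -
  consider "M = {#}" | y where "M = {#y#}" | "size M \<ge> 2"
    by (metis One_nat_def Suc_1 Suc_leI le_less_linear less_Suc_eq_le nat_less_le size_1_singleton_mset size_eq_0_iff_empty le_zero_eq le_SucE)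
  then show ?thesis
  proof cases
    case 3
    let ?m = "real (size M)"
    have "pmf (urn_limit K x) M * (1 + ?m) = (?m - 1) * urn_prob K x M / (?m * (?m - 1))"
    proof -
      have "a / (m * (m + 1)) * (1 + m) = (m - 1) * a / (m * (m - 1))" if "2 \<le> m" for a m :: real
        using that by (simp add: divide_simps)
      then show ?thesis using 3 by (simp add: pmf_urn_limit)
    qed
    also have "\<dots> = parents_sum K (pmf (urn_limit K x)) M"
      unfolding urn_prob_forward parents_sum_def sum_divide_distrib
    proof (intro sum.cong refl)
      fix y assume y: "y \<in># M"
      then have "size M = Suc (size (M - {#y#}))" by (metis insert_DiffM size_add_mset)
      then show "birth_rate K (M - {#y#}) y * urn_prob K x (M - {#y#}) / (?m * (?m - 1)) =
         birth_rate K (M - {#y#}) y * pmf (urn_limit K x) (M - {#y#})"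
        by (simp add: pmf_urn_limit mult_ac)
    qed
    finally show ?thesis using 3 by auto
  qed (auto simp: pmf_urn_limit parents_sum_def urn_prob_single birth_rate_def)
qed

section \<open>Types of vertices in the discrete tree\<close>

text \<open>A history lists the pairs \<open>(V\<^sub>n, Z\<^sub>n\<^sub>+\<^sub>1)\<close>, latest first, and starts with the two vertices 0 and 1;
  so a history \<open>h\<close> has the vertices below \<open>length h + 2\<close>. The vertices descending from \<open>v\<close> are
  \<open>v\<close> and those that arrived when a vertex descending from \<open>v\<close> was selected; each of them gets a
  label relative to \<open>v\<close>, by the same rule as in continuous time. At the start the vertices 0 and 1
  are unrelated, although 1 is attached to 0. This affects only what is recorded about the root.\<close>

fun labels :: "('a \<Rightarrow> nat \<Rightarrow> 'a) \<Rightarrow> 'a \<Rightarrow> (nat \<times> nat) list \<Rightarrow> nat \<Rightarrow> nat \<Rightarrow> 'a option" where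
  "labels off x [] v w = (if v = w \<and> v \<le> 1 then Some x else None)"
| "labels off x ((u, z) # h) v w =
    (if w = length h + 2 then (if v = w then Some x else map_option (\<lambda>y. off y z) (labels off x h v u))
     else labels off x h v w)"

fun descendants :: "(nat \<times> nat) list \<Rightarrow> nat \<Rightarrow> nat set" where
  "descendants [] v = (if v \<le> 1 then {v} else {})"
| "descendants ((u, z) # h) v =
    descendants h v \<union> (if v = length h + 2 \<or> u \<in> descendants h v then {length h + 2} else {})"

definition fringe_type :: "('a \<Rightarrow> nat \<Rightarrow> 'a) \<Rightarrow> 'a \<Rightarrow> (nat \<times> nat) list \<Rightarrow> nat \<Rightarrow> 'a multiset" where
  "fringe_type off x h v = image_mset (\<lambda>w. the (labels off x h v w)) (mset_set (descendants h v))"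

definition type_count :: "('a \<Rightarrow> nat \<Rightarrow> 'a) \<Rightarrow> 'a \<Rightarrow> (nat \<times> nat) list \<Rightarrow> 'a multiset \<Rightarrow> real" where
  "type_count off x h M = (\<Sum>v<length h + 2. of_bool (fringe_type off x h v = M))"

lemma descendants_bounds: "w \<in> descendants h v \<Longrightarrow> v \<le> w \<and> w < length h + 2"
proof (induction h arbitrary: w)
  case (Cons e h)
  obtain u z where e: "e = (u, z)" by (cases e)
  show ?case
  proof (cases "w = length h + 2")
    case True
    then have "v = w \<or> u \<in> descendants h v" using Cons.prems Cons.IH[of w] by (auto simp: e split: if_splits)
    then show ?thesis using True Cons.IH[of u] by auto
  next
    case False
    then have "w \<in> descendants h v" using Cons.prems by (auto simp: e split: if_splits)
    then show ?thesis using Cons.IH[of w] by auto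
  qed
qed (auto split: if_splits)

lemma finite_descendants: "finite (descendants h v)"
  by (rule finite_subset[of _ "{..<length h + 2}"]) (auto dest: descendants_bounds)

lemma labels_eq_None_iff: "labels off x h v w = None \<longleftrightarrow> w \<notin> descendants h v"
proof (induction h arbitrary: w)
  case (Cons e h)
  have "length h + 2 \<notin> descendants h v" using descendants_bounds by blast
  then show ?case using Cons by (cases e) auto
qed simp

lemma descendants_self: "v < length h + 2 \<Longrightarrow> v \<in> descendants h v"
proof (induction h)
  case (Cons e h)
  then show ?case by (cases e; cases "v = length h + 2") auto
qed simp

lemma fringe_type_new: "fringe_type off x ((u, z) # h) (length h + 2) = {#x#}"
proof -
  have "descendants h (length h + 2) = {}" using descendants_bounds by fastforce
  then show ?thesis by (simp add: fringe_type_def)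
qed

lemma fringe_type_Cons:
  assumes "v < length h + 2"
  shows "fringe_type off x ((u, z) # h) v =
    (if u \<in> descendants h v then add_mset (off (the (labels off x h v u)) z) (fringe_type off x h v)
     else fringe_type off x h v)"
proof -
  have new: "length h + 2 \<notin> descendants h v" using descendants_bounds by blast
  have *: "image_mset (\<lambda>w. the (labels off x ((u, z) # h) v w)) (mset_set (descendants h v)) = fringe_type off x h v"
    unfolding fringe_type_def using new by (intro image_mset_cong) (auto simp: finite_descendants)
  show ?thesis
  proof (cases "u \<in> descendants h v")
    case True
    then obtain y where y: "labels off x h v u = Some y" using labels_eq_None_iff[of off x h v u] by auto
    have "fringe_type off x ((u, z) # h) v = add_mset (off y z)
        (image_mset (\<lambda>w. the (labels off x ((u, z) # h) v w)) (mset_set (descendants h v)))"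
      unfolding fringe_type_def descendants.simps using True assms new y by (simp add: finite_descendants)
    then show ?thesis using * True y by simp
  next
    case False
    then have "descendants ((u, z) # h) v = descendants h v" using assms by simp
    then show ?thesis using * False by (simp only: fringe_type_def if_False)
  qed
qed

lemma size_fringe_type: "size (fringe_type off x h v) = card (descendants h v)"
  by (simp add: fringe_type_def)

text \<open>Selection turns the vertices into a tree of its own, the recursive tree in which \<open>u\<close> is the parent
  of the newcomer; its subtrees are nested or disjoint.\<close>

lemma descendants_laminar:
  "w \<in> descendants h v \<Longrightarrow> w \<in> descendants h v' \<Longrightarrow> v \<le> v' \<Longrightarrow> descendants h v' \<subseteq> descendants h v"
proof (induction h arbitrary: w)
  case (Cons e h)
  obtain u z where e: "e = (u, z)" by (cases e)
  have nin: "length h + 2 \<notin> descendants h v''" for v'' using descendants_bounds by blast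
  have sub: "descendants h v' \<subseteq> descendants h v" if "w' \<in> descendants h v" "w' \<in> descendants h v'" for w'
    using Cons.IH that Cons.prems(3) by blast
  show ?case
  proof (cases "v' = length h + 2")
    case True
    then have "descendants h v' = {}" using descendants_bounds by fastforce
    then have "descendants (e # h) v' = {length h + 2}" using True by (simp add: e)
    then show ?thesis using Cons.prems by auto
  next
    case False
    have v: "v \<noteq> length h + 2"
    proof
      assume "v = length h + 2"
      then have "length h + 2 < v'" using Cons.prems(3) False by simp
      then show False using descendants_bounds[OF Cons.prems(2)] by simp
    qed
    show ?thesis
    proof (cases "w = length h + 2")
      case True
      then have "u \<in> descendants h v" "u \<in> descendants h v'"
        using Cons.prems nin v False by (auto simp: e split: if_splits)
      then show ?thesis using sub[of u] v False by (auto simp: e)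
    next
      case ne: False
      then have "w \<in> descendants h v" "w \<in> descendants h v'"
        using Cons.prems by (auto simp: e split: if_splits)
      then show ?thesis using sub[of w] v False by (auto simp: e)
    qed
  qed
qed (auto split: if_splits)

lemma ancestors_distinct_sizes:
  assumes "u \<in> descendants h v" "u \<in> descendants h v'" "card (descendants h v) = card (descendants h v')"
  shows "v = v'"
proof -
  have *: "v = v'" if "v \<le> v'" "u \<in> descendants h v" "u \<in> descendants h v'"
    "card (descendants h v) = card (descendants h v')" for v v'
  proof -
    have "descendants h v' = descendants h v"
      using descendants_laminar[OF that(2,3,1)] that(4) by (intro card_subset_eq finite_descendants) auto
    moreover have "v \<in> descendants h v"
      using descendants_bounds[OF that(2)] by (intro descendants_self) auto
    ultimately have "v' \<le> v" using descendants_bounds[of v h v'] by auto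
    then show ?thesis using that by simp
  qed
  show ?thesis using *[of v v'] *[of v' v] assms by (cases "v \<le> v'") auto
qed

lemma type_count_bounds: "0 \<le> type_count off x h M" "type_count off x h M \<le> real (length h) + 2"
proof -
  have "type_count off x h M \<le> (\<Sum>v<length h + 2. 1)"
    unfolding type_count_def by (intro sum_mono) auto
  then show "type_count off x h M \<le> real (length h) + 2" by simp
qed (auto simp: type_count_def intro: sum_nonneg)

lemma type_count_Cons:
  "type_count off x ((u, z) # h) M = of_bool (M = {#x#}) + (\<Sum>v<length h + 2. of_bool (fringe_type off x ((u, z) # h) v = M))"
  using fringe_type_new[of off x u z h] by (auto simp: type_count_def)

text \<open>Only the ancestors of the selected vertex change their type. Their sets of descendants are strictly
  nested and hence have different sizes, so at most one of them leaves \<open>M\<close>, at most one enters \<open>M\<close>,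
  and the newcomer itself may have type \<open>M\<close>.\<close>

lemma type_count_increment:
  assumes "u < length h + 2"
  shows "\<bar>type_count off x ((u, z) # h) M - type_count off x h M\<bar> \<le> 2"
proof -
  let ?T = "\<lambda>v. fringe_type off x h v" and ?T' = "\<lambda>v. fringe_type off x ((u, z) # h) v"
  let ?m = "length h + 2"
  define A where "A = {v\<in>{..<?m}. u \<in> descendants h v}"
  define f where "f v = (of_bool (?T' v = M) :: real)" for v
  define g where "g v = (of_bool (?T v = M) :: real)" for v
  have A: "finite A" "A \<subseteq> {..<?m}" by (auto simp: A_def)
  have one: "(\<Sum>v\<in>A. of_bool (P v)) \<le> (1::real)" if "\<And>v v'. v \<in> A \<Longrightarrow> v' \<in> A \<Longrightarrow> P v \<Longrightarrow> P v' \<Longrightarrow> card (descendants h v) = card (descendants h v')" for P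
  proof -
    have "v = v'" if "v \<in> A" "v' \<in> A" "P v" "P v'" for v v'
      using \<open>\<And>v v'. v \<in> A \<Longrightarrow> v' \<in> A \<Longrightarrow> P v \<Longrightarrow> P v' \<Longrightarrow> card (descendants h v) = card (descendants h v')\<close>[OF that] that
      by (intro ancestors_distinct_sizes[of u h v v']) (auto simp: A_def)
    then have "card (A \<inter> {v. P v}) \<le> Suc 0"
      using A by (subst card_le_Suc0_iff_eq) auto
    then show ?thesis using A by simp
  qed
  have f1: "(\<Sum>v\<in>A. f v) \<le> 1"
    unfolding f_def
  proof (rule one)
    fix v v' assume "v \<in> A" "v' \<in> A" "?T' v = M" "?T' v' = M"
    then have "size (?T' v) = size (?T' v')" by simp
    then show "card (descendants h v) = card (descendants h v')"
      using \<open>v \<in> A\<close> \<open>v' \<in> A\<close> by (simp add: A_def fringe_type_Cons size_fringe_type[of off x h])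
  qed
  have g1: "(\<Sum>v\<in>A. g v) \<le> 1"
    unfolding g_def
  proof (rule one)
    fix v v' assume "?T v = M" "?T v' = M"
    then show "card (descendants h v) = card (descendants h v')" by (metis size_fringe_type)
  qed
  have "(\<Sum>v<?m. f v) - (\<Sum>v<?m. g v) = (\<Sum>v\<in>A. f v - g v)"
    unfolding sum_subtractf[symmetric]
    by (rule sum.mono_neutral_right) (auto simp: A_def f_def g_def fringe_type_Cons)
  then have "(\<Sum>v<?m. f v) - (\<Sum>v<?m. g v) = (\<Sum>v\<in>A. f v) - (\<Sum>v\<in>A. g v)" by (simp add: sum_subtractf)
  moreover have "0 \<le> (\<Sum>v\<in>A. f v)" "0 \<le> (\<Sum>v\<in>A. g v)" by (simp_all add: f_def g_def sum_nonneg)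
  moreover have "type_count off x ((u, z) # h) M = of_bool (M = {#x#}) + (\<Sum>v<?m. f v)" "type_count off x h M = (\<Sum>v<?m. g v)"
    unfolding type_count_Cons f_def g_def by (simp_all add: type_count_def)
  ultimately show ?thesis using f1 g1 by (cases "M = {#x#}") (auto simp: abs_le_iff)
qed


definition new_event :: "nat pmf \<Rightarrow> nat \<Rightarrow> (nat \<times> nat) pmf" where
  "new_event p m = pair_pmf (pmf_of_set {..<m}) p"

primrec histories :: "nat pmf \<Rightarrow> nat \<Rightarrow> (nat \<times> nat) list pmf" where
  "histories p 0 = return_pmf []"
| "histories p (Suc n) = histories p n \<bind> (\<lambda>h. map_pmf (\<lambda>e. e # h) (new_event p (n + 2)))"

lemma length_histories: "h \<in> set_pmf (histories p n) \<Longrightarrow> length h = n"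
  by (induction n arbitrary: h) auto

lemma pmf_add_mset_map:
  "pmf (map_pmf (\<lambda>y. add_mset y T) q) M = (\<Sum>y\<in>set_mset M. of_bool (T = M - {#y#}) * pmf q y)"
proof (cases "\<exists>y. M = add_mset y T")
  case True
  then obtain y where y: "M = add_mset y T" by blast
  have inj: "inj (\<lambda>y. add_mset y T)" by (auto intro: injI)
  have "(\<Sum>y'\<in>set_mset M. of_bool (T = M - {#y'#}) * pmf q y') = (\<Sum>y'\<in>{y}. of_bool (T = M - {#y'#}) * pmf q y')"
  proof (rule sum.mono_neutral_right)
    have "y' = y" if "y' \<in># M" "T = M - {#y'#}" for y'
    proof -
      have "add_mset y' T = M" using that by simp
      then show ?thesis using y by simp
    qed
    then show "\<forall>y'\<in>set_mset M - {y}. of_bool (T = M - {#y'#}) * pmf q y' = 0" by auto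
  qed (use y in auto)
  then show ?thesis using y pmf_map_inj'[OF inj, of q y] by simp
next
  case False
  then have "T \<noteq> M - {#y#}" if "y \<in># M" for y using that by (metis insert_DiffM)
  moreover have "pmf (map_pmf (\<lambda>y. add_mset y T) q) M = 0" using False by (auto simp: pmf_eq_0_set_pmf)
  ultimately show ?thesis by simp
qed

context
  fixes off :: "'a \<Rightarrow> nat \<Rightarrow> 'a" and x :: 'a and p :: "nat pmf" and K :: "'a \<Rightarrow> 'a pmf"
  defines "K \<equiv> (\<lambda>y. map_pmf (off y) p)"
begin

text \<open>A vertex of type \<open>T\<close> changes with probability \<open>size T / m\<close>, namely if one of its descendants is
  selected, and then it gains one individual as a step of the urn prescribes.\<close>

lemma prob_fringe_type_step:
  fixes h :: "(nat \<times> nat) list" and v :: nat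
  defines "T \<equiv> fringe_type off x h v" and "m \<equiv> length h + 2"
  assumes v: "v < m"
  shows "measure_pmf.prob (new_event p m) {e. fringe_type off x (e # h) v = M} =
    ((real m - size M) * of_bool (T = M) + (\<Sum>y\<in>set_mset M. of_bool (T = M - {#y#}) * birth_rate K (M - {#y#}) y)) / m"
proof -
  let ?D = "descendants h v"
  have D: "?D \<subseteq> {..<m}" using descendants_bounds[of _ h v] by (auto simp: m_def)
  have finD: "finite ?D" by (rule finite_descendants)
  define lab where "lab w = the (labels off x h v w)" for w
  have ne: "{..<m} \<noteq> {}" by (auto simp: m_def)
  have "measure_pmf.prob (new_event p m) {e. fringe_type off x (e # h) v = M} =
      pmf (map_pmf (\<lambda>e. fringe_type off x (e # h) v) (new_event p m)) M"
    by (simp add: pmf_map vimage_def)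
  also have "map_pmf (\<lambda>e. fringe_type off x (e # h) v) (new_event p m) =
      pmf_of_set {..<m} \<bind> (\<lambda>u. map_pmf (\<lambda>z. fringe_type off x ((u, z) # h) v) p)"
    by (simp add: new_event_def pair_pmf_def map_bind_pmf map_pmf_def[symmetric] pmf.map_comp o_def)
  also have "pmf \<dots> M = (\<Sum>u<m. pmf (map_pmf (\<lambda>z. fringe_type off x ((u, z) # h) v) p) M) / m"
    using ne by (simp add: pmf_bind_pmf_of_set)
  also have "(\<Sum>u<m. pmf (map_pmf (\<lambda>z. fringe_type off x ((u, z) # h) v) p) M) =
      (\<Sum>u\<in>{..<m} - ?D. of_bool (T = M)) + (\<Sum>u\<in>?D. \<Sum>y\<in>set_mset M. of_bool (T = M - {#y#}) * pmf (K (lab u)) y)"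
    unfolding sum.subset_diff[OF D finite_lessThan]
  proof (intro arg_cong2[where f="(+)"] sum.cong refl)
    fix u assume "u \<in> {..<m} - ?D"
    then have "(\<lambda>z. fringe_type off x ((u, z) # h) v) = (\<lambda>_. T)"
      using v by (auto simp: fringe_type_Cons T_def m_def)
    then show "pmf (map_pmf (\<lambda>z. fringe_type off x ((u, z) # h) v) p) M = of_bool (T = M)"
      by (simp add: map_pmf_const indicator_def)
  next
    fix u assume u: "u \<in> ?D"
    have "map_pmf (\<lambda>z. fringe_type off x ((u, z) # h) v) p = map_pmf (\<lambda>y. add_mset y T) (K (lab u))"
      using v u by (simp add: fringe_type_Cons T_def m_def K_def pmf.map_comp o_def lab_def)
    then show "pmf (map_pmf (\<lambda>z. fringe_type off x ((u, z) # h) v) p) M =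
        (\<Sum>y\<in>set_mset M. of_bool (T = M - {#y#}) * pmf (K (lab u)) y)"
      by (simp only: pmf_add_mset_map)
  qed
  also have "(\<Sum>u\<in>{..<m} - ?D. of_bool (T = M)) = (real m - size M) * of_bool (T = M)"
  proof (cases "T = M")
    case True
    have "card ({..<m} - ?D) = m - card ?D" using D finD by (subst card_Diff_subset) auto
    moreover have "card ?D \<le> m" using card_mono[OF _ D] by simp
    ultimately show ?thesis using True size_fringe_type[of off x h v] by (simp add: T_def of_nat_diff)
  qed simp
  also have "(\<Sum>u\<in>?D. \<Sum>y\<in>set_mset M. of_bool (T = M - {#y#}) * pmf (K (lab u)) y) =
      (\<Sum>y\<in>set_mset M. of_bool (T = M - {#y#}) * birth_rate K (M - {#y#}) y)"
  proof -
    have "(\<Sum>u\<in>?D. pmf (K (lab u)) y) = birth_rate K T y" for y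
      by (simp add: birth_rate_def T_def fringe_type_def lab_def sum_unfold_sum_mset multiset.map_comp o_def)
    then show ?thesis
      by (subst sum.swap) (auto simp: sum_distrib_left[symmetric] intro!: sum.cong)
  qed
  finally show ?thesis .
qed

lemma expectation_type_count_step:
  fixes h :: "(nat \<times> nat) list"
  defines "m \<equiv> length h + 2"
  shows "measure_pmf.expectation (new_event p m) (\<lambda>e. type_count off x (e # h) M) =
    of_bool (M = {#x#}) + type_count off x h M - size M / m * type_count off x h M
      + parents_sum K (type_count off x h) M / m"
proof -
  have m: "real m > 0" by (simp add: m_def)
  have "measure_pmf.expectation (new_event p m) (\<lambda>e. type_count off x (e # h) M) =
     measure_pmf.expectation (new_event p m) (\<lambda>e. of_bool (M = {#x#}) + (\<Sum>v<m. indicator {e. fringe_type off x (e # h) v = M} e))"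
  proof (intro arg_cong2[where f="integral\<^sup>L"] ext refl)
    fix e show "type_count off x (e # h) M = of_bool (M = {#x#}) + (\<Sum>v<m. indicator {e. fringe_type off x (e # h) v = M} e)"
      by (cases e) (simp add: type_count_Cons m_def indicator_def of_bool_def)
  qed
  also have "\<dots> = of_bool (M = {#x#}) + (\<Sum>v<m. measure_pmf.prob (new_event p m) {e. fringe_type off x (e # h) v = M})"
  proof -
    have ii: "integrable (new_event p m) (\<lambda>e. indicator S e :: real)" for S
      by (rule measure_pmf.integrable_const_bound[where B=1]) auto
    show ?thesis
      by (subst Bochner_Integration.integral_add) (simp_all add: ii Bochner_Integration.integral_sum)
  qed
  also have "(\<Sum>v<m. measure_pmf.prob (new_event p m) {e. fringe_type off x (e # h) v = M}) =
      (\<Sum>v<m. ((real m - size M) * of_bool (fringe_type off x h v = M) +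
        (\<Sum>y\<in>set_mset M. of_bool (fringe_type off x h v = M - {#y#}) * birth_rate K (M - {#y#}) y)) / m)"
  proof (rule sum.cong[OF refl])
    fix v assume "v \<in> {..<m}"
    then show "measure_pmf.prob (new_event p m) {e. fringe_type off x (e # h) v = M} =
      ((real m - size M) * of_bool (fringe_type off x h v = M) +
        (\<Sum>y\<in>set_mset M. of_bool (fringe_type off x h v = M - {#y#}) * birth_rate K (M - {#y#}) y)) / m"
      using prob_fringe_type_step[of v h M] by (simp only: m_def lessThan_iff)
  qed
  also have "\<dots> = ((real m - size M) * type_count off x h M + parents_sum K (type_count off x h) M) / m"
  proof -
    have "(\<Sum>v<m. \<Sum>y\<in>set_mset M. of_bool (fringe_type off x h v = M - {#y#}) * birth_rate K (M - {#y#}) y) =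
        parents_sum K (type_count off x h) M"
      unfolding parents_sum_def type_count_def m_def[symmetric]
      by (subst sum.swap) (simp add: sum_distrib_left mult.commute)
    moreover have "type_count off x h M = (\<Sum>v<m. of_bool (fringe_type off x h v = M))"
      by (simp only: type_count_def m_def)
    ultimately show ?thesis
      unfolding sum_divide_distrib[symmetric] sum.distrib sum_distrib_left[symmetric] by (simp only:)
  qed
  also have "\<dots> = type_count off x h M - size M / m * type_count off x h M + parents_sum K (type_count off x h) M / m"
    using m by (simp add: field_simps)
  finally show ?thesis by simp
qed

text \<open>The deviation of the number of vertices of type \<open>M\<close> from its limiting share. With the exact
  centering below, its mean satisfies a homogeneous linear recursion.\<close>

definition discrepancy :: "(nat \<times> nat) list \<Rightarrow> 'a multiset \<Rightarrow> real" where
  "discrepancy h M = type_count off x h M - (real (length h) + 2) * pmf (urn_limit K x) M"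

lemma expectation_discrepancy_step:
  fixes h :: "(nat \<times> nat) list"
  defines "m \<equiv> length h + 2"
  shows "measure_pmf.expectation (new_event p m) (\<lambda>e. discrepancy (e # h) M) =
    discrepancy h M - size M / m * discrepancy h M + parents_sum K (discrepancy h) M / m"
proof -
  let ?\<pi> = "pmf (urn_limit K x)"
  have m: "real m > 0" by (simp add: m_def)
  have int: "integrable (new_event p m) (\<lambda>e. type_count off x (e # h) M)"
    by (rule measure_pmf.integrable_const_bound[where B="real m + 1"])
      (use type_count_bounds[of off x "_ # h" M] in \<open>auto simp: m_def\<close>)
  have "measure_pmf.expectation (new_event p m) (\<lambda>e. discrepancy (e # h) M) =
    measure_pmf.expectation (new_event p m) (\<lambda>e. type_count off x (e # h) M) - (real m + 1) * ?\<pi> M"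
    unfolding discrepancy_def by (subst Bochner_Integration.integral_diff) (use int in \<open>auto simp: m_def add_ac\<close>)
  also have "measure_pmf.expectation (new_event p m) (\<lambda>e. type_count off x (e # h) M) =
    of_bool (M = {#x#}) + type_count off x h M - size M / m * type_count off x h M
      + parents_sum K (type_count off x h) M / m"
    unfolding m_def by (rule expectation_type_count_step)
  also have "parents_sum K (type_count off x h) M = parents_sum K (discrepancy h) M + m * parents_sum K ?\<pi> M"
    unfolding parents_sum_def discrepancy_def m_def
    by (simp add: sum_distrib_left sum.distrib[symmetric] algebra_simps)
  also have "of_bool (M = {#x#}) = ?\<pi> M * (1 + real (size M)) - parents_sum K ?\<pi> M"
    using urn_limit_forward[of K x M] by simp
  also have "?\<pi> M * (1 + real (size M)) - parents_sum K ?\<pi> M + type_count off x h M - size M / m * type_count off x h M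
      + (parents_sum K (discrepancy h) M + m * parents_sum K ?\<pi> M) / m - (real m + 1) * ?\<pi> M =
      discrepancy h M - size M / m * discrepancy h M + parents_sum K (discrepancy h) M / m"
  proof -
    have d: "discrepancy h M = type_count off x h M - m * ?\<pi> M" by (simp add: discrepancy_def m_def add_ac)
    show ?thesis unfolding d using m by (simp add: field_simps)
  qed
  finally show ?thesis .
qed

lemma discrepancy_increment:
  assumes "u < length h + 2"
  shows "\<bar>discrepancy ((u, z) # h) M - discrepancy h M\<bar> \<le> 3"
proof -
  have "discrepancy ((u, z) # h) M - discrepancy h M =
      (type_count off x ((u, z) # h) M - type_count off x h M) - pmf (urn_limit K x) M"
    by (simp add: discrepancy_def algebra_simps)
  then show ?thesis
    using type_count_increment[OF assms, of off x z M] pmf_le_1[of "urn_limit K x" M] pmf_nonneg[of "urn_limit K x" M]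
    by linarith
qed

text \<open>The drift of \<open>discrepancy h M\<close> has a restoring part of strength \<open>size M / m\<close> and a perturbation by
  the discrepancies of the at most \<open>size M\<close> types that precede \<open>M\<close>. After the product of both is
  bounded by squares, the restoring part absorbs the terms that contain \<open>discrepancy h M\<close>.\<close>

lemma discrepancy_square_step:
  fixes h :: "(nat \<times> nat) list"
  defines "m \<equiv> length h + 2"
  shows "(\<integral>\<^sup>+e. ennreal ((discrepancy (e # h) M)\<^sup>2) \<partial>new_event p m) \<le>
    ennreal ((discrepancy h M)\<^sup>2 + (\<Sum>y\<in>set_mset M. (birth_rate K (M - {#y#}) y)\<^sup>2 * (discrepancy h (M - {#y#}))\<^sup>2) / m + 9)"
proof -
  let ?D = "discrepancy h M" and ?\<Delta> = "\<lambda>e. discrepancy (e # h) M - discrepancy h M"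
  let ?Q = "\<Sum>y\<in>set_mset M. (birth_rate K (M - {#y#}) y)\<^sup>2 * (discrepancy h (M - {#y#}))\<^sup>2"
  have m: "real m > 0" by (simp add: m_def)
  have bound: "AE e in new_event p m. \<bar>?\<Delta> e\<bar> \<le> 3"
  proof -
    have "set_pmf (pmf_of_set {..<m}) = {..<m}" by (rule set_pmf_of_set) (auto simp: m_def)
    then show ?thesis
      unfolding AE_measure_pmf_iff using discrepancy_increment[of _ h] by (auto simp: new_event_def m_def)
  qed
  have int: "integrable (new_event p m) ?\<Delta>"
    by (rule measure_pmf.integrable_const_bound[where B=3]) (use bound in auto)
  have bound2: "AE e in new_event p m. (?\<Delta> e)\<^sup>2 \<le> 9"
    using bound
  proof eventually_elim
    case (elim e)
    then have "\<bar>?\<Delta> e\<bar>\<^sup>2 \<le> 3\<^sup>2" by (intro power_mono) auto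
    then show ?case by simp
  qed
  have int2: "integrable (new_event p m) (\<lambda>e. (?\<Delta> e)\<^sup>2)"
    by (rule measure_pmf.integrable_const_bound[where B=9]) (use bound2 in auto)
  have intD: "integrable (new_event p m) (\<lambda>e. ?D\<^sup>2 + 2 * ?D * ?\<Delta> e + (?\<Delta> e)\<^sup>2)"
    using int int2 by (intro Bochner_Integration.integrable_add integrable_mult_right) auto
  have mean: "measure_pmf.expectation (new_event p m) ?\<Delta> = (parents_sum K (discrepancy h) M - size M * ?D) / m"
  proof -
    have "integrable (new_event p m) (\<lambda>e. ?\<Delta> e + ?D)" using int by (intro Bochner_Integration.integrable_add) auto
    then have "integrable (new_event p m) (\<lambda>e. discrepancy (e # h) M)" by simp
    then have "measure_pmf.expectation (new_event p m) ?\<Delta> =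
        measure_pmf.expectation (new_event p m) (\<lambda>e. discrepancy (e # h) M) - ?D"
      by (subst Bochner_Integration.integral_diff) auto
    then show ?thesis
      using expectation_discrepancy_step[of h M] by (simp add: m_def diff_divide_distrib)
  qed
  have "(\<integral>\<^sup>+e. ennreal ((discrepancy (e # h) M)\<^sup>2) \<partial>new_event p m) =
      (\<integral>\<^sup>+e. ennreal (?D\<^sup>2 + 2 * ?D * ?\<Delta> e + (?\<Delta> e)\<^sup>2) \<partial>new_event p m)"
    by (intro nn_integral_cong arg_cong[where f=ennreal]) (simp add: power2_eq_square algebra_simps)
  also have "\<dots> = ennreal (measure_pmf.expectation (new_event p m) (\<lambda>e. ?D\<^sup>2 + 2 * ?D * ?\<Delta> e + (?\<Delta> e)\<^sup>2))"
  proof (rule nn_integral_eq_integral[OF intD], rule AE_I2)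
    fix e
    have "?D\<^sup>2 + 2 * ?D * ?\<Delta> e + (?\<Delta> e)\<^sup>2 = (discrepancy (e # h) M)\<^sup>2" by (simp add: power2_eq_square algebra_simps)
    then show "0 \<le> ?D\<^sup>2 + 2 * ?D * ?\<Delta> e + (?\<Delta> e)\<^sup>2" by (simp del: power2_eq_square)
  qed
  also have "\<dots> \<le> ennreal (?D\<^sup>2 + ?Q / m + 9)"
  proof (rule ennreal_leI)
    have "measure_pmf.expectation (new_event p m) (\<lambda>e. ?D\<^sup>2 + 2 * ?D * ?\<Delta> e + (?\<Delta> e)\<^sup>2) =
        ?D\<^sup>2 + 2 * ?D * measure_pmf.expectation (new_event p m) ?\<Delta> + measure_pmf.expectation (new_event p m) (\<lambda>e. (?\<Delta> e)\<^sup>2)"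
      using int int2 by (simp add: integrable_mult_right)
    moreover have "measure_pmf.expectation (new_event p m) (\<lambda>e. (?\<Delta> e)\<^sup>2) \<le> 9"
      using measure_pmf.integral_le_const[OF int2 bound2] .
    moreover have "2 * ?D * measure_pmf.expectation (new_event p m) ?\<Delta> \<le> ?Q / m"
    proof -
      \<comment> \<open>Here \<open>2 a b \<le> a\<^sup>2 + b\<^sup>2\<close> is used once for each possible last newborn, and there are at most \<open>size M\<close> of them.\<close>
      have "2 * ?D * parents_sum K (discrepancy h) M =
          (\<Sum>y\<in>set_mset M. 2 * ?D * (birth_rate K (M - {#y#}) y * discrepancy h (M - {#y#})))"
        by (simp add: parents_sum_def sum_distrib_left)
      also have "\<dots> \<le> (\<Sum>y\<in>set_mset M. ?D\<^sup>2 + (birth_rate K (M - {#y#}) y * discrepancy h (M - {#y#}))\<^sup>2)"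
      proof (rule sum_mono)
        fix y
        show "2 * ?D * (birth_rate K (M - {#y#}) y * discrepancy h (M - {#y#})) \<le>
          ?D\<^sup>2 + (birth_rate K (M - {#y#}) y * discrepancy h (M - {#y#}))\<^sup>2"
          by (rule sum_squares_bound)
      qed
      also have "\<dots> = real (card (set_mset M)) * ?D\<^sup>2 + ?Q" by (simp add: sum.distrib power_mult_distrib)
      also have "real (card (set_mset M)) * ?D\<^sup>2 \<le> 2 * real (size M) * ?D\<^sup>2"
      proof (rule mult_right_mono)
        have "card (set_mset M) \<le> size M" by (induction M) (auto simp: card_insert_if intro: le_SucI)
        then show "real (card (set_mset M)) \<le> 2 * real (size M)" by linarith
      qed simp
      finally have "2 * ?D * (parents_sum K (discrepancy h) M - size M * ?D) \<le> ?Q"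
        by (simp add: algebra_simps power2_eq_square)
      then show ?thesis unfolding mean using m by (simp add: divide_right_mono)
    qed
    ultimately show "measure_pmf.expectation (new_event p m) (\<lambda>e. ?D\<^sup>2 + 2 * ?D * ?\<Delta> e + (?\<Delta> e)\<^sup>2) \<le> ?D\<^sup>2 + ?Q / m + 9"
      by linarith
  qed
  finally show ?thesis .
qed

text \<open>The second moment gains at most a constant in each step, because by induction the second moments
  of the smaller types are of order \<open>m\<close> and enter with a factor \<open>1 / m\<close>.\<close>

theorem discrepancy_second_moment:
  "\<exists>C\<ge>0. \<forall>n. (\<integral>\<^sup>+h. ennreal ((discrepancy h M)\<^sup>2) \<partial>histories p n) \<le> ennreal (C * (real n + 2))"
proof (induction "size M" arbitrary: M rule: less_induct)
  case less
  have "\<exists>C\<ge>0. \<forall>n. (\<integral>\<^sup>+h. ennreal ((discrepancy h (M - {#y#}))\<^sup>2) \<partial>histories p n) \<le> ennreal (C * (real n + 2))" if "y \<in># M" for y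
    using that by (intro less) (metis insert_DiffM size_add_mset lessI)
  then obtain C where C: "\<And>y. y \<in># M \<Longrightarrow> 0 \<le> C y"
    "\<And>y n. y \<in># M \<Longrightarrow> (\<integral>\<^sup>+h. ennreal ((discrepancy h (M - {#y#}))\<^sup>2) \<partial>histories p n) \<le> ennreal (C y * (real n + 2))"
    by metis
  let ?r = "\<lambda>y. (birth_rate K (M - {#y#}) y)\<^sup>2"
  define B where "B = (\<Sum>y\<in>set_mset M. ?r y * C y) + 9"
  have B: "0 \<le> B" unfolding B_def using C(1) by (intro add_nonneg_nonneg sum_nonneg mult_nonneg_nonneg) auto
  have "(\<integral>\<^sup>+h. ennreal ((discrepancy h M)\<^sup>2) \<partial>histories p n) \<le> ennreal (4 + B * real n)" for n
  proof (induction n)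
    case 0
    have "discrepancy [] M = type_count off x [] M - 2 * pmf (urn_limit K x) M"
      by (simp add: discrepancy_def)
    moreover have "type_count off x [] M \<le> 2" using type_count_bounds(2)[of off x "[]" M] by simp
    ultimately have "\<bar>discrepancy [] M\<bar> \<le> 2"
      using type_count_bounds(1)[of off x "[]" M] pmf_le_1[of "urn_limit K x" M] pmf_nonneg[of "urn_limit K x" M]
      by linarith
    then have "\<bar>discrepancy [] M\<bar>\<^sup>2 \<le> 2\<^sup>2" by (intro power_mono) auto
    then have "(discrepancy [] M)\<^sup>2 \<le> 4" by simp
    from ennreal_leI[OF this] show ?case by simp
  next
    case (Suc n)
    have "(\<integral>\<^sup>+h. ennreal ((discrepancy h M)\<^sup>2) \<partial>histories p (Suc n)) =
        (\<integral>\<^sup>+h. \<integral>\<^sup>+e. ennreal ((discrepancy (e # h) M)\<^sup>2) \<partial>new_event p (n + 2) \<partial>histories p n)"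
      by simp
    also have "\<dots> \<le> (\<integral>\<^sup>+h. ennreal ((discrepancy h M)\<^sup>2) +
        (\<Sum>y\<in>set_mset M. ennreal (?r y / (real n + 2)) * ennreal ((discrepancy h (M - {#y#}))\<^sup>2)) + 9 \<partial>histories p n)"
    proof (intro nn_integral_mono_AE, unfold AE_measure_pmf_iff, intro ballI)
      fix h assume h: "h \<in> set_pmf (histories p n)"
      have "(\<integral>\<^sup>+e. ennreal ((discrepancy (e # h) M)\<^sup>2) \<partial>new_event p (n + 2)) \<le>
        ennreal ((discrepancy h M)\<^sup>2 + (\<Sum>y\<in>set_mset M. ?r y * (discrepancy h (M - {#y#}))\<^sup>2) / (real n + 2) + 9)"
        using discrepancy_square_step[of h M] length_histories[OF h] by (simp add: add.commute)
      also have "\<dots> = ennreal ((discrepancy h M)\<^sup>2) +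
        (\<Sum>y\<in>set_mset M. ennreal (?r y / (real n + 2)) * ennreal ((discrepancy h (M - {#y#}))\<^sup>2)) + 9"
      proof -
        have "(\<Sum>y\<in>set_mset M. ?r y * (discrepancy h (M - {#y#}))\<^sup>2) / (real n + 2) =
            (\<Sum>y\<in>set_mset M. ?r y / (real n + 2) * (discrepancy h (M - {#y#}))\<^sup>2)"
          by (simp add: sum_divide_distrib)
        then show ?thesis by (simp add: ennreal_plus sum_nonneg ennreal_mult[symmetric] del: ennreal_mult'')
      qed
      finally show "(\<integral>\<^sup>+e. ennreal ((discrepancy (e # h) M)\<^sup>2) \<partial>new_event p (n + 2)) \<le> ennreal ((discrepancy h M)\<^sup>2) +
        (\<Sum>y\<in>set_mset M. ennreal (?r y / (real n + 2)) * ennreal ((discrepancy h (M - {#y#}))\<^sup>2)) + 9" .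
    qed
    also have "\<dots> = (\<integral>\<^sup>+h. ennreal ((discrepancy h M)\<^sup>2) \<partial>histories p n) +
        (\<Sum>y\<in>set_mset M. ennreal (?r y / (real n + 2)) * (\<integral>\<^sup>+h. ennreal ((discrepancy h (M - {#y#}))\<^sup>2) \<partial>histories p n)) + 9"
      by (simp add: nn_integral_add nn_integral_sum nn_integral_cmult)
    also have "\<dots> \<le> ennreal (4 + B * real n) + (\<Sum>y\<in>set_mset M. ennreal (?r y / (real n + 2)) * ennreal (C y * (real n + 2))) + 9"
      using C(2) Suc by (intro add_mono sum_mono mult_left_mono) auto
    also have "(\<Sum>y\<in>set_mset M. ennreal (?r y / (real n + 2)) * ennreal (C y * (real n + 2))) = ennreal (\<Sum>y\<in>set_mset M. ?r y * C y)"
    proof -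
      have "ennreal (?r y / (real n + 2)) * ennreal (C y * (real n + 2)) = ennreal (?r y * C y)" if "y \<in># M" for y
        using C(1)[OF that] by (subst ennreal_mult[symmetric]) auto
      then show ?thesis using C(1) by (simp add: sum_nonneg)
    qed
    also have "ennreal (4 + B * real n) + ennreal (\<Sum>y\<in>set_mset M. ?r y * C y) + 9 = ennreal (4 + B * real (Suc n))"
    proof -
      have "0 \<le> (\<Sum>y\<in>set_mset M. ?r y * C y)" using C(1) by (intro sum_nonneg) auto
      then have "ennreal (4 + B * real n) + ennreal (\<Sum>y\<in>set_mset M. ?r y * C y) + ennreal 9 =
          ennreal (4 + B * real n + (\<Sum>y\<in>set_mset M. ?r y * C y) + 9)"
        using B by (simp add: ennreal_plus)
      then show ?thesis by (simp add: B_def algebra_simps)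
    qed
    finally show ?case .
  qed
  moreover have "ennreal (4 + B * real n) \<le> ennreal ((B + 4) * (real n + 2))" for n
    using B by (intro ennreal_leI) (simp add: algebra_simps)
  ultimately have "(\<integral>\<^sup>+h. ennreal ((discrepancy h M)\<^sup>2) \<partial>histories p n) \<le> ennreal ((B + 4) * (real n + 2))" for n
    using order_trans by blast
  then show ?case using B by (intro exI[of _ "B + 4"]) auto
qed

end

section \<open>PageRank as a function of the type\<close>

lemma dpaths_Suc_iff:
  "u # ys \<in> dpaths A (Suc l) v \<longleftrightarrow> ys \<in> dpaths A l v \<and> (u, hd ys) \<in> A \<and> u \<notin> set ys"
  by (cases ys) (auto simp: dpaths_def)

text \<open>In a graph where every vertex has at most one outgoing arc, a path towards \<open>v\<close> is determined by its
  first vertex. The levels strictly decrease along such a path, so its vertices are distinct.\<close>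

lemma bij_betw_hd_dpaths:
  assumes single: "\<And>u w w'. (u, w) \<in> A \<Longrightarrow> (u, w') \<in> A \<Longrightarrow> w = w'"
    and level_0: "\<And>u. lev u = Some 0 \<longleftrightarrow> u = v"
    and level_Suc: "\<And>u l. lev u = Some (Suc l) \<longleftrightarrow> (\<exists>w. (u, w) \<in> A \<and> lev w = Some l)"
  shows "bij_betw hd (dpaths A l v) {u. lev u = Some l}"
proof -
  have levels: "lev (hd xs) = Some l \<and> (\<forall>y\<in>set xs. \<exists>j\<le>l. lev y = Some j)" if "xs \<in> dpaths A l v" for xs l
    using that
  proof (induction l arbitrary: xs)
    case 0
    then obtain y where "xs = [y]" by (auto simp: dpaths_def length_Suc_conv)
    then show ?case using 0 level_0 by (auto simp: dpaths_def)
  next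
    case (Suc l)
    then obtain u ys where xs: "xs = u # ys" by (cases xs) (auto simp: dpaths_def)
    then have ys: "ys \<in> dpaths A l v" "(u, hd ys) \<in> A" using Suc.prems by (auto simp: dpaths_Suc_iff)
    then have "lev u = Some (Suc l)" using Suc.IH[OF ys(1)] level_Suc by blast
    then show ?case using Suc.IH[OF ys(1)] by (auto simp: xs intro: le_SucI)
  qed
  have ex: "\<exists>xs\<in>dpaths A l v. hd xs = u" if "lev u = Some l" for u l
    using that
  proof (induction l arbitrary: u)
    case 0
    then have "[u] \<in> dpaths A 0 v" using level_0 by (simp add: dpaths_def)
    then show ?case by force
  next
    case (Suc l)
    then obtain w where w: "(u, w) \<in> A" "lev w = Some l" using level_Suc by blast
    then obtain ys where ys: "ys \<in> dpaths A l v" "hd ys = w" using Suc.IH by blast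
    have "u \<notin> set ys" using levels[OF ys(1)] Suc.prems by fastforce
    then have "u # ys \<in> dpaths A (Suc l) v" using ys w by (simp add: dpaths_Suc_iff)
    then show ?case by force
  qed
  have "xs = ys" if "xs \<in> dpaths A l v" "ys \<in> dpaths A l v" "hd xs = hd ys" for xs ys l
    using that
  proof (induction l arbitrary: xs ys)
    case 0
    then show ?case by (auto simp: dpaths_def length_Suc_conv)
  next
    case (Suc l)
    obtain u xs' where xs: "xs = u # xs'" using Suc.prems by (cases xs) (auto simp: dpaths_def)
    obtain w ys' where ys: "ys = w # ys'" using Suc.prems by (cases ys) (auto simp: dpaths_def)
    have "xs' \<in> dpaths A l v" "ys' \<in> dpaths A l v" "(u, hd xs') \<in> A" "(u, hd ys') \<in> A" "u = w"
      using Suc.prems by (auto simp: xs ys dpaths_Suc_iff)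
    then show ?case using Suc.IH[of xs' ys'] single xs ys by blast
  qed
  then show ?thesis
    unfolding bij_betw_def inj_on_def using levels ex by blast
qed

text \<open>The PageRank score of a vertex below which the multiset \<open>M\<close> lists the distances; individuals with
  label \<open>None\<close> lie outside the subtree of the vertex.\<close>

definition type_score :: "real \<Rightarrow> nat option multiset \<Rightarrow> ennreal" where
  "type_score c M = ennreal (1 - c) * (1 + (\<Sum>l. ennreal (c ^ Suc l) * of_nat (count M (Some (Suc l)))))"

lemma type_score_finite: "type_score c M < \<infinity>"
proof -
  have "finite {l. Some (Suc l) \<in># M}"
    using finite_vimageI[of "set_mset M" "\<lambda>l. Some (Suc l)"] by (auto simp: vimage_def inj_def)
  then have "(\<Sum>l. ennreal (c ^ Suc l) * of_nat (count M (Some (Suc l)))) =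
      (\<Sum>l\<in>{l. Some (Suc l) \<in># M}. ennreal (c ^ Suc l) * of_nat (count M (Some (Suc l))))"
    by (rule suminf_finite) (simp add: not_in_iff)
  also have "\<dots> < \<infinity>"
    using \<open>finite {l. Some (Suc l) \<in># M}\<close>
    by (auto simp: less_top[symmetric] ennreal_mult_eq_top_iff simp del: power_Suc)
  finally show ?thesis
    unfolding type_score_def by (simp add: ennreal_mult_less_top)
qed

text \<open>The form in which both tree models are compared with types: \<open>W\<close> may contain vertices outside the
  subtree of \<open>v\<close>, with label \<open>None\<close>.\<close>

lemma pagerank_eq_type_score:
  assumes single: "\<And>u w w'. (u, w) \<in> A \<Longrightarrow> (u, w') \<in> A \<Longrightarrow> w = w'"
    and fin: "finite W"
    and level_0: "\<And>u. u \<in> W \<and> lab u = Some 0 \<longleftrightarrow> u = v"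
    and level_Suc: "\<And>u l. u \<in> W \<and> lab u = Some (Suc l) \<longleftrightarrow> (\<exists>w. (u, w) \<in> A \<and> w \<in> W \<and> lab w = Some l)"
  shows "pagerank c A v = type_score c (image_mset lab (mset_set W))"
proof -
  define lev where "lev u = (if u \<in> W then lab u else None)" for u
  have *: "lev u = Some l \<longleftrightarrow> u \<in> W \<and> lab u = Some l" for u l by (simp add: lev_def)
  have "emeasure (count_space UNIV) (dpaths A l v) = of_nat (count (image_mset lab (mset_set W)) (Some l))" for l
  proof -
    have bij: "bij_betw hd (dpaths A l v) {u. lev u = Some l}"
      by (rule bij_betw_hd_dpaths) (use single level_0 level_Suc in \<open>auto simp: *\<close>)
    have fin': "finite {u. lev u = Some l}" using fin by (simp add: *)
    have "emeasure (count_space UNIV) (dpaths A l v) = of_nat (card (dpaths A l v))"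
      using bij_betw_finite[OF bij] fin' by (intro emeasure_count_space_finite) auto
    also have "card (dpaths A l v) = card {u. lev u = Some l}" using bij by (rule bij_betw_same_card)
    also have "\<dots> = count (image_mset lab (mset_set W)) (Some l)"
      using fin by (simp add: count_image_mset * vimage_def Int_def conj_commute)
    finally show ?thesis .
  qed
  then show ?thesis unfolding pagerank_def type_score_def by simp
qed

text \<open>The label of the vertex produced when a vertex with label \<open>x\<close> is selected with step \<open>z\<close>. Here
  \<open>Some d\<close> is a vertex at distance \<open>d\<close> below the vertex under consideration, and \<open>None\<close> is a vertex
  that is not below it; whatever is produced by the latter is not below it either.\<close>

definition offspring :: "nat option \<Rightarrow> nat \<Rightarrow> nat option" where
  "offspring x z = (case x of None \<Rightarrow> None | Some d \<Rightarrow> if z \<le> d then Some (Suc d - z) else None)"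

lemma offspring_simps [simp]:
  "offspring None z = None"
  "offspring (Some d) z = (if z \<le> d then Some (Suc d - z) else None)"
  by (simp_all add: offspring_def)

lemma finite_range_offspring: "finite (range (offspring x))"
proof (cases x)
  case (Some d)
  have "range (offspring x) \<subseteq> insert None (Some ` {..Suc d})" by (auto simp: Some)
  then show ?thesis by (rule finite_subset) simp
qed (simp add: image_constant_conv)

primrec history_of :: "(nat \<Rightarrow> nat) \<Rightarrow> (nat \<Rightarrow> nat) \<Rightarrow> nat \<Rightarrow> (nat \<times> nat) list" where
  "history_of V Z 0 = []"
| "history_of V Z (Suc n) = (V (Suc n), Z (Suc (Suc n))) # history_of V Z n"

lemma length_history_of [simp]: "length (history_of V Z n) = n"
  by (induction n) simp_all

lemma funpow_le_self: "(\<And>u. f u \<le> (u :: nat)) \<Longrightarrow> (f ^^ k) u \<le> u"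
  by (induction k) (auto intro: order_trans)

lemma tree_parent_bounds:
  assumes V: "\<And>k. k \<ge> 1 \<Longrightarrow> V k \<le> k"
  shows "tree_parent V Z n u \<le> u" "1 \<le> u \<Longrightarrow> tree_parent V Z n u < u"
proof -
  have "tree_parent V Z n u \<le> u \<and> (1 \<le> u \<longrightarrow> tree_parent V Z n u < u)"
  proof (induction n arbitrary: u rule: induct_nat_012)
    case (ge2 n)
    let ?par = "tree_parent V Z (Suc n)"
    have "(?par ^^ k) (V (Suc n)) \<le> Suc n" for k
      using funpow_le_self[of ?par k "V (Suc n)"] ge2.IH(2) V[of "Suc n"] by (auto intro: order_trans)
    then show ?case using ge2.IH(2)[of u] by (auto simp: Let_def less_Suc_eq_le intro: le_SucI)
  qed auto
  then show "tree_parent V Z n u \<le> u" "1 \<le> u \<Longrightarrow> tree_parent V Z n u < u" by auto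
qed

lemma funpow_root_dist:
  assumes "\<And>u. par u \<le> (u :: nat)" "\<And>u. 1 \<le> u \<Longrightarrow> par u < u"
  shows "(par ^^ root_dist par u) u = 0"
proof -
  have "\<exists>k. (par ^^ k) u = 0"
  proof (induction u rule: less_induct)
    case (less u)
    show ?case
    proof (cases "u = 0")
      case True
      then show ?thesis by (intro exI[of _ 0]) simp
    next
      case False
      then obtain k where "(par ^^ k) (par u) = 0" using less assms(2)[of u] by auto
      then show ?thesis by (intro exI[of _ "Suc k"]) (simp add: funpow_swap1)
    qed
  qed
  then show ?thesis unfolding root_dist_def by (rule LeastI_ex)
qed

lemma funpow_nonroot: "i < root_dist par u \<Longrightarrow> (par ^^ i) u \<noteq> 0"
  unfolding root_dist_def by (rule not_less_Least)

text \<open>The distance of \<open>u\<close> to \<open>v\<close> if \<open>u\<close> lies below \<open>v\<close> in the tree of parents, as recorded by the labels.\<close>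

definition depth_below :: "(nat \<times> nat) list \<Rightarrow> nat \<Rightarrow> nat \<Rightarrow> nat option" where
  "depth_below h v u = Option.bind (labels offspring (Some 0) h v u) id"

lemma depth_below_Some: "depth_below h v u = Some l \<longleftrightarrow> labels offspring (Some 0) h v u = Some (Some l)"
  by (cases "labels offspring (Some 0) h v u") (auto simp: depth_below_def)

lemma depth_below_bounds: "depth_below h v u = Some l \<Longrightarrow> v \<le> u \<and> u < length h + 2"
  using labels_eq_None_iff[of offspring "Some 0" h v u] descendants_bounds[of u h v] by (auto simp: depth_below_Some)

lemma depth_below_Cons:
  "depth_below ((u, z) # h) v w =
    (if w = length h + 2 then (if v = w then Some 0 else Option.bind (depth_below h v u) (\<lambda>d. offspring (Some d) z))
     else depth_below h v w)"
proof -
  have "Option.bind (map_option (\<lambda>y. offspring y z) a) id = Option.bind (Option.bind a id) (\<lambda>d. offspring (Some d) z)"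
    for a :: "nat option option"
    by (cases a; cases "the a") auto
  then show ?thesis by (simp add: depth_below_def)
qed

lemma depth_below_0: "1 \<le> v \<Longrightarrow> v < length h + 2 \<Longrightarrow> depth_below h v u = Some 0 \<longleftrightarrow> u = v"
proof (induction h arbitrary: u)
  case Nil
  then show ?case by (auto simp: depth_below_def)
next
  case (Cons e h)
  obtain w z where e: "e = (w, z)" by (cases e)
  show ?case
  proof (cases "v = length h + 2")
    case True
    then show ?thesis using depth_below_bounds[of h v u 0] by (auto simp: e depth_below_Cons)
  next
    case False
    then show ?thesis using Cons
      by (auto simp: e depth_below_Cons bind_eq_Some_conv split: if_splits)
  qed
qed

text \<open>The recorded distances are the distances in the tree of parents, for every vertex \<open>v\<close> except the
  root. In the recursion a step that is too long for \<open>v\<close> makes the newcomer leave the subtree of \<open>v\<close>;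
  in the tree it is then attached above \<open>v\<close>, at the root if necessary.\<close>

lemma depth_below_Suc:
  assumes V: "\<And>k. k \<ge> 1 \<Longrightarrow> V k \<le> k" and v: "1 \<le> v" "v \<le> Suc n"
  shows "depth_below (history_of V Z n) v u = Some (Suc l) \<longleftrightarrow>
    u \<in> {1..Suc n} \<and> depth_below (history_of V Z n) v (tree_parent V Z (Suc n) u) = Some l"
  using v
proof (induction n arbitrary: u l)
  case 0
  then show ?case by (auto simp: depth_below_def)
next
  case (Suc n)
  define h where "h = history_of V Z n"
  define par where "par = tree_parent V Z (Suc n)"
  define w where "w = V (Suc n)"
  define z where "z = Z (Suc (Suc n))"
  define j where "j = min z (root_dist par w)"
  let ?N = "Suc (Suc n)"
  have len: "length h = n" by (simp add: h_def)
  have h': "history_of V Z (Suc n) = (w, z) # h" by (simp add: h_def w_def z_def)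
  have par': "tree_parent V Z ?N = par(?N := (par ^^ j) w)"
    by (simp add: par_def w_def z_def j_def Let_def)
  have par_le: "par a \<le> a" for a unfolding par_def by (rule tree_parent_bounds(1)[OF V])
  have par_less: "1 \<le> a \<Longrightarrow> par a < a" for a unfolding par_def by (rule tree_parent_bounds(2)[OF V])
  have w: "w \<le> Suc n" unfolding w_def by (rule V) simp
  have iter_le: "(par ^^ i) w \<le> Suc n" for i using funpow_le_self[OF par_le, of i w] w by simp
  show ?case
  proof (cases "v = ?N")
    case True
    have "depth_below h v a \<noteq> Some l'" for a l' using depth_below_bounds[of h v a l'] True len by auto
    moreover have "tree_parent V Z ?N u \<noteq> ?N" if "u \<le> ?N"
      using tree_parent_bounds(2)[OF V, where n = ?N and Z = Z and u = u] tree_parent_bounds(1)[OF V, where n = ?N and Z = Z and u = u] that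
      by (cases "u = 0") auto
    ultimately show ?thesis unfolding h' using True by (auto simp: depth_below_Cons len)
  next
    case False
    then have v: "1 \<le> v" "v \<le> Suc n" using Suc.prems by auto
    have IH: "depth_below h v a = Some (Suc l) \<longleftrightarrow> a \<in> {1..Suc n} \<and> depth_below h v (par a) = Some l" for a l
      unfolding h_def par_def by (rule Suc.IH[OF v])
    have root: "depth_below h v 0 \<noteq> Some l" for l using depth_below_bounds[of h v 0 l] v by auto
    have iter: "depth_below h v ((par ^^ i) w) = Some l \<longleftrightarrow> depth_below h v w = Some (l + i)"
      if "i \<le> root_dist par w" for i l
      using that
    proof (induction i arbitrary: l)
      case (Suc i)
      then have "(par ^^ i) w \<in> {1..Suc n}" using funpow_nonroot[of i par w] iter_le[of i] by auto
      then have "depth_below h v ((par ^^ Suc i) w) = Some l \<longleftrightarrow> depth_below h v ((par ^^ i) w) = Some (Suc l)"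
        using IH[of "(par ^^ i) w" l] by auto
      then show ?case using Suc by simp
    qed simp
    \<comment> \<open>the vertex \<open>(par ^^ j) w\<close> is the parent of the newcomer\<close>
    have key: "depth_below h v ((par ^^ j) w) = Some l \<longleftrightarrow> depth_below h v w = Some (l + z)" for l
    proof (cases "z \<le> root_dist par w")
      case True
      then show ?thesis using iter[of z l] by (simp add: j_def min_def)
    next
      case False
      let ?r = "root_dist par w"
      have "(par ^^ ?r) w = 0" by (rule funpow_root_dist) (use par_le par_less in auto)
      then have "depth_below h v w \<noteq> Some (l' + ?r)" for l' using iter[of ?r l'] root by simp
      from this[of "l + z - ?r"] have "depth_below h v w \<noteq> Some (l + z)" using False by simp
      then show ?thesis using \<open>(par ^^ ?r) w = 0\<close> root False by (simp add: j_def min_def)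
    qed
    show ?thesis
    proof (cases "u = ?N")
      case True
      have "(par ^^ j) w \<noteq> ?N" using iter_le[of j] by auto
      then have "depth_below ((w, z) # h) v (tree_parent V Z ?N u) = Some l \<longleftrightarrow> depth_below h v w = Some (l + z)"
        using True False key by (simp add: par' depth_below_Cons len del: tree_parent.simps)
      moreover have "depth_below ((w, z) # h) v u = Some (Suc l) \<longleftrightarrow> depth_below h v w = Some (l + z)"
        using True False by (auto simp: depth_below_Cons len bind_eq_Some_conv split: if_splits)
      ultimately show ?thesis unfolding h' using True by (simp del: tree_parent.simps)
    next
      case uN: False
      have "depth_below h v u = Some l' \<Longrightarrow> u < ?N" for l' using depth_below_bounds[of h v u l'] len by simp
      moreover have "u \<le> Suc n \<Longrightarrow> par u \<noteq> ?N" using par_le[of u] by auto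
      ultimately show ?thesis
        unfolding h' using uN IH[of u l] by (auto simp: par' depth_below_Cons len simp del: tree_parent.simps)
    qed
  qed
qed

lemma pagerank_discrete:
  assumes V: "\<And>k. k \<ge> 1 \<Longrightarrow> V k \<le> k" and v: "1 \<le> v" "v \<le> Suc n"
  shows "pagerank c (tree_arcs V Z (Suc n)) v = type_score c (fringe_type offspring (Some 0) (history_of V Z n) v)"
proof -
  let ?h = "history_of V Z n"
  have lab: "u \<in> descendants ?h v \<and> the (labels offspring (Some 0) ?h v u) = Some l \<longleftrightarrow> depth_below ?h v u = Some l" for u l
    using labels_eq_None_iff[of offspring "Some 0" ?h v u] by (auto simp: depth_below_Some)
  show ?thesis
    unfolding fringe_type_def
  proof (rule pagerank_eq_type_score)
    show "u \<in> descendants ?h v \<and> the (labels offspring (Some 0) ?h v u) = Some 0 \<longleftrightarrow> u = v" for u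
      unfolding lab by (rule depth_below_0) (use v in auto)
    show "u \<in> descendants ?h v \<and> the (labels offspring (Some 0) ?h v u) = Some (Suc l) \<longleftrightarrow>
      (\<exists>w. (u, w) \<in> tree_arcs V Z (Suc n) \<and> w \<in> descendants ?h v \<and> the (labels offspring (Some 0) ?h v w) = Some l)" for u l
      using depth_below_Suc[OF V v, where Z = Z and u = u and l = l] unfolding lab by (auto simp: tree_arcs_def simp del: tree_parent.simps)
  qed (auto simp: tree_arcs_def finite_descendants)
qed

lemma root_path_not_Nil [simp]: "root_path Z v \<noteq> []"
  by (cases v) auto

lemma hd_root_path [simp]: "hd (root_path Z v) = v"
  by (cases v) auto

lemma label_offspring:
  "label offspring (Some 0) Z v = (if is_created Z v then Some (length (root_path Z v) - 1) else None)"
proof (induction v)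
  case (Cons k v)
  have "length (root_path Z v) \<ge> 1" by (simp add: Suc_le_eq)
  then show ?case using Cons by auto
qed simp

text \<open>The root path of a vertex on the root path of \<open>v\<close> is the corresponding final segment, so the second
  vertex of a root path is a parent one level closer to the root. It is present whenever \<open>v\<close> is, since
  it is born earlier.\<close>

lemma root_path_nth:
  assumes "\<And>i. 0 \<le> E i" "is_created Z v" "i < length (root_path Z v)"
  shows "root_path Z (root_path Z v ! i) = drop i (root_path Z v) \<and>
    is_created Z (root_path Z v ! i) \<and> birth_time E (root_path Z v ! i) \<le> birth_time E v"
  using assms(2,3)
proof (induction v arbitrary: i)
  case (Cons k v)
  show ?case
  proof (cases i)
    case 0
    then show ?thesis using Cons.prems by simp
  next
    case (Suc i')
    let ?w = "root_path Z v ! (Z (v, k) + i')"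
    have len: "Z (v, k) + i' < length (root_path Z v)" using Cons.prems Suc by simp
    have "birth_time E v \<le> birth_time E (k # v)" using assms(1) by (simp add: sum_nonneg)
    then show ?thesis
      using Cons.IH[of "Z (v, k) + i'"] Cons.prems Suc len by (auto simp: add.commute)
  qed
qed simp

lemma pagerank_continuous:
  assumes E: "\<And>i. 0 \<le> E i" and t: "0 \<le> t" and fin: "finite (yule E t)"
  shows "pagerank c (ct_arcs E Z t) [] = type_score c (population offspring (Some 0) E Z t)"
  unfolding population_def
proof (rule pagerank_eq_type_score)
  have lab: "label offspring (Some 0) Z u = Some l \<longleftrightarrow> is_created Z u \<and> length (root_path Z u) = Suc l" for u l
  proof -
    have "length (root_path Z u) \<ge> 1" by (simp add: Suc_le_eq)
    then show ?thesis by (auto simp: label_offspring)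
  qed
  have nontriv: "length (root_path Z u) > 1" if "is_created Z u" "u \<noteq> []" for u
    using that by (cases u) (auto simp: less_Suc_eq_le Suc_le_eq intro: le_less_trans)
  show "u \<in> yule E t \<and> label offspring (Some 0) Z u = Some 0 \<longleftrightarrow> u = []" for u
    unfolding lab using nontriv[of u] t by (cases "u = []") (auto simp: yule_def)
  show "u \<in> yule E t \<and> label offspring (Some 0) Z u = Some (Suc l) \<longleftrightarrow>
    (\<exists>w. (u, w) \<in> ct_arcs E Z t \<and> w \<in> yule E t \<and> label offspring (Some 0) Z w = Some l)" for u l
  proof (cases "u \<in> yule E t \<and> is_created Z u \<and> u \<noteq> []")
    case True
    let ?w = "root_path Z u ! 1"
    have w: "root_path Z ?w = drop 1 (root_path Z u)" "is_created Z ?w" "birth_time E ?w \<le> birth_time E u"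
      using root_path_nth[OF E, of Z u 1] nontriv[of u] True by auto
    have arc: "(u, w) \<in> ct_arcs E Z t \<longleftrightarrow> w = ?w" for w
      using True by (auto simp: ct_arcs_def ct_verts_def yule_def)
    have "?w \<in> yule E t" using w True by (simp add: yule_def)
    then have "(\<exists>w. (u, w) \<in> ct_arcs E Z t \<and> w \<in> yule E t \<and> label offspring (Some 0) Z w = Some l) \<longleftrightarrow>
        label offspring (Some 0) Z ?w = Some l" by (simp add: arc)
    also have "\<dots> \<longleftrightarrow> length (root_path Z u) - 1 = Suc l"
      unfolding lab w(1) using w(2) by simp
    also have "\<dots> \<longleftrightarrow> u \<in> yule E t \<and> label offspring (Some 0) Z u = Some (Suc l)"
      unfolding lab using True nontriv[of u] by auto
    finally show ?thesis by blast
  next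
    case False
    then have "(u, w) \<notin> ct_arcs E Z t" for w by (auto simp: ct_arcs_def ct_verts_def yule_def)
    moreover have "\<not> (u \<in> yule E t \<and> label offspring (Some 0) Z u = Some (Suc l))"
      using False by (auto simp: lab)
    ultimately show ?thesis by blast
  qed
qed (use fin in \<open>auto simp: ct_arcs_def\<close>)

section \<open>Convergence of the empirical distribution\<close>

definition type_fraction :: "nat option multiset set \<Rightarrow> (nat \<times> nat) list \<Rightarrow> real" where
  "type_fraction S h = (\<Sum>v<length h + 2. of_bool (fringe_type offspring (Some 0) h v \<in> S)) / (real (length h) + 2)"

definition limit_type :: "nat pmf \<Rightarrow> nat option multiset pmf" where
  "limit_type p = urn_limit (\<lambda>x. map_pmf (offspring x) p) (Some 0)"

abbreviation type_discrepancy :: "nat pmf \<Rightarrow> (nat \<times> nat) list \<Rightarrow> nat option multiset \<Rightarrow> real" where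
  "type_discrepancy p \<equiv> discrepancy offspring (Some 0) p"

lemma type_fraction_bounds: "0 \<le> type_fraction S h" "type_fraction S h \<le> 1"
proof -
  show "0 \<le> type_fraction S h" by (simp add: type_fraction_def sum_nonneg)
  have "(\<Sum>v<length h + 2. of_bool (fringe_type offspring (Some 0) h v \<in> S)) \<le> (\<Sum>v<length h + 2. 1 :: real)"
    by (intro sum_mono) auto
  then show "type_fraction S h \<le> 1" by (simp add: type_fraction_def)
qed

lemma type_fraction_Compl: "type_fraction (- S) h = 1 - type_fraction S h"
proof -
  have "(\<Sum>v<length h + 2. of_bool (fringe_type offspring (Some 0) h v \<in> - S) :: real) =
      (\<Sum>v<length h + 2. 1 - of_bool (fringe_type offspring (Some 0) h v \<in> S))"
    by (intro sum.cong) auto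
  also have "\<dots> = (real (length h) + 2) - (\<Sum>v<length h + 2. of_bool (fringe_type offspring (Some 0) h v \<in> S))"
    unfolding sum_subtractf by simp
  finally show ?thesis unfolding type_fraction_def by (simp add: diff_divide_distrib del: sum.lessThan_Suc)
qed

text \<open>A lower bound for every set of types is enough, because it can also be applied to the complement.
  Only the finitely many types in \<open>F\<close> are counted; the others cost at most their limiting mass.\<close>

lemma type_fraction_lower:
  assumes F: "finite F"
  shows "measure_pmf.prob (limit_type p) S - type_fraction S h \<le>
    (\<Sum>M\<in>F. \<bar>type_discrepancy p h M\<bar>) / (real (length h) + 2) + measure_pmf.prob (limit_type p) (- F)"
proof -
  let ?m = "real (length h) + 2" and ?T = "fringe_type offspring (Some 0) h" and ?\<pi> = "limit_type p"
  have m: "?m > 0" by simp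
  have "(\<Sum>M\<in>F \<inter> S. type_count offspring (Some 0) h M) = (\<Sum>v<length h + 2. \<Sum>M\<in>F \<inter> S. of_bool (?T v = M))"
    unfolding type_count_def by (rule sum.swap)
  also have "\<dots> \<le> (\<Sum>v<length h + 2. of_bool (?T v \<in> S))"
    using F by (intro sum_mono) (auto simp: of_bool_def)
  also have "\<dots> = ?m * type_fraction S h" by (simp add: type_fraction_def del: sum.lessThan_Suc)
  finally have 1: "(\<Sum>M\<in>F \<inter> S. type_count offspring (Some 0) h M) \<le> ?m * type_fraction S h" .
  have "(\<Sum>M\<in>F \<inter> S. type_count offspring (Some 0) h M) = (\<Sum>M\<in>F \<inter> S. type_discrepancy p h M + ?m * pmf ?\<pi> M)"
    by (intro sum.cong) (auto simp: discrepancy_def limit_type_def)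
  also have "\<dots> = (\<Sum>M\<in>F \<inter> S. type_discrepancy p h M) + ?m * measure_pmf.prob ?\<pi> (F \<inter> S)"
    using F by (simp add: sum.distrib sum_distrib_left measure_measure_pmf_finite)
  finally have 2: "(\<Sum>M\<in>F \<inter> S. type_count offspring (Some 0) h M) =
      (\<Sum>M\<in>F \<inter> S. type_discrepancy p h M) + ?m * measure_pmf.prob ?\<pi> (F \<inter> S)" .
  have "- (\<Sum>M\<in>F \<inter> S. type_discrepancy p h M) \<le> (\<Sum>M\<in>F \<inter> S. \<bar>type_discrepancy p h M\<bar>)"
    unfolding sum_negf[symmetric] by (intro sum_mono) auto
  also have "\<dots> \<le> (\<Sum>M\<in>F. \<bar>type_discrepancy p h M\<bar>)"
    using F by (intro sum_mono2) auto
  finally have 3: "- (\<Sum>M\<in>F \<inter> S. type_discrepancy p h M) \<le> (\<Sum>M\<in>F. \<bar>type_discrepancy p h M\<bar>)" .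
  have "measure_pmf.prob ?\<pi> S \<le> measure_pmf.prob ?\<pi> ((F \<inter> S) \<union> - F)"
    by (intro measure_pmf.finite_measure_mono) auto
  also have "\<dots> \<le> measure_pmf.prob ?\<pi> (F \<inter> S) + measure_pmf.prob ?\<pi> (- F)"
    by (rule measure_Un_le) auto
  finally have 4: "measure_pmf.prob ?\<pi> S - measure_pmf.prob ?\<pi> (- F) \<le> measure_pmf.prob ?\<pi> (F \<inter> S)" by simp
  have "?m * (measure_pmf.prob ?\<pi> S - measure_pmf.prob ?\<pi> (- F)) \<le> ?m * measure_pmf.prob ?\<pi> (F \<inter> S)"
    using 4 by (intro mult_left_mono) auto
  also have "\<dots> \<le> ?m * type_fraction S h + (\<Sum>M\<in>F. \<bar>type_discrepancy p h M\<bar>)"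
    using 1 2 3 by linarith
  finally show ?thesis using m by (simp add: field_simps)
qed

lemma type_fraction_approx:
  assumes "finite F"
  shows "\<bar>type_fraction S h - measure_pmf.prob (limit_type p) S\<bar> \<le>
    (\<Sum>M\<in>F. \<bar>type_discrepancy p h M\<bar>) / (real (length h) + 2) + measure_pmf.prob (limit_type p) (- F)"
proof -
  have "measure_pmf.prob (limit_type p) (- S) = 1 - measure_pmf.prob (limit_type p) S"
    using measure_pmf.prob_compl[of S "limit_type p"] by (simp add: Compl_eq_Diff_UNIV)
  then show ?thesis
    using type_fraction_lower[OF assms, of p S h] type_fraction_lower[OF assms, of p "- S" h]
    by (simp add: type_fraction_Compl abs_le_iff)
qed

lemma pmf_tight:
  fixes q :: "'a::countable pmf"
  assumes "0 < \<epsilon>"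
  shows "\<exists>F. finite F \<and> measure_pmf.prob q (- F) < \<epsilon>"
proof -
  define A where "A n = {x :: 'a. to_nat x < n}" for n
  have "(\<lambda>n. measure_pmf.prob q (A n)) \<longlonglongrightarrow> measure_pmf.prob q (\<Union>n. A n)"
    by (rule measure_pmf.finite_Lim_measure_incseq) (auto simp: A_def incseq_def)
  moreover have "(\<Union>n. A n) = UNIV" by (auto simp: A_def)
  ultimately have "(\<lambda>n. measure_pmf.prob q (A n)) \<longlonglongrightarrow> 1" by simp
  then have "\<forall>\<^sub>F n in sequentially. measure_pmf.prob q (A n) > 1 - \<epsilon>"
    by (rule order_tendstoD) (use assms in simp)
  then obtain n where n: "measure_pmf.prob q (A n) > 1 - \<epsilon>" by (auto simp: eventually_sequentially)
  have "finite (A n)"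
    unfolding A_def using finite_vimageI[of "{..<n}" to_nat] by (simp add: vimage_def lessThan_def)
  moreover have "measure_pmf.prob q (- A n) = 1 - measure_pmf.prob q (A n)"
    using measure_pmf.prob_compl[of "A n" q] by (simp add: Compl_eq_Diff_UNIV)
  ultimately show ?thesis using n by (intro exI[of _ "A n"]) auto
qed

text \<open>Chebyshev's inequality: the second moment is of order \<open>n\<close>, and the threshold squared is of order \<open>n\<^sup>2\<close>.\<close>

lemma discrepancy_tail:
  assumes "0 < \<delta>"
  shows "(\<lambda>n. measure_pmf.prob (histories p n) {h. \<bar>type_discrepancy p h M\<bar> > \<delta> * (real n + 2)}) \<longlonglongrightarrow> 0"
proof -
  obtain C where C: "0 \<le> C" "\<And>n. (\<integral>\<^sup>+h. ennreal ((type_discrepancy p h M)\<^sup>2) \<partial>histories p n) \<le> ennreal (C * (real n + 2))"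
    using discrepancy_second_moment[where off = offspring and x = "Some 0" and p = p and M = M] by blast
  have bound: "measure_pmf.prob (histories p n) {h. \<bar>type_discrepancy p h M\<bar> > \<delta> * (real n + 2)} \<le> C / \<delta>\<^sup>2 / (real n + 2)" for n
  proof -
    let ?m = "real n + 2"
    let ?c = "1 / (\<delta> * ?m)\<^sup>2"
    have c: "0 \<le> ?c" by simp
    have dm: "0 < \<delta> * ?m" using assms by (intro mult_pos_pos) auto
    have "emeasure (histories p n) {h. \<bar>type_discrepancy p h M\<bar> > \<delta> * ?m} \<le>
        emeasure (histories p n) {h \<in> UNIV. 1 \<le> ennreal ?c * ennreal ((type_discrepancy p h M)\<^sup>2)}"
    proof (intro emeasure_mono subsetI)
      fix h assume "h \<in> {h. \<bar>type_discrepancy p h M\<bar> > \<delta> * ?m}"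
      then have "(\<delta> * ?m)\<^sup>2 \<le> \<bar>type_discrepancy p h M\<bar>\<^sup>2" using dm by (intro power_mono) auto
      then have "1 \<le> ?c * (type_discrepancy p h M)\<^sup>2" using dm by (simp add: field_simps del: power_mult_distrib)
      then have "ennreal 1 \<le> ennreal (?c * (type_discrepancy p h M)\<^sup>2)" by (rule ennreal_leI)
      also have "\<dots> = ennreal ?c * ennreal ((type_discrepancy p h M)\<^sup>2)" using c by (rule ennreal_mult) simp
      finally have le: "1 \<le> ennreal ?c * ennreal ((type_discrepancy p h M)\<^sup>2)" by (simp only: ennreal_1)
      show "h \<in> {h \<in> UNIV. 1 \<le> ennreal ?c * ennreal ((type_discrepancy p h M)\<^sup>2)}"
        by (intro CollectI conjI le UNIV_I)
    qed simp
    also have "\<dots> \<le> ennreal ?c * (\<integral>\<^sup>+h. ennreal ((type_discrepancy p h M)\<^sup>2) * indicator UNIV h \<partial>histories p n)"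
      by (rule nn_integral_Markov_inequality) auto
    also have "\<dots> \<le> ennreal ?c * ennreal (C * ?m)"
      using C(2)[of n] by (intro mult_left_mono) auto
    also have "\<dots> = ennreal (C / \<delta>\<^sup>2 / ?m)"
    proof -
      have "1 / (d * m)\<^sup>2 * (a * m) = a / d\<^sup>2 / m" if "m \<noteq> 0" for a d m :: real
        using that by (simp add: power2_eq_square)
      from this[of ?m \<delta> C] have "?c * (C * ?m) = C / \<delta>\<^sup>2 / ?m" by simp
      then show ?thesis using c C by (subst ennreal_mult[symmetric]) (simp_all del: power_mult_distrib)
    qed
    finally show ?thesis
      using C assms by (simp add: measure_pmf.emeasure_eq_measure)
  qed
  have "(\<lambda>n. C / \<delta>\<^sup>2 / (real n + 2)) \<longlonglongrightarrow> 0"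
    using LIMSEQ_ignore_initial_segment[OF lim_const_over_n[of "C / \<delta>\<^sup>2"], of 2] by (simp add: add.commute)
  then show ?thesis
    by (rule tendsto_sandwich[OF _ _ tendsto_const, rotated 2]) (use bound in auto)
qed

theorem type_fraction_converges:
  assumes "0 < \<epsilon>"
  shows "(\<lambda>n. measure_pmf.prob (histories p n) {h. \<bar>type_fraction S h - measure_pmf.prob (limit_type p) S\<bar> > \<epsilon>}) \<longlonglongrightarrow> 0"
proof -
  obtain F where F: "finite F" "measure_pmf.prob (limit_type p) (- F) < \<epsilon> / 2"
    using pmf_tight[of "\<epsilon> / 2" "limit_type p"] assms by auto
  define \<delta> where "\<delta> = \<epsilon> / (2 * (real (card F) + 1))"
  have \<delta>: "0 < \<delta>" using assms by (simp add: \<delta>_def)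
  let ?B = "\<lambda>n M. {h. \<bar>type_discrepancy p h M\<bar> > \<delta> * (real n + 2)}"
  have bound: "measure_pmf.prob (histories p n) {h. \<bar>type_fraction S h - measure_pmf.prob (limit_type p) S\<bar> > \<epsilon>} \<le>
      (\<Sum>M\<in>F. measure_pmf.prob (histories p n) (?B n M))" for n
  proof -
    have "measure_pmf.prob (histories p n) {h. \<bar>type_fraction S h - measure_pmf.prob (limit_type p) S\<bar> > \<epsilon>} \<le>
        measure_pmf.prob (histories p n) (\<Union>M\<in>F. ?B n M)"
    proof (rule measure_pmf.finite_measure_mono_AE, unfold AE_measure_pmf_iff, intro ballI impI)
      fix h assume "h \<in> set_pmf (histories p n)"
      then have len: "length h = n" by (rule length_histories)
      assume "h \<in> {h. \<bar>type_fraction S h - measure_pmf.prob (limit_type p) S\<bar> > \<epsilon>}"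
      then have big: "\<epsilon> < \<bar>type_fraction S h - measure_pmf.prob (limit_type p) S\<bar>" by simp
      show "h \<in> (\<Union>M\<in>F. ?B n M)"
      proof (rule ccontr)
        assume "h \<notin> (\<Union>M\<in>F. ?B n M)"
        then have "(\<Sum>M\<in>F. \<bar>type_discrepancy p h M\<bar>) \<le> (\<Sum>M\<in>F. \<delta> * (real n + 2))"
          by (intro sum_mono) (auto simp: not_less)
        also have "\<dots> \<le> (real (card F) + 1) * \<delta> * (real n + 2)"
          using \<delta> by (simp add: algebra_simps)
        also have "(real (card F) + 1) * \<delta> = \<epsilon> / 2" by (simp add: \<delta>_def field_simps)
        finally have "(\<Sum>M\<in>F. \<bar>type_discrepancy p h M\<bar>) / (real n + 2) \<le> \<epsilon> / 2" by (simp add: field_simps)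
        then show False using type_fraction_approx[OF F(1), of S h p] F(2) big unfolding len by linarith
      qed
    qed simp
    also have "\<dots> \<le> (\<Sum>M\<in>F. measure_pmf.prob (histories p n) (?B n M))"
      using F(1) by (intro measure_pmf.finite_measure_subadditive_finite) auto
    finally show ?thesis .
  qed
  have "(\<lambda>n. \<Sum>M\<in>F. measure_pmf.prob (histories p n) (?B n M)) \<longlonglongrightarrow> (\<Sum>M\<in>F. 0)"
    by (intro tendsto_sum discrepancy_tail \<delta>)
  then have "(\<lambda>n. \<Sum>M\<in>F. measure_pmf.prob (histories p n) (?B n M)) \<longlonglongrightarrow> 0" by simp
  then show ?thesis
    by (rule tendsto_sandwich[OF _ _ tendsto_const, rotated 2]) (use bound in auto)
qed

lemma pmf_histories_Cons:
  "pmf (histories p (Suc n)) ((u, z) # h) = pmf (pmf_of_set {0..Suc n}) u * pmf p z * pmf (histories p n) h"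
proof -
  let ?q = "new_event p (n + 2)"
  have inj: "inj (\<lambda>e. e # h)" by (auto intro: injI)
  have "pmf (histories p (Suc n)) ((u, z) # h) =
      measure_pmf.expectation (histories p n) (\<lambda>h'. pmf (map_pmf (\<lambda>e. e # h') ?q) ((u, z) # h))"
    by (simp add: pmf_bind)
  also have "\<dots> = (\<Sum>h'\<in>{h}. pmf (map_pmf (\<lambda>e. e # h') ?q) ((u, z) # h) * pmf (histories p n) h')"
    by (rule integral_measure_pmf_real) (auto simp: pmf_eq_0_set_pmf)
  also have "\<dots> = pmf ?q (u, z) * pmf (histories p n) h"
    using pmf_map_inj'[OF inj, of ?q "(u, z)"] by simp
  also have "{..<n + 2} = {0..Suc n}" by auto
  then have "pmf ?q (u, z) = pmf (pmf_of_set {0..Suc n}) u * pmf p z"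
    by (simp add: new_event_def pmf_pair)
  finally show ?thesis .
qed

text \<open>The bridge from the given random variables to histories: a history is a cylinder event for finitely
  many of them, whose probability factorizes by independence.\<close>

lemma distr_history:
  fixes M :: "'a measure" and V Z :: "nat \<Rightarrow> 'a \<Rightarrow> nat" and p :: "nat pmf"
  assumes M: "prob_space M"
    and indep: "prob_space.indep_vars M (\<lambda>_. count_space UNIV) (case_sum V Z) ({1..} <+> {1..})"
    and law_V: "\<And>n. n \<ge> 1 \<Longrightarrow> distr M (count_space UNIV) (V n) = measure_pmf (pmf_of_set {0..n})"
    and law_Z: "\<And>n. n \<ge> 1 \<Longrightarrow> distr M (count_space UNIV) (Z n) = measure_pmf p"
  defines "H \<equiv> (\<lambda>n \<omega>. history_of (\<lambda>k. V k \<omega>) (\<lambda>k. Z k \<omega>) n)"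
  shows "H n \<in> M \<rightarrow>\<^sub>M count_space UNIV" and "distr M (count_space UNIV) (H n) = measure_pmf (histories p n)"
proof -
  interpret prob_space M by fact
  define X where "X = case_sum V Z"
  define law where "law j = (case j of Inl k \<Rightarrow> pmf_of_set {0..k} | Inr k \<Rightarrow> p)" for j :: "nat + nat"
  define J where "J n = Inl ` {1..n} \<union> Inr ` {2..Suc n}" for n :: nat
  have J_sub: "J n \<subseteq> {1..} <+> {1..}" for n by (auto simp: J_def)
  have X_meas: "X j \<in> M \<rightarrow>\<^sub>M count_space UNIV" if "j \<in> J n" for j n
    using indep that J_sub[of n] unfolding indep_vars_def X_def by auto
  have X_law: "prob (X j -` {a} \<inter> space M) = pmf (law j) a" if "j \<in> J n" for j a n
  proof -
    have "distr M (count_space UNIV) (X j) = measure_pmf (law j)"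
      using that law_V law_Z by (auto simp: J_def X_def law_def)
    then have "measure (distr M (count_space UNIV) (X j)) {a} = pmf (law j) a"
      by (simp add: measure_pmf_single)
    then show ?thesis using X_meas[OF that] by (simp add: measure_distr)
  qed
  \<comment> \<open>the coordinates \<open>a\<close> of the cylinder that belongs to the history \<open>h\<close>\<close>
  have cyl: "\<exists>a. (\<forall>\<omega>. H n \<omega> = h \<longleftrightarrow> (\<forall>j\<in>J n. X j \<omega> = a j)) \<and> (\<Prod>j\<in>J n. pmf (law j) (a j)) = pmf (histories p n) h"
    if "length h = n" for n h
    using that
  proof (induction n arbitrary: h)
    case 0
    then show ?case by (auto simp: H_def J_def)
  next
    case (Suc n)
    then obtain u z h' where h: "h = (u, z) # h'" "length h' = n" by (cases h) auto
    obtain a where a: "\<And>\<omega>. H n \<omega> = h' \<longleftrightarrow> (\<forall>j\<in>J n. X j \<omega> = a j)"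
      "(\<Prod>j\<in>J n. pmf (law j) (a j)) = pmf (histories p n) h'"
      using Suc.IH[OF h(2)] by auto
    define b where "b = a(Inl (Suc n) := u, Inr (Suc (Suc n)) := z)"
    have nin: "Inl (Suc n) \<notin> J n" "Inr (Suc (Suc n)) \<notin> J n" by (auto simp: J_def)
    have JS: "J (Suc n) = insert (Inl (Suc n)) (insert (Inr (Suc (Suc n))) (J n))"
      by (auto simp: J_def image_iff atLeastAtMostSuc_conv)
    have ba: "b j = a j" if "j \<in> J n" for j using that nin by (auto simp: b_def)
    have "H (Suc n) \<omega> = h \<longleftrightarrow> (\<forall>j\<in>J (Suc n). X j \<omega> = b j)" for \<omega>
    proof -
      have "H (Suc n) \<omega> = h \<longleftrightarrow> V (Suc n) \<omega> = u \<and> Z (Suc (Suc n)) \<omega> = z \<and> H n \<omega> = h'"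
        by (auto simp: H_def h(1))
      also have "\<dots> \<longleftrightarrow> (\<forall>j\<in>J (Suc n). X j \<omega> = b j)"
        unfolding JS a(1) using ba by (auto simp: X_def b_def)
      finally show ?thesis .
    qed
    moreover have "(\<Prod>j\<in>J (Suc n). pmf (law j) (b j)) = pmf (histories p (Suc n)) h"
    proof -
      have "(\<Prod>j\<in>J n. pmf (law j) (b j)) = (\<Prod>j\<in>J n. pmf (law j) (a j))"
        by (intro prod.cong) (auto simp: ba)
      moreover have "finite (J n)" by (simp add: J_def)
      moreover have l: "law (Inl (Suc n)) = pmf_of_set {0..Suc n}" "law (Inr (Suc (Suc n))) = p"
        "b (Inl (Suc n)) = u" "b (Inr (Suc (Suc n))) = z" by (simp_all add: law_def b_def)
      ultimately show ?thesis
        unfolding JS h(1) pmf_histories_Cons using nin l by (simp add: a(2) mult_ac)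
    qed
    ultimately show ?case by blast
  qed
  have len: "length (H n \<omega>) = n" for n \<omega> by (simp add: H_def)
  have single: "H n -` {h} \<inter> space M \<in> sets M \<and> prob (H n -` {h} \<inter> space M) = pmf (histories p n) h" for n h
  proof (cases "length h = n")
    case False
    then have "H n -` {h} \<inter> space M = {}" using len by auto
    moreover have "pmf (histories p n) h = 0" using False length_histories[of h p n] by (auto simp: pmf_eq_0_set_pmf)
    ultimately show ?thesis by simp
  next
    case True
    then obtain a where a: "\<And>\<omega>. H n \<omega> = h \<longleftrightarrow> (\<forall>j\<in>J n. X j \<omega> = a j)"
      "(\<Prod>j\<in>J n. pmf (law j) (a j)) = pmf (histories p n) h" using cyl by blast
    show ?thesis
    proof (cases "J n = {}")
      case True
      then have "H n -` {h} \<inter> space M = space M" using a(1) by auto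
      then show ?thesis using a(2) True by (simp add: prob_space)
    next
      case False
      have eq: "H n -` {h} \<inter> space M = (\<Inter>j\<in>J n. X j -` {a j} \<inter> space M)" using a(1) False by auto
      have fin: "finite (J n)" by (simp add: J_def)
      have "prob (\<Inter>j\<in>J n. X j -` {a j} \<inter> space M) = (\<Prod>j\<in>J n. prob (X j -` {a j} \<inter> space M))"
        using indep False fin J_sub unfolding X_def by (intro indep_varsD) auto
      also have "\<dots> = (\<Prod>j\<in>J n. pmf (law j) (a j))" by (intro prod.cong refl X_law)
      finally have "prob (H n -` {h} \<inter> space M) = pmf (histories p n) h" unfolding eq a(2) .
      moreover have "H n -` {h} \<inter> space M \<in> sets M"
        unfolding eq using False fin by (intro sets.finite_INT measurable_sets[OF X_meas]) auto
      ultimately show ?thesis by blast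
    qed
  qed
  show meas: "H n \<in> M \<rightarrow>\<^sub>M count_space UNIV"
    using single by (simp add: measurable_count_space_eq2_countable)
  show "distr M (count_space UNIV) (H n) = measure_pmf (histories p n)"
    by (rule measure_eqI_countable[of _ UNIV])
      (auto simp: emeasure_distr meas single emeasure_pmf_single emeasure_eq_measure)
qed

lemma AE_ct_space:
  "AE \<omega> in ct_space p. (\<forall>i. 0 \<le> fst \<omega> i) \<and> 0 \<le> snd (snd \<omega>) \<and> final_population offspring (Some 0) \<omega> \<noteq> {#}"
proof -
  interpret C: prob_space clocks by (rule prob_space_clocks)
  interpret T: prob_space "steps p" by (rule prob_space_steps)
  interpret X: prob_space exp1 by (rule prob_space_exp1)
  interpret TX: pair_prob_space "steps p" exp1 ..
  interpret CTX: pair_prob_space clocks "steps p \<Otimes>\<^sub>M exp1" ..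
  note [measurable] = measurable_ct_coords[unfolded ct_space_def]
  have "AE \<omega> in ct_space p. 0 \<le> fst \<omega> i" for i
    unfolding ct_space_def
  proof (rule CTX.AE_pair_measure)
    show "AE x in clocks. AE y in steps p \<Otimes>\<^sub>M exp1. 0 \<le> fst (x, y) i"
      using AE_clocks_nonneg by eventually_elim (cases i, simp)
  qed measurable
  moreover have "AE \<omega> in ct_space p. 0 \<le> snd (snd \<omega>)"
    unfolding ct_space_def
  proof (rule CTX.AE_pair_measure)
    have "AE y in steps p \<Otimes>\<^sub>M exp1. 0 \<le> snd y"
    proof (rule TX.AE_pair_measure)
      show "AE x in steps p. AE y in exp1. 0 \<le> snd (x, y)" using AE_exp1_nonneg by simp
    qed measurable
    then show "AE x in clocks. AE y in steps p \<Otimes>\<^sub>M exp1. 0 \<le> snd (snd (x, y))" by simp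
  qed measurable
  moreover have "AE \<omega> in ct_space p. final_population offspring (Some 0) \<omega> \<noteq> {#}"
  proof (rule AE_distrD[OF measurable_final_population])
    have "{#} \<notin> set_pmf (urn_limit (\<lambda>x. map_pmf (offspring x) p) (Some 0))"
      by (simp add: set_pmf_iff pmf_urn_limit)
    then show "AE M in distr (ct_space p) (count_space UNIV) (final_population offspring (Some 0)). M \<noteq> {#}"
      unfolding distr_final_population[OF finite_range_offspring] AE_measure_pmf_iff by auto
  qed
  ultimately show ?thesis by (simp add: AE_all_countable)
qed

lemma AE_pagerank_limit:
  "AE \<omega> in ct_space p. pagerank_limit c \<omega> = type_score c (final_population offspring (Some 0) \<omega>)"
  using AE_ct_space
proof eventually_elim
  case (elim \<omega>)
  obtain E Z t where \<omega>: "\<omega> = (E, Z, t)" by (cases \<omega>)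
  have "population offspring (Some 0) E Z t \<noteq> {#}" using elim by (simp add: \<omega> final_population_def)
  then have "finite (yule E t)" using population_eq_empty_iff[of t offspring "Some 0" E Z] elim by (simp add: \<omega>)
  moreover have "0 \<le> E i" for i using elim by (cases i) (simp add: \<omega>)
  ultimately show ?case
    using pagerank_continuous[of E t c Z] elim by (simp add: \<omega> pagerank_limit_def final_population_def)
qed

theorem measure_pagerank_limit:
  "measure (ct_space p) {\<omega> \<in> space (ct_space p). enn2real (pagerank_limit c \<omega>) > r} =
    measure_pmf.prob (limit_type p) {M. enn2real (type_score c M) > r}"
proof -
  interpret prob_space "ct_space p" by (rule prob_space_ct_space)
  let ?f = "final_population offspring (Some 0)" and ?S = "{M. enn2real (type_score c M) > r}"
  have "measure (ct_space p) {\<omega> \<in> space (ct_space p). enn2real (pagerank_limit c \<omega>) > r} =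
      measure (ct_space p) (?f -` ?S \<inter> space (ct_space p))"
  proof (rule finite_measure_eq_AE)
    show "AE \<omega> in ct_space p. \<omega> \<in> {\<omega> \<in> space (ct_space p). enn2real (pagerank_limit c \<omega>) > r} \<longleftrightarrow>
        \<omega> \<in> ?f -` ?S \<inter> space (ct_space p)"
      using AE_pagerank_limit[where p = p and c = c] by eventually_elim auto
    show "{\<omega> \<in> space (ct_space p). enn2real (pagerank_limit c \<omega>) > r} \<in> sets (ct_space p)"
      using measurable_pagerank_limit[of c p] by measurable
    show "?f -` ?S \<inter> space (ct_space p) \<in> sets (ct_space p)"
      by (rule measurable_sets[OF measurable_final_population]) simp
  qed
  also have "\<dots> = measure (distr (ct_space p) (count_space UNIV) ?f) ?S"
    by (rule measure_distr[symmetric]) auto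
  finally show ?thesis
    unfolding distr_final_population[OF finite_range_offspring] limit_type_def .
qed

text \<open>Two errors of at most \<open>1 / (n + 1)\<close>: the root, whose type does not determine its score, and the
  normalization by \<open>n + 1\<close> instead of the number \<open>n + 2\<close> of vertices.\<close>

lemma pagerank_fraction_approx:
  assumes V: "\<And>k. k \<ge> 1 \<Longrightarrow> V k \<le> k"
  shows "\<bar>1 / real (Suc n) * (\<Sum>v\<in>{0..Suc n}. of_bool (enn2real (pagerank c (tree_arcs V Z (Suc n)) v) > r)) -
    type_fraction {M. enn2real (type_score c M) > r} (history_of V Z n)\<bar> \<le> 2 / real (Suc n)"
proof -
  let ?h = "history_of V Z n" and ?S = "{M. enn2real (type_score c M) > r}"
  define F where "F = type_fraction ?S ?h"
  define f where "f v = (of_bool (enn2real (pagerank c (tree_arcs V Z (Suc n)) v) > r) :: real)" for v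
  define g where "g v = (of_bool (fringe_type offspring (Some 0) ?h v \<in> ?S) :: real)" for v
  have "f v = g v" if "v \<in> {Suc 0..Suc n}" for v
    using that pagerank_discrete[OF V, of v n c Z] by (simp add: f_def g_def del: tree_parent.simps)
  then have fg: "sum f {Suc 0..Suc n} = sum g {Suc 0..Suc n}" by (intro sum.cong) auto
  have "{0..Suc n} = insert 0 {Suc 0..Suc n}" by auto
  then have sums: "sum f {0..Suc n} = f 0 + sum f {Suc 0..Suc n}" "sum g {0..Suc n} = g 0 + sum g {Suc 0..Suc n}" by simp_all
  have "{..<n + 2} = {0..Suc n}" by auto
  then have F: "sum g {0..Suc n} = (real n + 2) * F" by (simp add: F_def type_fraction_def g_def)
  have b: "0 \<le> f 0" "f 0 \<le> 1" "0 \<le> g 0" "g 0 \<le> 1" "0 \<le> F" "F \<le> 1"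
    by (auto simp: f_def g_def F_def type_fraction_bounds)
  have "1 / real (Suc n) * sum f {0..Suc n} - F = (f 0 - g 0 + F) / real (Suc n)"
    using sums fg F by (simp add: field_simps)
  moreover have "\<bar>f 0 - g 0 + F\<bar> \<le> 2" using b by (simp add: abs_le_iff)
  ultimately show ?thesis unfolding F_def[symmetric] f_def[symmetric] by (simp add: divide_right_mono del: of_nat_Suc)
qed

theorem corollary3p15:
  fixes M :: "'a measure" and V Z :: "nat \<Rightarrow> 'a \<Rightarrow> nat" and p :: "nat pmf" and c :: real
  assumes "prob_space M"
    and indep: "prob_space.indep_vars M (\<lambda>_. count_space UNIV) (case_sum V Z) ({1..} <+> {1..})"
    and law_V: "\<And>n. n \<ge> 1 \<Longrightarrow> distr M (count_space UNIV) (V n) = measure_pmf (pmf_of_set {0..n})"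
    and law_Z: "\<And>n. n \<ge> 1 \<Longrightarrow> distr M (count_space UNIV) (Z n) = measure_pmf p"
    and mean: "integrable (measure_pmf p) real"
    and c: "0 < c" "c < 1"
  shows "(AE \<omega> in ct_space p. pagerank_limit c \<omega> < \<infinity>) \<and>
    (\<forall>r. isCont (cdf (distr (ct_space p) borel (\<lambda>\<omega>. enn2real (pagerank_limit c \<omega>)))) r \<longrightarrow>
      (\<forall>\<epsilon>>0. (\<lambda>n. measure M {\<omega> \<in> space M.
          \<bar>1 / real n * (\<Sum>v\<in>{0..n}. of_bool
              (enn2real (pagerank c (tree_arcs (\<lambda>k. V k \<omega>) (\<lambda>k. Z k \<omega>) n) v) > r))
           - measure (ct_space p) {\<omega>' \<in> space (ct_space p). enn2real (pagerank_limit c \<omega>') > r}\<bar> > \<epsilon>})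
        \<longlonglongrightarrow> 0))"
proof (intro conjI allI impI)
  interpret prob_space M by fact
  show "AE \<omega> in ct_space p. pagerank_limit c \<omega> < \<infinity>"
    using AE_pagerank_limit[where p = p and c = c] by eventually_elim (metis type_score_finite)
  fix r \<epsilon> :: real
  assume \<epsilon>: "0 < \<epsilon>"
  define S where "S = {M. enn2real (type_score c M) > r}"
  define q where "q = measure_pmf.prob (limit_type p) S"
  define H where "H n \<omega> = history_of (\<lambda>k. V k \<omega>) (\<lambda>k. Z k \<omega>) n" for n \<omega>
  have H: "H n \<in> M \<rightarrow>\<^sub>M count_space UNIV" "distr M (count_space UNIV) (H n) = measure_pmf (histories p n)" for n
    unfolding H_def by (rule distr_history[OF assms(1) indep law_V law_Z]; assumption)+
  have V: "AE \<omega> in M. \<forall>k\<ge>1. V k \<omega> \<le> k"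
    unfolding AE_all_countable
  proof
    fix k
    show "AE \<omega> in M. k \<ge> 1 \<longrightarrow> V k \<omega> \<le> k"
    proof (cases "k \<ge> 1")
      case True
      have meas: "V k \<in> M \<rightarrow>\<^sub>M count_space UNIV"
        using indep True unfolding indep_vars_def by force
      have "AE v in distr M (count_space UNIV) (V k). v \<le> k"
        unfolding law_V[OF True] AE_measure_pmf_iff by simp
      from AE_distrD[OF meas this] show ?thesis by simp
    qed simp
  qed
  let ?A = "\<lambda>n. {\<omega> \<in> space M. \<bar>1 / real n * (\<Sum>v\<in>{0..n}. of_bool
      (enn2real (pagerank c (tree_arcs (\<lambda>k. V k \<omega>) (\<lambda>k. Z k \<omega>) n) v) > r))
      - measure (ct_space p) {\<omega>' \<in> space (ct_space p). enn2real (pagerank_limit c \<omega>') > r}\<bar> > \<epsilon>}"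
  let ?B = "{h. \<bar>type_fraction S h - q\<bar> > \<epsilon> / 2}"
  have bound: "measure M (?A (Suc n)) \<le> measure_pmf.prob (histories p n) ?B" if n: "real (Suc n) \<ge> 4 / \<epsilon>" for n
  proof -
    have "2 / real (Suc n) \<le> \<epsilon> / 2" using n \<epsilon> by (simp add: field_simps)
    note small = this
    have "measure M (?A (Suc n)) \<le> measure M (H n -` ?B \<inter> space M)"
    proof (rule finite_measure_mono_AE)
      show "AE \<omega> in M. \<omega> \<in> ?A (Suc n) \<longrightarrow> \<omega> \<in> H n -` ?B \<inter> space M"
        using V
      proof eventually_elim
        case (elim \<omega>)
        have close: "\<bar>1 / real (Suc n) * (\<Sum>v\<in>{0..Suc n}. of_bool
          (enn2real (pagerank c (tree_arcs (\<lambda>k. V k \<omega>) (\<lambda>k. Z k \<omega>) (Suc n)) v) > r)) - type_fraction S (H n \<omega>)\<bar> \<le> 2 / real (Suc n)"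
          unfolding S_def H_def by (rule pagerank_fraction_approx) (use elim in auto)
        have "\<epsilon> < \<bar>a - q\<bar> \<Longrightarrow> \<bar>a - type_fraction S (H n \<omega>)\<bar> \<le> 2 / real (Suc n) \<Longrightarrow>
          \<epsilon> / 2 < \<bar>type_fraction S (H n \<omega>) - q\<bar>" for a
          using small by linarith
        from this[OF _ close] show ?case
          unfolding measure_pagerank_limit S_def[symmetric] q_def[symmetric] by blast
      qed
      show "H n -` ?B \<inter> space M \<in> sets M" by (rule measurable_sets[OF H(1)]) simp
    qed
    also have "\<dots> = measure (distr M (count_space UNIV) (H n)) ?B"
      by (rule measure_distr[symmetric]) (use H in auto)
    finally show ?thesis unfolding H(2) .
  qed
  have lim: "(\<lambda>n. measure_pmf.prob (histories p n) ?B) \<longlonglongrightarrow> 0"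
    unfolding q_def by (rule type_fraction_converges) (use \<epsilon> in simp)
  have "(\<lambda>n. measure M (?A (Suc n))) \<longlonglongrightarrow> 0"
  proof (rule tendsto_sandwich[OF _ _ tendsto_const lim])
    have "\<forall>\<^sub>F n in sequentially. real (Suc n) \<ge> 4 / \<epsilon>"
      by (intro eventually_sequentiallyI[of "nat \<lceil>4 / \<epsilon>\<rceil>"]) linarith
    then show "\<forall>\<^sub>F n in sequentially. measure M (?A (Suc n)) \<le> measure_pmf.prob (histories p n) ?B"
      by eventually_elim (rule bound)
  qed simp
  then show "(\<lambda>n. measure M (?A n)) \<longlonglongrightarrow> 0" by (rule LIMSEQ_imp_Suc)
qed

end
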